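(* Let $p:(\Sigma,\pi_\Sigma)\to(M,\pi_M)$ be a Poisson submersion with Poisson fibres. Then the preimage under $p$ of every symplectic leaf of $(M,\pi_M)$ is a Poisson submanifold of $(\Sigma,\pi_\Sigma)$, and for each $x\in\Sigma$ the map $p$ restricts to a coupling Poisson submersion $$p|_{\mathrm S_\Sigma(x)}:(\mathrm S_\Sigma(x),\omega_{\mathrm S_\Sigma(x)})\to(\mathrm S_M(p(x)),\omega_{\mathrm S_M(p(x))})$$ between the symplectic leaf of $(\Sigma,\pi_\Sigma)$ through $x$ and the symplectic leaf of $(M,\pi_M)$ through $p(x)$ (this restriction is not required to be surjective).
   Context: Everything is smooth. For a Poisson manifold $(M,\pi_M)$, $\pi_M^\sharp:T^*M\to TM$ is contraction with $\pi_M$, and $\mathrm{Gr}(\pi_M)=\{\pi_M^\sharp(\xi)+\xi\}$. $\mathrm S_M(x)$ denotes the symplectic leaf through $x$ and $\omega_{\mathrm S_M(x)}$ its symplectic form. A Poisson submersion is a submersion between Poisson manifolds which is a Poisson map. A submanifold $i:X\to M$ is a Poisson-Dirac submanifold of $(M,\pi_M)$ if $i^!\mathrm{Gr}(\pi_M):=\{u+i^*\xi : i_*u=\pi_M^\sharp(\xi)\}$ equals $\mathrm{Gr}(\pi_X)$ for a (unique, automatically Poisson) smooth bivector $\pi_X$ on $X$. A submersion $p:(\Sigma,\pi_\Sigma)\to M$ has Poisson fibres if each fibre is a Poisson-Dirac submanifold of $(\Sigma,\pi_\Sigma)$. A (possibly only initial, immersed) submanifold $X$ is a Poisson submanifold if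 $\pi_M^\sharp(T^*M|_X)\subset TX$. It is a Poisson transversal if $TM|_X=TX\oplus\pi_M^\sharp(N^*X)$, where $N^*X$ is the annihilator of $TX$. A submersion $p:(\Sigma,\pi_\Sigma)\to M$ from a Poisson manifold is coupling if its fibres are Poisson transversals in $(\Sigma,\pi_\Sigma)$. *)

theory Defs
  imports "HOL-Analysis.Analysis"
begin

section \<open>Smooth maps between subsets of Euclidean spaces\<close>

primrec Ck_on :: "nat \<Rightarrow> 'e::euclidean_space set \<Rightarrow> ('e \<Rightarrow> 'f::euclidean_space) \<Rightarrow> bool" where
  "Ck_on 0 U f \<longleftrightarrow> continuous_on U f"
| "Ck_on (Suc k) U f \<longleftrightarrow>
     (\<forall>x\<in>U. f differentiable (at x)) \<and> (\<forall>v. Ck_on k U (\<lambda>x. frechet_derivative f (at x) v))"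

text \<open>On an arbitrary set \<open>S\<close>, smoothness means local extendability to a smooth map on an open set.
  This is what allows charts with values in proper linear subspaces of \<open>'e\<close>.\<close>

definition smooth_on :: "'e::euclidean_space set \<Rightarrow> ('e \<Rightarrow> 'f::euclidean_space) \<Rightarrow> bool" where
  "smooth_on S f \<longleftrightarrow>
     (\<forall>x\<in>S. \<exists>U g. open U \<and> x \<in> U \<and> (\<forall>k. Ck_on k U g) \<and> (\<forall>y\<in>S \<inter> U. g y = f y))"


section \<open>Smooth manifolds\<close>

text \<open>A chart is a pair of a domain and a map, injective on the domain, whose image is open in
  some linear subspace of \<open>'e\<close>. Hence \<open>'e\<close> only bounds the dimension of a manifold, and a manifold
  and its submanifolds of lower dimension can be modelled on the same type.\<close>

type_synonym ('a, 'e) chart = "'a set \<times> ('a \<Rightarrow> 'e)"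

record ('a, 'e) mfd =
  pts :: "'a set"
  atlas :: "('a, 'e) chart set"

definition chart_of_dim :: "nat \<Rightarrow> ('a, 'e::euclidean_space) chart \<Rightarrow> bool" where
  "chart_of_dim d = (\<lambda>(U, \<phi>). inj_on \<phi> U \<and>
     (\<exists>W. subspace W \<and> dim W = d \<and> openin (top_of_set W) (\<phi> ` U)))"

definition compatible :: "('a, 'e::euclidean_space) chart \<Rightarrow> ('a, 'e) chart \<Rightarrow> bool" where
  "compatible = (\<lambda>(U, \<phi>) (V, \<psi>).
     openin (top_of_set (\<phi> ` U)) (\<phi> ` (U \<inter> V)) \<and>
     smooth_on (\<phi> ` (U \<inter> V)) (\<psi> \<circ> inv_into U \<phi>))"

text \<open>The manifold topology is the one for which all charts are homeomorphisms onto their images;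
  for a submanifold it is in general finer than the subspace topology.\<close>

definition mtop :: "('a, 'e::euclidean_space) mfd \<Rightarrow> 'a topology" where
  "mtop M = topology (\<lambda>A. A \<subseteq> pts M \<and>
     (\<forall>(U, \<phi>)\<in>atlas M. \<exists>T. open T \<and> A \<inter> U = U \<inter> \<phi> -` T))"

lemma openin_mtop:
  "openin (mtop M) A \<longleftrightarrow>
     A \<subseteq> pts M \<and> (\<forall>(U, \<phi>)\<in>atlas M. \<exists>T. open T \<and> A \<inter> U = U \<inter> \<phi> -` T)"
proof -
  define P where "P A \<longleftrightarrow> A \<subseteq> pts M \<and>
    (\<forall>(U, \<phi>)\<in>atlas M. \<exists>T. open T \<and> A \<inter> U = U \<inter> \<phi> -` T)" for A
  have PD: "\<exists>T. open T \<and> A \<inter> U = U \<inter> \<phi> -` T" if "P A" "(U, \<phi>) \<in> atlas M" for A U \<phi>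
    using bspec[OF conjunct2[OF that(1)[unfolded P_def]] that(2)] unfolding prod.case .
  have PI: "P A" if "A \<subseteq> pts M"
    "\<And>U \<phi>. (U, \<phi>) \<in> atlas M \<Longrightarrow> \<exists>T. open T \<and> A \<inter> U = U \<inter> \<phi> -` T" for A
    unfolding P_def
  proof (intro conjI ballI)
    show "A \<subseteq> pts M" by (rule that(1))
    fix c assume "c \<in> atlas M"
    then show "case c of (U, \<phi>) \<Rightarrow> \<exists>T. open T \<and> A \<inter> U = U \<inter> \<phi> -` T"
      using that(2)[of "fst c" "snd c"] by (simp only: prod.collapse case_prod_beta)
  qed
  have Psub: "A \<subseteq> pts M" if "P A" for A
    using that[unfolded P_def] by (rule conjunct1)
  have "istopology P"
    unfolding istopology_def
  proof (intro conjI allI impI)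
    fix A B assume A: "P A" and B: "P B"
    show "P (A \<inter> B)"
    proof (rule PI)
      show "A \<inter> B \<subseteq> pts M" by (rule order_trans[OF Int_lower1 Psub[OF A]])
      fix U \<phi> assume c: "(U, \<phi>) \<in> atlas M"
      obtain T where T: "open T" "A \<inter> U = U \<inter> \<phi> -` T" using PD[OF A c] by metis
      obtain T' where T': "open T'" "B \<inter> U = U \<inter> \<phi> -` T'" using PD[OF B c] by metis
      have "A \<inter> B \<inter> U = (A \<inter> U) \<inter> (B \<inter> U)" by blast
      then have "A \<inter> B \<inter> U = U \<inter> \<phi> -` (T \<inter> T')"
        unfolding T(2) T'(2) by blast
      then show "\<exists>T. open T \<and> A \<inter> B \<inter> U = U \<inter> \<phi> -` T"
        using open_Int[OF T(1) T'(1)] by metis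
    qed
  next
    fix K assume K: "\<forall>A\<in>K. P A"
    show "P (\<Union>K)"
    proof (rule PI)
      show "\<Union>K \<subseteq> pts M" by (rule Union_least, rule Psub, rule bspec[OF K])
      fix U \<phi> assume c: "(U, \<phi>) \<in> atlas M"
      have "\<forall>A\<in>K. \<exists>T. open T \<and> A \<inter> U = U \<inter> \<phi> -` T" by (rule ballI, rule PD[OF bspec[OF K] c])
      then obtain T where T: "\<And>A. A \<in> K \<Longrightarrow> open (T A)" "\<And>A. A \<in> K \<Longrightarrow> A \<inter> U = U \<inter> \<phi> -` T A"
        by metis
      have "\<Union>K \<inter> U = (\<Union>A\<in>K. A \<inter> U)" by (rule Int_Union2)
      also have "\<dots> = (\<Union>A\<in>K. U \<inter> \<phi> -` T A)" using T(2) by (rule SUP_cong[OF refl])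
      also have "\<dots> = U \<inter> \<phi> -` (\<Union>A\<in>K. T A)" by (simp only: vimage_UN Int_UN_distrib)
      finally show "\<exists>T. open T \<and> \<Union>K \<inter> U = U \<inter> \<phi> -` T"
        using T(1) open_UN[of K T] by metis
    qed
  qed
  then have "openin (topology P) A = P A" by simp
  then show ?thesis unfolding mtop_def P_def .
qed

definition smooth_manifold :: "('a, 'e::euclidean_space) mfd \<Rightarrow> bool" where
  "smooth_manifold M \<longleftrightarrow>
     (\<Union>c\<in>atlas M. fst c) = pts M \<and>
     (\<exists>d. \<forall>c\<in>atlas M. chart_of_dim d c) \<and>
     (\<forall>c\<in>atlas M. \<forall>c'\<in>atlas M. compatible c c') \<and>
     Hausdorff_space (mtop M) \<and> second_countable (mtop M)"

definition max_atlas :: "('a, 'e::euclidean_space) mfd \<Rightarrow> ('a, 'e) chart set" where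
  "max_atlas M = {c. fst c \<subseteq> pts M \<and> (\<exists>d. chart_of_dim d c) \<and>
     (\<forall>c'\<in>atlas M. compatible c c' \<and> compatible c' c)}"

definition smooth_map ::
  "('a, 'e::euclidean_space) mfd \<Rightarrow> ('b, 'f::euclidean_space) mfd \<Rightarrow> ('a \<Rightarrow> 'b) \<Rightarrow> bool" where
  "smooth_map N M p \<longleftrightarrow> continuous_map (mtop N) (mtop M) p \<and>
     (\<forall>(U, \<phi>)\<in>atlas N. \<forall>(V, \<psi>)\<in>atlas M.
        smooth_on (\<phi> ` (U \<inter> p -` V)) (\<psi> \<circ> p \<circ> inv_into U \<phi>))"

definition smooth_fun_on :: "('a, 'e::euclidean_space) mfd \<Rightarrow> 'a set \<Rightarrow> ('a \<Rightarrow> real) \<Rightarrow> bool" where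
  "smooth_fun_on M A f \<longleftrightarrow> (\<forall>(U, \<phi>)\<in>atlas M. smooth_on (\<phi> ` (A \<inter> U)) (f \<circ> inv_into U \<phi>))"

definition smooth_at :: "('a, 'e::euclidean_space) mfd \<Rightarrow> 'a \<Rightarrow> ('a \<Rightarrow> real) \<Rightarrow> bool" where
  "smooth_at M x f \<longleftrightarrow> (\<exists>U. openin (mtop M) U \<and> x \<in> U \<and> smooth_fun_on M U f)"

definition real_line :: "(real, real) mfd" where
  "real_line = \<lparr>pts = UNIV, atlas = {(UNIV, \<lambda>t. t)}\<rparr>"

abbreviation smooth_curve :: "('a, 'e::euclidean_space) mfd \<Rightarrow> (real \<Rightarrow> 'a) \<Rightarrow> bool" where
  "smooth_curve M c \<equiv> smooth_map real_line M c"


section \<open>Tangent and cotangent spaces\<close>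

text \<open>A tangent vector at \<open>x\<close> is the velocity of a smooth curve through \<open>x\<close>, represented by its
  action on the functions that are smooth near \<open>x\<close>; on all other functions its value is fixed
  to be \<open>0\<close>. Vector space operations are pointwise. Covectors are likewise extended by \<open>0\<close>
  outside the tangent space.\<close>

type_synonym 'a tvec = "('a \<Rightarrow> real) \<Rightarrow> real"
type_synonym 'a covec = "'a tvec \<Rightarrow> real"

definition velocity :: "('a, 'e::euclidean_space) mfd \<Rightarrow> (real \<Rightarrow> 'a) \<Rightarrow> 'a tvec" where
  "velocity M c = (\<lambda>f. if smooth_at M (c 0) f then deriv (\<lambda>t. f (c t)) 0 else 0)"

definition tangent :: "('a, 'e::euclidean_space) mfd \<Rightarrow> 'a \<Rightarrow> 'a tvec set" where
  "tangent M x = {velocity M c | c. smooth_curve M c \<and> c 0 = x}"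

definition cotangent :: "('a, 'e::euclidean_space) mfd \<Rightarrow> 'a \<Rightarrow> 'a covec set" where
  "cotangent M x = {\<xi>. (\<forall>v. v \<notin> tangent M x \<longrightarrow> \<xi> v = 0) \<and>
     (\<forall>u\<in>tangent M x. \<forall>v\<in>tangent M x. \<forall>a b.
        \<xi> (\<lambda>f. a * u f + b * v f) = a * \<xi> u + b * \<xi> v)}"

definition differential :: "('a, 'e::euclidean_space) mfd \<Rightarrow> ('a \<Rightarrow> real) \<Rightarrow> 'a \<Rightarrow> 'a covec" where
  "differential M f x = (\<lambda>v. if v \<in> tangent M x then v f else 0)"

text \<open>\<open>push M p x\<close> and \<open>pull N M p x\<close> are the tangent map of \<open>p : N \<rightarrow> M\<close> at \<open>x\<close> and its transpose.\<close>

definition push :: "('b, 'f::euclidean_space) mfd \<Rightarrow> ('a \<Rightarrow> 'b) \<Rightarrow> 'a \<Rightarrow> 'a tvec \<Rightarrow> 'b tvec" where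
  "push M p x v = (\<lambda>f. if smooth_at M (p x) f then v (f \<circ> p) else 0)"

definition pull ::
  "('a, 'e::euclidean_space) mfd \<Rightarrow> ('b, 'f::euclidean_space) mfd \<Rightarrow> ('a \<Rightarrow> 'b) \<Rightarrow> 'a \<Rightarrow>
   'b covec \<Rightarrow> 'a covec" where
  "pull N M p x \<xi> = (\<lambda>v. if v \<in> tangent N x then \<xi> (push M p x v) else 0)"

definition submersion ::
  "('a, 'e::euclidean_space) mfd \<Rightarrow> ('b, 'f::euclidean_space) mfd \<Rightarrow> ('a \<Rightarrow> 'b) \<Rightarrow> bool" where
  "submersion N M p \<longleftrightarrow> smooth_map N M p \<and>
     (\<forall>x\<in>pts N. push M p x ` tangent N x = tangent M (p x))"


section \<open>Submanifolds\<close>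

text \<open>Initial submanifolds in the sense of Kriegl and Michor: \<open>smooth_component M A x\<close> consists of
  the points of \<open>A\<close> which can be joined to \<open>x\<close> by a smooth curve of \<open>M\<close> lying in \<open>A\<close>, and a subset
  \<open>X\<close> is an initial submanifold if around each of its points \<open>x\<close> there is a chart \<open>(U, \<phi>)\<close> of \<open>M\<close>
  that maps the component of \<open>x\<close> in \<open>U \<inter> X\<close> onto \<open>\<phi> ` U \<inter> W\<close> for a linear subspace \<open>W\<close>. These
  components, with the restrictions of the \<open>\<phi>\<close>, are the charts of the manifold structure
  \<open>submfd M X\<close> of \<open>X\<close>, which is thus determined by the subset.\<close>

definition smooth_component :: "('a, 'e::euclidean_space) mfd \<Rightarrow> 'a set \<Rightarrow> 'a \<Rightarrow> 'a set" where
  "smooth_component M A x = {y. \<exists>c. smooth_curve M c \<and> range c \<subseteq> A \<and> c 0 = x \<and> c 1 = y}"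

definition submfd :: "('a, 'e::euclidean_space) mfd \<Rightarrow> 'a set \<Rightarrow> ('a, 'e) mfd" where
  "submfd M X = \<lparr>pts = X,
     atlas = {(smooth_component M (U \<inter> X) x, \<phi>) | U \<phi> x. x \<in> U \<inter> X \<and> (U, \<phi>) \<in> max_atlas M \<and>
       (\<exists>W. subspace W \<and> \<phi> ` smooth_component M (U \<inter> X) x = \<phi> ` U \<inter> W)}\<rparr>"

text \<open>Being a manifold includes that the chart domains of \<open>submfd M X\<close> cover \<open>X\<close>, which is the
  condition above.\<close>

definition initial_submanifold :: "('a, 'e::euclidean_space) mfd \<Rightarrow> 'a set \<Rightarrow> bool" where
  "initial_submanifold M X \<longleftrightarrow> X \<subseteq> pts M \<and> smooth_manifold (submfd M X)"

definition embedded_submanifold :: "('a, 'e::euclidean_space) mfd \<Rightarrow> 'a set \<Rightarrow> bool" where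
  "embedded_submanifold M X \<longleftrightarrow>
     initial_submanifold M X \<and> mtop (submfd M X) = subtopology (mtop M) X"

abbreviation incl_push :: "('a, 'e::euclidean_space) mfd \<Rightarrow> 'a \<Rightarrow> 'a tvec \<Rightarrow> 'a tvec" where
  "incl_push M x \<equiv> push M (\<lambda>y. y) x"

text \<open>\<open>TX\<close> and its annihilator, at \<open>x\<close>, inside \<open>TM\<close> and \<open>T\<^sup>*M\<close>:\<close>

definition tangent_sub :: "('a, 'e::euclidean_space) mfd \<Rightarrow> 'a set \<Rightarrow> 'a \<Rightarrow> 'a tvec set" where
  "tangent_sub M X x = incl_push M x ` tangent (submfd M X) x"

definition conormal :: "('a, 'e::euclidean_space) mfd \<Rightarrow> 'a set \<Rightarrow> 'a \<Rightarrow> 'a covec set" where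
  "conormal M X x = {\<xi> \<in> cotangent M x. \<forall>v\<in>tangent_sub M X x. \<xi> v = 0}"


section \<open>Poisson manifolds\<close>

text \<open>A bivector at \<open>x\<close> is an alternating bilinear form on the cotangent space at \<open>x\<close>.\<close>

type_synonym 'a bivector = "'a \<Rightarrow> 'a covec \<Rightarrow> 'a covec \<Rightarrow> real"

definition bracket ::
  "('a, 'e::euclidean_space) mfd \<Rightarrow> 'a bivector \<Rightarrow> ('a \<Rightarrow> real) \<Rightarrow> ('a \<Rightarrow> real) \<Rightarrow> 'a \<Rightarrow> real" where
  "bracket M \<pi> f g = (\<lambda>x. \<pi> x (differential M f x) (differential M g x))"

definition smooth_bivector :: "('a, 'e::euclidean_space) mfd \<Rightarrow> 'a bivector \<Rightarrow> bool" where
  "smooth_bivector M \<pi> \<longleftrightarrow>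
     (\<forall>x\<in>pts M. \<forall>\<xi>\<in>cotangent M x. \<forall>\<eta>\<in>cotangent M x. \<forall>\<zeta>\<in>cotangent M x. \<forall>a b.
        \<pi> x \<xi> \<xi> = 0 \<and> \<pi> x \<xi> \<eta> = - \<pi> x \<eta> \<xi> \<and>
        \<pi> x (\<lambda>v. a * \<xi> v + b * \<eta> v) \<zeta> = a * \<pi> x \<xi> \<zeta> + b * \<pi> x \<eta> \<zeta>) \<and>
     (\<forall>U f g. openin (mtop M) U \<longrightarrow> smooth_fun_on M U f \<longrightarrow> smooth_fun_on M U g \<longrightarrow>
        smooth_fun_on M U (bracket M \<pi> f g))"

definition poisson_manifold :: "('a, 'e::euclidean_space) mfd \<Rightarrow> 'a bivector \<Rightarrow> bool" where
  "poisson_manifold M \<pi> \<longleftrightarrow> smooth_manifold M \<and> smooth_bivector M \<pi> \<and>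
     (\<forall>U f g h. openin (mtop M) U \<longrightarrow>
        smooth_fun_on M U f \<longrightarrow> smooth_fun_on M U g \<longrightarrow> smooth_fun_on M U h \<longrightarrow>
        (\<forall>x\<in>U. bracket M \<pi> f (bracket M \<pi> g h) x + bracket M \<pi> g (bracket M \<pi> h f) x
               + bracket M \<pi> h (bracket M \<pi> f g) x = 0))"

text \<open>Contraction in the first argument: \<open>\<langle>\<eta>, \<pi>\<^sup>\<sharp>(\<xi>)\<rangle> = \<pi>(\<xi>, \<eta>)\<close>.\<close>

definition sharp ::
  "('a, 'e::euclidean_space) mfd \<Rightarrow> 'a bivector \<Rightarrow> 'a \<Rightarrow> 'a covec \<Rightarrow> 'a tvec" where
  "sharp M \<pi> x \<xi> = (THE v. v \<in> tangent M x \<and> (\<forall>\<eta>\<in>cotangent M x. \<eta> v = \<pi> x \<xi> \<eta>))"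

definition poisson_map ::
  "('a, 'e::euclidean_space) mfd \<Rightarrow> 'a bivector \<Rightarrow> ('b, 'f::euclidean_space) mfd \<Rightarrow> 'b bivector \<Rightarrow>
   ('a \<Rightarrow> 'b) \<Rightarrow> bool" where
  "poisson_map N \<pi>\<^sub>N M \<pi>\<^sub>M p \<longleftrightarrow> smooth_map N M p \<and>
     (\<forall>x\<in>pts N. \<forall>\<xi>\<in>cotangent M (p x). \<forall>\<eta>\<in>cotangent M (p x).
        \<pi>\<^sub>N x (pull N M p x \<xi>) (pull N M p x \<eta>) = \<pi>\<^sub>M (p x) \<xi> \<eta>)"

definition poisson_submersion ::
  "('a, 'e::euclidean_space) mfd \<Rightarrow> 'a bivector \<Rightarrow> ('b, 'f::euclidean_space) mfd \<Rightarrow> 'b bivector \<Rightarrow>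
   ('a \<Rightarrow> 'b) \<Rightarrow> bool" where
  "poisson_submersion N \<pi>\<^sub>N M \<pi>\<^sub>M p \<longleftrightarrow>
     poisson_manifold N \<pi>\<^sub>N \<and> poisson_manifold M \<pi>\<^sub>M \<and>
     submersion N M p \<and> poisson_map N \<pi>\<^sub>N M \<pi>\<^sub>M p"


section \<open>Submanifolds of Poisson manifolds\<close>

definition gr ::
  "('a, 'e::euclidean_space) mfd \<Rightarrow> 'a bivector \<Rightarrow> 'a \<Rightarrow> ('a tvec \<times> 'a covec) set" where
  "gr M \<pi> x = {(sharp M \<pi> x \<xi>, \<xi>) | \<xi>. \<xi> \<in> cotangent M x}"

text \<open>\<open>i\<^sup>!Gr(\<pi>)\<close> at \<open>x\<close>, for the inclusion \<open>i : X \<rightarrow> M\<close>:\<close>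

definition gr_pullback ::
  "('a, 'e::euclidean_space) mfd \<Rightarrow> 'a bivector \<Rightarrow> 'a set \<Rightarrow> 'a \<Rightarrow> ('a tvec \<times> 'a covec) set" where
  "gr_pullback M \<pi> X x = {(u, pull (submfd M X) M (\<lambda>y. y) x \<xi>) | u \<xi>.
     u \<in> tangent (submfd M X) x \<and> \<xi> \<in> cotangent M x \<and> incl_push M x u = sharp M \<pi> x \<xi>}"

definition poisson_dirac :: "('a, 'e::euclidean_space) mfd \<Rightarrow> 'a bivector \<Rightarrow> 'a set \<Rightarrow> bool" where
  "poisson_dirac M \<pi> X \<longleftrightarrow> embedded_submanifold M X \<and>
     (\<exists>\<pi>\<^sub>X. smooth_bivector (submfd M X) \<pi>\<^sub>X \<and>
        (\<forall>x\<in>X. gr_pullback M \<pi> X x = gr (submfd M X) \<pi>\<^sub>X x))"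

definition poisson_submanifold ::
  "('a, 'e::euclidean_space) mfd \<Rightarrow> 'a bivector \<Rightarrow> 'a set \<Rightarrow> bool" where
  "poisson_submanifold M \<pi> X \<longleftrightarrow> initial_submanifold M X \<and>
     (\<forall>x\<in>X. sharp M \<pi> x ` cotangent M x \<subseteq> tangent_sub M X x)"

definition poisson_transversal ::
  "('a, 'e::euclidean_space) mfd \<Rightarrow> 'a bivector \<Rightarrow> 'a set \<Rightarrow> bool" where
  "poisson_transversal M \<pi> X \<longleftrightarrow> embedded_submanifold M X \<and>
     (\<forall>x\<in>X. \<forall>u\<in>tangent_sub M X x. \<forall>v\<in>sharp M \<pi> x ` conormal M X x.
        (\<lambda>f. u f + v f) \<in> tangent M x) \<and>
     (\<forall>x\<in>X. \<forall>w\<in>tangent M x. \<exists>!(u, v).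
        u \<in> tangent_sub M X x \<and> v \<in> sharp M \<pi> x ` conormal M X x \<and> w = (\<lambda>f. u f + v f))"

definition poisson_fibres ::
  "('a, 'e::euclidean_space) mfd \<Rightarrow> 'a bivector \<Rightarrow> ('a \<Rightarrow> 'b) \<Rightarrow> bool" where
  "poisson_fibres N \<pi> p \<longleftrightarrow> (\<forall>y\<in>p ` pts N. poisson_dirac N \<pi> {x \<in> pts N. p x = y})"

definition coupling ::
  "('a, 'e::euclidean_space) mfd \<Rightarrow> 'a bivector \<Rightarrow> ('b, 'f::euclidean_space) mfd \<Rightarrow> ('a \<Rightarrow> 'b) \<Rightarrow>
   bool" where
  "coupling N \<pi> M p \<longleftrightarrow> poisson_manifold N \<pi> \<and> submersion N M p \<and>
     (\<forall>y\<in>p ` pts N. poisson_transversal N \<pi> {x \<in> pts N. p x = y})"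


section \<open>Symplectic leaves\<close>

text \<open>\<open>symplectic_leaves M \<pi> S\<close> says that \<open>S x\<close> is the symplectic leaf through \<open>x\<close>, for each \<open>x\<close>:
  the leaves are the members of the partition of \<open>M\<close> into connected initial submanifolds whose
  tangent spaces are the images of \<open>\<pi>\<^sup>\<sharp>\<close>. By a theorem of Weinstein, every Poisson manifold has
  exactly one such partition.\<close>

definition symplectic_leaves ::
  "('a, 'e::euclidean_space) mfd \<Rightarrow> 'a bivector \<Rightarrow> ('a \<Rightarrow> 'a set) \<Rightarrow> bool" where
  "symplectic_leaves M \<pi> S \<longleftrightarrow>
     (\<forall>x\<in>pts M. x \<in> S x \<and> (\<forall>y\<in>S x. S y = S x) \<and>
        initial_submanifold M (S x) \<and> connected_space (mtop (submfd M (S x))) \<and>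
        (\<forall>y\<in>S x. tangent_sub M (S x) y = sharp M \<pi> y ` cotangent M y))"

text \<open>The symplectic form on a leaf: \<open>\<omega>(u, v) = \<langle>\<xi>, v\<rangle>\<close> whenever \<open>u = \<pi>\<^sup>\<sharp>(\<xi>)\<close>. It is independent of
  the choice of \<open>\<xi>\<close>, because \<open>v\<close> is in the image of \<open>\<pi>\<^sup>\<sharp>\<close> as well.\<close>

definition leaf_form ::
  "('a, 'e::euclidean_space) mfd \<Rightarrow> 'a bivector \<Rightarrow> 'a \<Rightarrow> 'a tvec \<Rightarrow> 'a tvec \<Rightarrow> real" where
  "leaf_form M \<pi> y u v =
     (SOME \<xi>. \<xi> \<in> cotangent M y \<and> sharp M \<pi> y \<xi> = incl_push M y u) (incl_push M y v)"

text \<open>A symplectic manifold is regarded as a Poisson manifold by means of the bivector with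
  \<open>\<pi>\<^sup>\<sharp>(\<omega>(u, \<cdot>)) = u\<close>, that is, \<open>Gr(\<pi>) = {u + \<omega>(u, \<cdot>)}\<close>.\<close>

definition form_bivector ::
  "('a, 'e::euclidean_space) mfd \<Rightarrow> ('a \<Rightarrow> 'a tvec \<Rightarrow> 'a tvec \<Rightarrow> real) \<Rightarrow> 'a bivector" where
  "form_bivector N \<omega> x \<xi> \<eta> =
     \<eta> (THE u. u \<in> tangent N x \<and> (\<forall>v\<in>tangent N x. \<omega> x u v = \<xi> v))"

definition leaf_bivector ::
  "('a, 'e::euclidean_space) mfd \<Rightarrow> 'a bivector \<Rightarrow> 'a set \<Rightarrow> 'a bivector" where
  "leaf_bivector M \<pi> L = form_bivector (submfd M L) (leaf_form M \<pi>)"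

end

theory Submission
  imports Defs
begin

text \<open>
  Since the fibres are Poisson-Dirac, every covector \<open>\<eta>\<close> on \<open>\<Sigma>\<close> is \<open>\<xi> + p\<^sup>*\<zeta>\<close> with \<open>\<pi>\<^sub>\<Sigma>\<^sup>\<sharp>(\<xi>)\<close> tangent
  to the fibre. As \<open>p\<close> is a Poisson map, \<open>p\<^sub>*\<close> sends \<open>\<pi>\<^sub>\<Sigma>\<^sup>\<sharp>(\<eta>)\<close> to \<open>\<pi>\<^sub>M\<^sup>\<sharp>(\<zeta>)\<close>. Hence the image of \<open>\<pi>\<^sub>\<Sigma>\<^sup>\<sharp>\<close> is tangent
  to the preimage of each leaf of \<open>M\<close>, which is an initial submanifold because \<open>p\<close> is linear in suitable
  charts. The same decomposition, applied to covectors on a leaf \<open>S\<close> of \<open>\<Sigma>\<close>, gives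
  \<open>TS = T(fibre) \<oplus> \<pi>\<^sup>\<sharp>(N\<^sup>*(fibre))\<close> and the surjectivity of \<open>p\<^sub>*\<close> onto the tangent space of a leaf of \<open>M\<close>.
  That \<open>p\<close> maps \<open>S\<close> into one leaf \<open>L\<close> is obtained without flows of Hamiltonian vector fields: along a
  curve in \<open>S\<close>, the coordinates transverse to \<open>L\<close> satisfy a linear differential inequality, so they vanish
  on a neighbourhood of each point where they vanish once, and \<open>S\<close> is connected.
\<close>

section \<open>Calculus of smooth maps\<close>

text \<open>A graph contains a pair over every covector, so the restriction of \<eta> to a fibre is
  also the restriction of some \<xi> whose image under \<open>sharp\<close> is vertical; the
  difference \<eta> - \<xi> kills the vertical vectors and is therefore a pullback from M. What
  shapes the rest is that a leaf is only an initial submanifold: its topology may be finer than the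
  induced one, and an open set of the ambient manifold may meet it in many sheets. Only smooth
  curves tell the sheets apart, so charts, smooth maps into a leaf and tangent spaces are all
  handled by curves. To differentiate a transverse coordinate along such a curve, the velocity has
  to be the image of a covector of controlled size; a lower bound for the bracket matrix of a leaf
  chart provides this control, and a Lipschitz estimate bounds the brackets by the transverse
  coordinates. Fibres need no theory of their own: a point is a submanifold, so the lemmas on
  preimages serve the preimages of leaves, the fibres of p, and again the fibres of p restricted to
  a leaf once this restriction is known to be a submersion.\<close>

lemma Ck_on_subset: "Ck_on k U f \<Longrightarrow> V \<subseteq> U \<Longrightarrow> Ck_on k V f"
proof (induction k arbitrary: f)
  case 0
  then show ?case by (auto intro: continuous_on_subset)
next
  case (Suc k)
  then show ?case by auto
qed

lemma Ck_on_SucD: "Ck_on (Suc k) U f \<Longrightarrow> Ck_on k U f"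
proof (induction k arbitrary: f)
  case 0
  then show ?case
    by (auto intro!: continuous_at_imp_continuous_on differentiable_imp_continuous_within)
qed auto

lemma Ck_on_Suc_has_derivative:
  "Ck_on (Suc k) U f \<Longrightarrow> x \<in> U \<Longrightarrow> (f has_derivative frechet_derivative f (at x)) (at x)"
  by (auto simp: frechet_derivative_works)

lemma Ck_on_cong:
  assumes "open U" "Ck_on k U f" "\<And>x. x \<in> U \<Longrightarrow> f x = g x"
  shows "Ck_on k U g"
  using assms
proof (induction k arbitrary: f g)
  case 0
  then show ?case by (auto cong: continuous_on_cong)
next
  case (Suc k)
  have d: "(g has_derivative frechet_derivative f (at x)) (at x)" if "x \<in> U" for x
    by (rule has_derivative_transform_within_open
        [OF Ck_on_Suc_has_derivative[OF Suc.prems(2) that] Suc.prems(1) that Suc.prems(3)])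
  have eq: "frechet_derivative g (at x) = frechet_derivative f (at x)" if "x \<in> U" for x
    using frechet_derivative_at[OF d[OF that]] by simp
  have "Ck_on k U (\<lambda>x. frechet_derivative g (at x) v)" for v
    by (rule Suc.IH[of "\<lambda>x. frechet_derivative f (at x) v"]) (use Suc.prems(1,2) eq in auto)
  then show ?case using d unfolding Ck_on.simps differentiable_def by blast
qed

text \<open>Successor step of the inductions on k below. \<open>Ck_on\<close> refers to the
  derivative selected by \<open>frechet_derivative\<close>; on an open set uniqueness of derivatives
  lets an explicit formula f' take its place.\<close>

lemma Ck_on_SucI:
  assumes "open U" "\<And>x. x \<in> U \<Longrightarrow> (f has_derivative f' x) (at x)" "\<And>v. Ck_on k U (\<lambda>x. f' x v)"
  shows "Ck_on (Suc k) U f"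
proof -
  have "frechet_derivative f (at x) = f' x" if "x \<in> U" for x
    using frechet_derivative_at[OF assms(2)[OF that]] by simp
  then have "Ck_on k U (\<lambda>x. frechet_derivative f (at x) v)" for v
    by (intro Ck_on_cong[OF assms(1) assms(3)[of v]]) auto
  then show ?thesis using assms(2) by (auto simp: differentiable_def)
qed

lemma Ck_on_local:
  assumes "\<And>x. x \<in> U \<Longrightarrow> \<exists>V. open V \<and> x \<in> V \<and> Ck_on k V f"
  shows "Ck_on k U f"
  using assms
proof (induction k arbitrary: f)
  case 0
  have "isCont f x" if x: "x \<in> U" for x
  proof -
    obtain V where "open V" "x \<in> V" "continuous_on V f" using 0[OF x] by auto
    then show ?thesis by (simp add: continuous_on_eq_continuous_at)
  qed
  then show ?case by (simp add: continuous_at_imp_continuous_on)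
next
  case (Suc k)
  have *: "\<exists>V. open V \<and> x \<in> V \<and> f differentiable at x \<and> (\<forall>v. Ck_on k V (\<lambda>x. frechet_derivative f (at x) v))"
    if x: "x \<in> U" for x
  proof -
    obtain V where "open V" "x \<in> V" "Ck_on (Suc k) V f" using Suc.prems[OF x] by blast
    then show ?thesis by (intro exI[of _ V]) auto
  qed
  have "Ck_on k U (\<lambda>x. frechet_derivative f (at x) v)" for v
    by (rule Suc.IH) (use * in blast)
  moreover have "f differentiable at x" if "x \<in> U" for x
    using *[OF that] by blast
  ultimately show ?case by simp
qed

lemma Ck_on_const: "open U \<Longrightarrow> Ck_on k U (\<lambda>x. c)"
proof (induction k arbitrary: c)
  case (Suc k)
  show ?case by (rule Ck_on_SucI[OF Suc.prems has_derivative_const]) (use Suc in auto)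
qed auto

lemma Ck_on_linear_compose:
  assumes "bounded_linear L" "open U"
  shows "Ck_on k U f \<Longrightarrow> Ck_on k U (\<lambda>x. L (f x))"
proof (induction k arbitrary: f)
  case 0
  then show ?case using assms(1) by (auto intro: bounded_linear.continuous_on)
next
  case (Suc k)
  show ?case
    by (rule Ck_on_SucI[OF assms(2) bounded_linear.has_derivative[OF assms(1) Ck_on_Suc_has_derivative[OF Suc.prems]]])
      (use Suc in auto)
qed

lemma Ck_on_id: "open U \<Longrightarrow> Ck_on k U (\<lambda>x. x)"
proof (cases k)
  case (Suc m)
  assume U: "open U"
  show ?thesis unfolding Suc
    by (rule Ck_on_SucI[OF U has_derivative_ident Ck_on_const[OF U]])
qed auto

lemma Ck_on_add:
  assumes "open U"
  shows "Ck_on k U f \<Longrightarrow> Ck_on k U g \<Longrightarrow> Ck_on k U (\<lambda>x. f x + g x)"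
proof (induction k arbitrary: f g)
  case 0
  then show ?case by (auto intro: continuous_intros)
next
  case (Suc k)
  show ?case
    by (rule Ck_on_SucI[OF assms has_derivative_add[OF Ck_on_Suc_has_derivative[OF Suc.prems(1)] Ck_on_Suc_has_derivative[OF Suc.prems(2)]]])
      (use Suc in auto)
qed

lemma Ck_on_sum:
  assumes "open U" "\<And>i. i \<in> I \<Longrightarrow> Ck_on k U (f i)"
  shows "Ck_on k U (\<lambda>x. \<Sum>i\<in>I. f i x)"
proof (cases "finite I")
  case True
  then show ?thesis using assms(2)
    by (induction I) (auto intro: Ck_on_const Ck_on_add assms(1))
qed (auto intro: Ck_on_const assms(1))

lemma Ck_on_bilinear:
  assumes "bounded_bilinear B" "open U"
  shows "Ck_on k U f \<Longrightarrow> Ck_on k U g \<Longrightarrow> Ck_on k U (\<lambda>x. B (f x) (g x))"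
proof (induction k arbitrary: f g)
  case 0
  then show ?case using assms(1) by (auto intro: bounded_bilinear.continuous_on)
next
  case (Suc k)
  show ?case
  proof (rule Ck_on_SucI[OF assms(2) bounded_bilinear.FDERIV[OF assms(1) Ck_on_Suc_has_derivative[OF Suc.prems(1)] Ck_on_Suc_has_derivative[OF Suc.prems(2)]]])
    fix v
    show "Ck_on k U (\<lambda>x. B (f x) (frechet_derivative g (at x) v) + B (frechet_derivative f (at x) v) (g x))"
      using Suc.prems Ck_on_SucD[OF Suc.prems(1)] Ck_on_SucD[OF Suc.prems(2)]
      by (intro Ck_on_add assms Suc.IH) auto
  qed
qed

lemma linear_euclidean_expand:
  fixes L :: "'e::euclidean_space \<Rightarrow> 'y::real_vector"
  assumes "linear L" shows "L w = (\<Sum>b\<in>Basis. (w \<bullet> b) *\<^sub>R L b)"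
proof -
  have "L w = L (\<Sum>b\<in>Basis. (w \<bullet> b) *\<^sub>R b)" by (simp add: euclidean_representation)
  then show ?thesis by (simp only: linear_sum[OF assms] linear_cmul[OF assms] o_def)
qed

text \<open>In the chain rule both the derivative of g and the vector it is applied to depend on x.
  Expanding this vector in the basis gives a finite sum of products: a coefficient of the derivative
  of f times a directional derivative of g at \<open>f x\<close>. The latter is again a composition,
  one order lower.\<close>

lemma Ck_on_compose:
  assumes U: "open U" and V: "open V"
  shows "Ck_on k U f \<Longrightarrow> Ck_on k V g \<Longrightarrow> f ` U \<subseteq> V \<Longrightarrow> Ck_on k U (\<lambda>x. g (f x))"
proof (induction k arbitrary: f g)
  case 0
  then show ?case by (auto intro: continuous_on_compose2)
next
  case (Suc k)
  let ?D = "\<lambda>x. frechet_derivative g (at (f x))"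
  have lin: "linear (?D x)" if "x \<in> U" for x
    using Ck_on_Suc_has_derivative[OF Suc.prems(2)] Suc.prems(3) that
    by (auto intro!: has_derivative_linear)
  have D: "((\<lambda>x. g (f x)) has_derivative (\<lambda>v. ?D x (frechet_derivative f (at x) v))) (at x)"
    if "x \<in> U" for x
    using has_derivative_compose[OF Ck_on_Suc_has_derivative[OF Suc.prems(1) that] Ck_on_Suc_has_derivative[OF Suc.prems(2)]]
      that Suc.prems(3) by auto
  show ?case
  proof (rule Ck_on_SucI[OF U])
    fix x assume x: "x \<in> U"
    have eq: "(\<lambda>v. ?D x (frechet_derivative f (at x) v))
        = (\<lambda>v. \<Sum>b\<in>Basis. (frechet_derivative f (at x) v \<bullet> b) *\<^sub>R ?D x b)"
      by (rule ext) (rule linear_euclidean_expand[OF lin[OF x]])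
    show "((\<lambda>x. g (f x)) has_derivative
        (\<lambda>v. \<Sum>b\<in>Basis. (frechet_derivative f (at x) v \<bullet> b) *\<^sub>R ?D x b)) (at x)"
      using D[OF x] unfolding eq .
  next
    fix v
    show "Ck_on k U (\<lambda>x. \<Sum>b\<in>Basis. (frechet_derivative f (at x) v \<bullet> b) *\<^sub>R ?D x b)"
    proof (intro Ck_on_sum[OF U] Ck_on_bilinear[OF bounded_bilinear_scaleR U])
      fix b :: 'b
      show "Ck_on k U (\<lambda>x. frechet_derivative f (at x) v \<bullet> b)"
        by (rule Ck_on_linear_compose[OF bounded_linear_inner_left U]) (use Suc.prems in auto)
      show "Ck_on k U (\<lambda>x. ?D x b)"
        using Suc.prems by (intro Suc.IH Ck_on_SucD[OF Suc.prems(1)]) auto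
    qed
  qed
qed

text \<open>Openness of the domain is bundled in, as for the local extensions that witness
  \<open>smooth_on\<close>.\<close>

definition Cinf :: "'e::euclidean_space set \<Rightarrow> ('e \<Rightarrow> 'f::euclidean_space) \<Rightarrow> bool" where
  "Cinf U f \<longleftrightarrow> open U \<and> (\<forall>k. Ck_on k U f)"

lemma Cinf_open: "Cinf U f \<Longrightarrow> open U"
  by (simp add: Cinf_def)

lemma Cinf_subset: "Cinf U f \<Longrightarrow> V \<subseteq> U \<Longrightarrow> open V \<Longrightarrow> Cinf V f"
  by (auto simp: Cinf_def intro: Ck_on_subset)

lemma Cinf_compose: "Cinf U f \<Longrightarrow> Cinf V g \<Longrightarrow> f ` U \<subseteq> V \<Longrightarrow> Cinf U (\<lambda>x. g (f x))"
  by (auto simp: Cinf_def intro: Ck_on_compose)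

lemma Cinf_has_derivative:
  "Cinf U f \<Longrightarrow> x \<in> U \<Longrightarrow> (f has_derivative frechet_derivative f (at x)) (at x)"
  using Ck_on_Suc_has_derivative[of 0 U f x] by (simp add: Cinf_def del: Ck_on.simps)

lemma Cinf_frechet_derivative:
  "Cinf U f \<Longrightarrow> Cinf U (\<lambda>x. frechet_derivative f (at x) v)"
  unfolding Cinf_def by (metis Ck_on.simps(2))

lemma Cinf_continuous_on: "Cinf U f \<Longrightarrow> continuous_on U f"
  unfolding Cinf_def using Ck_on.simps(1) by blast

section \<open>Smoothness on arbitrary subsets\<close>

lemma smooth_on_iff:
  "smooth_on S f \<longleftrightarrow> (\<forall>x\<in>S. \<exists>U g. Cinf U g \<and> x \<in> U \<and> (\<forall>y\<in>S \<inter> U. g y = f y))"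
  unfolding smooth_on_def Cinf_def by blast

lemma smooth_onE:
  assumes "smooth_on S f" "x \<in> S"
  obtains U g where "Cinf U g" "x \<in> U" "\<And>y. y \<in> S \<Longrightarrow> y \<in> U \<Longrightarrow> g y = f y"
  using assms unfolding smooth_on_iff by (metis IntI)

lemma smooth_on_open:
  assumes "open S" shows "smooth_on S f \<longleftrightarrow> Cinf S f"
proof
  assume f: "smooth_on S f"
  have "Ck_on k S f" for k
  proof (rule Ck_on_local)
    fix x assume "x \<in> S"
    with f obtain U g where U: "Cinf U g" "x \<in> U" "\<And>y. y \<in> S \<Longrightarrow> y \<in> U \<Longrightarrow> g y = f y"
      using smooth_onE by metis
    have "Ck_on k (U \<inter> S) f"
      by (rule Ck_on_cong[of _ _ g]) (use U assms in \<open>auto simp: Cinf_def intro: Ck_on_subset\<close>)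
    then show "\<exists>V. open V \<and> x \<in> V \<and> Ck_on k V f"
      using U assms \<open>x \<in> S\<close> by (intro exI[of _ "U \<inter> S"]) (auto simp: Cinf_def)
  qed
  then show "Cinf S f" using assms by (simp add: Cinf_def)
qed (auto simp: smooth_on_iff)

lemma Cinf_imp_smooth_on: "Cinf U f \<Longrightarrow> S \<subseteq> U \<Longrightarrow> smooth_on S f"
  by (auto simp: smooth_on_iff)

lemma smooth_on_subset: "smooth_on S f \<Longrightarrow> T \<subseteq> S \<Longrightarrow> smooth_on T f"
  unfolding smooth_on_iff by (meson IntD1 IntD2 IntI subsetD)

lemma smooth_on_cong: "smooth_on S f \<Longrightarrow> (\<And>x. x \<in> S \<Longrightarrow> f x = g x) \<Longrightarrow> smooth_on S g"
  unfolding smooth_on_iff by (metis IntD1)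

lemma smooth_on_compose:
  assumes f: "smooth_on S f" and g: "smooth_on T g" and ST: "f ` S \<subseteq> T"
  shows "smooth_on S (\<lambda>x. g (f x))"
  unfolding smooth_on_iff
proof
  fix x assume x: "x \<in> S"
  obtain U f' where U: "Cinf U f'" "x \<in> U" "\<And>y. y \<in> S \<Longrightarrow> y \<in> U \<Longrightarrow> f' y = f y"
    using smooth_onE[OF f x] by metis
  obtain V g' where V: "Cinf V g'" "f x \<in> V" "\<And>y. y \<in> T \<Longrightarrow> y \<in> V \<Longrightarrow> g' y = g y"
    using smooth_onE[OF g, of "f x"] x ST by (metis image_subset_iff)
  let ?U = "U \<inter> f' -` V"
  have "open ?U"
    using continuous_open_preimage[OF Cinf_continuous_on[OF U(1)] Cinf_open[OF U(1)] Cinf_open[OF V(1)]] .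
  then have "Cinf ?U f'" using U(1) by (auto intro: Cinf_subset)
  then have "Cinf ?U (\<lambda>x. g' (f' x))" using V(1) by (rule Cinf_compose) auto
  then show "\<exists>U h. Cinf U h \<and> x \<in> U \<and> (\<forall>y\<in>S \<inter> U. h y = g (f y))"
    using U V x ST by (intro exI[of _ ?U] exI[of _ "\<lambda>x. g' (f' x)"]) auto
qed

lemma smooth_on_local:
  assumes "\<And>x. x \<in> S \<Longrightarrow> \<exists>V. open V \<and> x \<in> V \<and> smooth_on (S \<inter> V) f"
  shows "smooth_on S f"
  unfolding smooth_on_iff
proof
  fix x assume x: "x \<in> S"
  obtain V where V: "open V" "x \<in> V" "smooth_on (S \<inter> V) f" using assms[OF x] by blast
  obtain U g where U: "Cinf U g" "x \<in> U" "\<And>y. y \<in> S \<inter> V \<Longrightarrow> y \<in> U \<Longrightarrow> g y = f y"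
    using smooth_onE[OF V(3) IntI[OF x V(2)]] by metis
  show "\<exists>U g. Cinf U g \<and> x \<in> U \<and> (\<forall>y\<in>S \<inter> U. g y = f y)"
    using U V by (intro exI[of _ "U \<inter> V"] exI[of _ g])
      (auto simp: open_Int Cinf_open intro: Cinf_subset)
qed

lemma smooth_on_continuous_on: "smooth_on S f \<Longrightarrow> continuous_on S f"
  unfolding continuous_on_eq_continuous_within
proof
  fix x assume f: "smooth_on S f" and x: "x \<in> S"
  obtain U g where U: "Cinf U g" "x \<in> U" "\<And>y. y \<in> S \<Longrightarrow> y \<in> U \<Longrightarrow> g y = f y"
    using smooth_onE[OF f x] by metis
  have "continuous (at x within S) g"
    using Cinf_continuous_on[OF U(1)] Cinf_open[OF U(1)] U(2)
    by (simp add: continuous_on_eq_continuous_at continuous_at_imp_continuous_at_within)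
  moreover obtain e where "e > 0" "\<And>y. dist y x < e \<Longrightarrow> y \<in> U"
    using Cinf_open[OF U(1)] U(2) unfolding open_dist by blast
  ultimately show "continuous (at x within S) f"
    using x U(3) by (intro continuous_transform_within[of x S g e f]) auto
qed

lemma smooth_on_const: "smooth_on S (\<lambda>x. c)"
  by (rule Cinf_imp_smooth_on[of UNIV]) (auto simp: Cinf_def intro: Ck_on_const)

lemma smooth_on_id: "smooth_on S (\<lambda>x. x)"
  by (rule Cinf_imp_smooth_on[of UNIV]) (auto simp: Cinf_def intro: Ck_on_id)

lemma smooth_on_linear: "linear L \<Longrightarrow> smooth_on S L"
  by (rule Cinf_imp_smooth_on[of UNIV])
    (auto simp: Cinf_def linear_conv_bounded_linear intro: Ck_on_linear_compose[OF _ _ Ck_on_id])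

lemma smooth_on_linear_compose: "linear L \<Longrightarrow> smooth_on S f \<Longrightarrow> smooth_on S (\<lambda>x. L (f x))"
  by (rule smooth_on_compose[OF _ smooth_on_linear]) auto

lemma smooth_on_bilinear:
  assumes "bounded_bilinear B" "smooth_on S f" "smooth_on S g"
  shows "smooth_on S (\<lambda>x. B (f x) (g x))"
  unfolding smooth_on_iff
proof
  fix x assume x: "x \<in> S"
  obtain U f' where U: "Cinf U f'" "x \<in> U" "\<And>y. y \<in> S \<Longrightarrow> y \<in> U \<Longrightarrow> f' y = f y"
    using smooth_onE[OF assms(2) x] by metis
  obtain V g' where V: "Cinf V g'" "x \<in> V" "\<And>y. y \<in> S \<Longrightarrow> y \<in> V \<Longrightarrow> g' y = g y"
    using smooth_onE[OF assms(3) x] by metis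
  have "Cinf (U \<inter> V) (\<lambda>x. B (f' x) (g' x))"
    using U(1) V(1) by (auto simp: Cinf_def intro!: Ck_on_bilinear[OF assms(1)] elim: Ck_on_subset)
  then show "\<exists>U h. Cinf U h \<and> x \<in> U \<and> (\<forall>y\<in>S \<inter> U. h y = B (f y) (g y))"
    using U V by (intro exI[of _ "U \<inter> V"] exI[of _ "\<lambda>x. B (f' x) (g' x)"]) auto
qed

lemmas smooth_on_scaleR = smooth_on_bilinear[OF bounded_bilinear_scaleR]
  and smooth_on_mult = smooth_on_bilinear[OF bounded_bilinear_mult]

lemma smooth_on_add:
  assumes "smooth_on S f" "smooth_on S g"
  shows "smooth_on S (\<lambda>x. f x + g x)"
  unfolding smooth_on_iff
proof
  fix x assume x: "x \<in> S"
  obtain U f' where U: "Cinf U f'" "x \<in> U" "\<And>y. y \<in> S \<Longrightarrow> y \<in> U \<Longrightarrow> f' y = f y"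
    using smooth_onE[OF assms(1) x] by metis
  obtain V g' where V: "Cinf V g'" "x \<in> V" "\<And>y. y \<in> S \<Longrightarrow> y \<in> V \<Longrightarrow> g' y = g y"
    using smooth_onE[OF assms(2) x] by metis
  have "Cinf (U \<inter> V) (\<lambda>x. f' x + g' x)"
    using U(1) V(1) by (auto simp: Cinf_def intro!: Ck_on_add elim: Ck_on_subset)
  then show "\<exists>U h. Cinf U h \<and> x \<in> U \<and> (\<forall>y\<in>S \<inter> U. h y = f y + g y)"
    using U V by (intro exI[of _ "U \<inter> V"] exI[of _ "\<lambda>x. f' x + g' x"]) auto
qed

lemma smooth_on_diff:
  assumes "smooth_on S f" "smooth_on S g"
  shows "smooth_on S (\<lambda>x. f x - g x)"
  using smooth_on_add[OF assms(1) smooth_on_linear_compose[OF linear_uminus assms(2)]] by simp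

section \<open>Functions used to reparametrise curves\<close>

lemma smooth_on_sin: "smooth_on S (\<lambda>t::real. sin t)"
proof (rule Cinf_imp_smooth_on[of UNIV])
  \<comment> \<open>The span of sin and cos is closed under differentiation, which makes the
    induction on k possible.\<close>
  have "Ck_on k UNIV (\<lambda>t::real. a * sin t + b * cos t)" for k a b
  proof (induction k arbitrary: a b)
    case 0
    then show ?case by (auto intro!: continuous_intros)
  next
    case (Suc k)
    show ?case
    proof (rule Ck_on_SucI)
      show "((\<lambda>t. a * sin t + b * cos t) has_derivative (\<lambda>v. v * ((- b) * sin t + a * cos t))) (at t)" for t :: real
        by (auto intro!: derivative_eq_intros simp: algebra_simps)
      show "Ck_on k UNIV (\<lambda>t. v * ((- b) * sin t + a * cos t))" for v
        using Suc.IH[of "v * (- b)" "v * a"] by (simp add: algebra_simps)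
    qed simp
  qed
  from this[of _ 1 0] show "Cinf UNIV (\<lambda>t::real. sin t)" by (simp add: Cinf_def)
qed simp

text \<open>\<open>flat 0\<close> is the classical function exp (-1/t), extended by 0. The powers of
  1/t are included because the derivative of \<open>flat k\<close> is then a linear combination of
  members of the same family.\<close>

definition flat :: "nat \<Rightarrow> real \<Rightarrow> real" where
  "flat k t = (if t > 0 then (1 / t) ^ k * exp (- (1 / t)) else 0)"

text \<open>From the right, the substitution s = 1/t turns this into the decay of
  \<open>s ^ k / exp s\<close> at infinity.\<close>

lemma flat_tendsto_0: "(flat k \<longlongrightarrow> 0) (at 0)"
proof -
  have "((\<lambda>s::real. s ^ k / exp s) \<longlongrightarrow> 0) at_top"
    by (rule tendsto_power_div_exp_0)
  then have "((\<lambda>t::real. (inverse t) ^ k / exp (inverse t)) \<longlongrightarrow> 0) (at_right 0)"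
    by (rule filterlim_compose[OF _ filterlim_inverse_at_top_right])
  then have "(flat k \<longlongrightarrow> 0) (at_right 0)"
    by (rule Lim_transform_eventually)
      (auto simp: flat_def eventually_at_filter exp_minus divide_inverse)
  moreover have "(flat k \<longlongrightarrow> 0) (at_left 0)"
    by (rule Lim_transform_eventually[OF tendsto_const])
      (auto simp: flat_def eventually_at_filter)
  ultimately show ?thesis using filterlim_split_at by blast
qed

lemma flat_has_derivative:
  "(flat k has_derivative (\<lambda>v. v * (flat (k + 2) t - real k * flat (k + 1) t))) (at t)"
proof -
  consider "t > 0" | "t < 0" | "t = 0" by linarith
  then have "(flat k has_real_derivative (flat (k + 2) t - real k * flat (k + 1) t)) (at t)"
  proof cases
    case 1
    \<comment> \<open>Removes the truncated exponent k - 1; for k = 0 both sides vanish because of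
      the factor k.\<close>
    have pw: "real k * (1 / t) ^ (k - Suc 0) = real k * (1 / t) ^ k * t"
      using 1 by (cases k) auto
    have "((\<lambda>t. (1 / t) ^ k * exp (- (1 / t))) has_real_derivative
       (1 / t) ^ k * (exp (- (1 / t)) * (1 / t\<^sup>2)) + (real k * (1 / t) ^ (k - Suc 0) * (- 1 / t\<^sup>2)) * exp (- (1 / t))) (at t)"
      using 1 by (auto intro!: derivative_eq_intros simp: power2_eq_square)
    also have "(1 / t) ^ k * (exp (- (1 / t)) * (1 / t\<^sup>2)) + (real k * (1 / t) ^ (k - Suc 0) * (- 1 / t\<^sup>2)) * exp (- (1 / t))
        = flat (k + 2) t - real k * flat (k + 1) t"
      unfolding pw using 1 by (simp add: flat_def field_simps power2_eq_square)
    finally have d: "((\<lambda>t. (1 / t) ^ k * exp (- (1 / t))) has_real_derivative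
        flat (k + 2) t - real k * flat (k + 1) t) (at t)" .
    show ?thesis
      using has_field_derivative_transform_within_open[OF d, of "{0<..}" "flat k"] 1
      by (simp add: flat_def)
  next
    case 2
    then show ?thesis
      using has_field_derivative_transform_within_open[OF DERIV_const[of 0], of "{..<0}" t "flat k"]
      by (simp add: flat_def)
  next
    case 3
    \<comment> \<open>The difference quotient of \<open>flat k\<close> at 0 is
      \<open>flat (Suc k)\<close>, which tends to 0.\<close>
    have "((\<lambda>h. (flat k (0 + h) - flat k 0) / h) \<longlongrightarrow> 0) (at 0)"
      by (rule Lim_transform_eventually[OF flat_tendsto_0[of "Suc k"]])
        (auto simp: eventually_at_filter flat_def)
    then show ?thesis using 3 by (simp add: DERIV_def flat_def)
  qed
  then show ?thesis by (simp add: has_field_derivative_def mult.commute[of _ "_ - _"])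
qed

lemma smooth_on_flat: "smooth_on S (flat n)"
proof (rule Cinf_imp_smooth_on[of UNIV])
  have "Ck_on k UNIV (flat n)" for k n
  proof (induction k arbitrary: n)
    case 0
    then show ?case
      using flat_has_derivative by (auto intro!: continuous_at_imp_continuous_on has_derivative_continuous)
  next
    case (Suc k)
    have "Ck_on k UNIV (\<lambda>t. v * flat (n + 2) t + (- v * real n) * flat (n + 1) t)" for v
      using Suc by (intro Ck_on_add Ck_on_bilinear[OF bounded_bilinear_mult] Ck_on_const) auto
    then show ?case
      by (intro Ck_on_SucI[OF _ flat_has_derivative]) (auto simp: algebra_simps)
  qed
  then show "Cinf UNIV (flat n)" by (simp add: Cinf_def)
qed simp

text \<open>A smooth transition from 0 to 1, constant outside the unit interval. Nesting
  \<open>flat 0\<close> needs division by a constant only, in place of the usual quotient of two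
  functions.\<close>

definition step :: "real \<Rightarrow> real" where
  "step t = 1 - flat 0 (1 - flat 0 t / flat 0 1) / flat 0 1"

lemma step_le_0: "t \<le> 0 \<Longrightarrow> step t = 0"
  by (simp add: step_def flat_def)

lemma step_ge_1: "t \<ge> 1 \<Longrightarrow> step t = 1"
proof -
  assume t: "t \<ge> 1"
  then have "- 1 \<le> - (1 / t)" by simp
  then have "exp (- 1) \<le> exp (- (1 / t))" by (subst exp_le_cancel_iff)
  then show ?thesis using t by (simp add: step_def flat_def divide_simps)
qed

lemma smooth_on_step: "smooth_on S step"
proof -
  have lin: "linear (\<lambda>x::real. x / c)" for c
    by (auto intro!: linearI simp: add_divide_distrib)
  have 1: "smooth_on S (\<lambda>t. 1 - flat 0 t / flat 0 1)"
    by (intro smooth_on_diff smooth_on_const smooth_on_linear_compose[OF lin] smooth_on_flat)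
  have 2: "smooth_on S (\<lambda>t. flat 0 (1 - flat 0 t / flat 0 1))"
    by (rule smooth_on_compose[OF 1 smooth_on_flat[of UNIV]]) simp
  show ?thesis
    unfolding step_def[abs_def] by (intro smooth_on_diff smooth_on_const smooth_on_linear_compose[OF lin] 2)
qed

section \<open>Inverse functions, Lipschitz bounds and a differential inequality\<close>

lemma has_derivative_scaleR_at_zero:
  fixes k :: "'x::real_normed_vector \<Rightarrow> real" and h :: "'x \<Rightarrow> 'y::real_normed_vector"
  assumes k: "(k has_derivative k') (at y)" and k0: "k y = 0" and h: "continuous (at y) h"
  shows "((\<lambda>x. k x *\<^sub>R h x) has_derivative (\<lambda>u. k' u *\<^sub>R h y)) (at y)"
proof -
  interpret bounded_linear k' using k by (rule has_derivative_bounded_linear)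
  obtain K where K: "\<And>u. norm (k' u) \<le> norm u * K" using bounded by blast
  \<comment> \<open>Since k vanishes at y, the bracket dominates
    \<open>norm (k x) / norm (x - y)\<close> and stays bounded. Multiplied by
    \<open>h x - h y\<close> it tends to 0, so that continuity of h suffices and no derivative of h
    enters.\<close>
  have "((\<lambda>x. (norm (k x - k' (x - y)) / norm (x - y) + \<bar>K\<bar>) * norm (h x - h y)) \<longlongrightarrow> (0 + \<bar>K\<bar>) * norm (h y - h y)) (at y)"
    using k h by (intro tendsto_intros) (auto simp: has_derivative_at2 k0 continuous_within divide_inverse_commute has_derivative_iff_norm)
  then have lim: "((\<lambda>x. (norm (k x - k' (x - y)) / norm (x - y) + \<bar>K\<bar>) * norm (h x - h y)) \<longlongrightarrow> 0) (at y)"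
    by simp
  have "((\<lambda>x. norm (k x *\<^sub>R (h x - h y)) / norm (x - y)) \<longlongrightarrow> 0) (at y)"
  proof (rule tendsto_sandwich[OF _ _ tendsto_const lim])
    show "\<forall>\<^sub>F x in at y. norm (k x *\<^sub>R (h x - h y)) / norm (x - y)
        \<le> (norm (k x - k' (x - y)) / norm (x - y) + \<bar>K\<bar>) * norm (h x - h y)"
      unfolding eventually_at_filter
    proof (intro always_eventually allI impI)
      fix x assume "x \<noteq> y"
      then have n: "norm (x - y) > 0" by simp
      have "norm (k x) \<le> norm (k x - k' (x - y)) + norm (k' (x - y))"
        using norm_triangle_ineq[of "k x - k' (x - y)" "k' (x - y)"] by simp
      also have "norm (k' (x - y)) \<le> \<bar>K\<bar> * norm (x - y)"
        using K[of "x - y"] n by (smt (verit) abs_ge_self mult.commute mult_right_mono norm_ge_zero)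
      finally have "norm (k x) / norm (x - y) \<le> norm (k x - k' (x - y)) / norm (x - y) + \<bar>K\<bar>"
        using n by (simp add: divide_simps)
      then have "norm (k x) / norm (x - y) * norm (h x - h y)
          \<le> (norm (k x - k' (x - y)) / norm (x - y) + \<bar>K\<bar>) * norm (h x - h y)"
        by (rule mult_right_mono) simp
      then show "norm (k x *\<^sub>R (h x - h y)) / norm (x - y)
        \<le> (norm (k x - k' (x - y)) / norm (x - y) + \<bar>K\<bar>) * norm (h x - h y)" by simp
    qed
  qed auto
  then have 1: "((\<lambda>x. k x *\<^sub>R (h x - h y)) has_derivative (\<lambda>u. 0)) (at y)"
    by (simp add: has_derivative_iff_norm k0)
  have 2: "((\<lambda>x. k x *\<^sub>R h y) has_derivative (\<lambda>u. k' u *\<^sub>R h y)) (at y)"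
    by (rule has_derivative_scaleR_left[OF k])
  show ?thesis using has_derivative_add[OF 1 2] by (simp add: algebra_simps)
qed

text \<open>The inverse function theorem yields a differentiable g whose derivative at y is the
  inverse of \<open>A (g y)\<close>. Smoothness is gained one order at a time, since derivatives of
  g' are expressed by g' and by derivatives of f at \<open>g y\<close>. The derivative at z0 is
  normalised to the identity, as it is for the coordinate change F in
  \<open>submersion_chart\<close>.\<close>

theorem Cinf_inverse_function:
  fixes f :: "'e::euclidean_space \<Rightarrow> 'e"
  assumes f: "Cinf U f" and z0: "z0 \<in> U" and D: "(f has_derivative (\<lambda>u. u)) (at z0)"
  obtains U' V g where "open U'" "U' \<subseteq> U" "z0 \<in> U'" "homeomorphism U' V f g" "Cinf V g"
proof -
  define A where "A x = frechet_derivative f (at x)" for x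
  define B where "B x = Blinfun (A x)" for x
  have dA: "(f has_derivative A x) (at x)" if "x \<in> U" for x
    using Cinf_has_derivative[OF f that] by (simp add: A_def)
  have BA: "blinfun_apply (B x) = A x" if "x \<in> U" for x
    using dA[OF that] by (simp add: B_def bounded_linear_Blinfun_apply has_derivative_bounded_linear)
  have CA: "Cinf U (\<lambda>x. A x v)" for v
    unfolding A_def by (rule Cinf_frechet_derivative[OF f])
  have contB: "continuous_on U B"
    by (rule continuous_on_blinfun_componentwise)
      (use Cinf_continuous_on[OF CA] BA in \<open>simp cong: continuous_on_cong\<close>)
  have B0: "B z0 = id_blinfun"
    using BA[OF z0] has_derivative_unique[OF D dA[OF z0]] by (intro blinfun_eqI) simp
  obtain e where e: "e > 0" "\<And>x. x \<in> U \<Longrightarrow> dist x z0 < e \<Longrightarrow> dist (B x) id_blinfun < 1/2"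
    using contB z0 B0 unfolding continuous_on_iff by (metis zero_less_divide_1_iff zero_less_numeral)
  define U0 where "U0 = U \<inter> ball z0 e"
  have U0: "open U0" "z0 \<in> U0" "U0 \<subseteq> U"
    using Cinf_open[OF f] z0 e by (auto simp: U0_def)
  \<comment> \<open>Derivatives at distance less than 1/2 from the identity shrink no vector by more
    than half. This is a uniform bound for their inverses g'.\<close>
  have lower: "norm v \<le> 2 * norm (A x v)" if "x \<in> U0" for x v
  proof -
    have x: "x \<in> U" "norm (B x - id_blinfun) < 1/2"
      using that e(2)[of x] by (auto simp: U0_def dist_norm norm_minus_commute)
    have "norm (A x v - v) \<le> norm (B x - id_blinfun) * norm v"
      using norm_blinfun[of "B x - id_blinfun" v] BA[OF x(1)] by (simp add: blinfun.diff_left)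
    also have "\<dots> \<le> 1/2 * norm v" using x(2) by (intro mult_right_mono) auto
    finally show ?thesis using norm_triangle_ineq2[of v "v - A x v"] 
      by (simp add: norm_minus_commute)
  qed
  obtain U' V g g' where inv: "open U'" "U' \<subseteq> U0" "z0 \<in> U'" "open V" "f z0 \<in> V" "homeomorphism U' V f g"
    and g': "\<And>y. y \<in> V \<Longrightarrow> (g has_derivative g' y) (at y)"
      "\<And>y. y \<in> V \<Longrightarrow> g' y = inv (blinfun_apply (B (g y)))" "\<And>y. y \<in> V \<Longrightarrow> bij (blinfun_apply (B (g y)))"
    by (rule inverse_function_theorem[OF U0(1), of f B z0 id_blinfun])
      (use U0 dA BA contB B0 in \<open>auto intro: continuous_on_subset blinfun_eqI\<close>)
  have gU: "g y \<in> U0" "g y \<in> U" if "y \<in> V" for y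
    using inv that U0 unfolding homeomorphism_def by auto
  have Ag': "A (g y) (g' y v) = v" and g'A: "g' y (A (g y) v) = v" if "y \<in> V" for y v
    using g'(2,3)[OF that] BA[OF gU(2)[OF that]] by (auto simp: bij_is_surj surj_f_inv_f bij_is_inj)
  have ling': "linear (g' y)" if "y \<in> V" for y
    using has_derivative_linear[OF g'(1)[OF that]] .
  have linA: "linear (A (g y))" if "y \<in> V" for y
    using has_derivative_linear[OF dA[OF gU(2)[OF that]]] .
  \<comment> \<open>The resolvent identity for inverses of linear maps. It reduces continuity, and
    below differentiability, of g' to that of \<open>A (g y)\<close> in y.\<close>
  have diff: "g' y' v = g' y v - g' y' (A (g y') (g' y v) - A (g y) (g' y v))" if "y \<in> V" "y' \<in> V" for y y' v
    using that by (simp add: linear_diff[OF ling'] g'A Ag')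
  have contg: "continuous_on V g"
    using inv(6) unfolding homeomorphism_def by blast
  have contAg: "continuous (at y) (\<lambda>y'. A (g y') w)" if "y \<in> V" for y w
  proof -
    have "continuous_on V (\<lambda>y'. A (g y') w)"
      by (rule continuous_on_compose2[OF Cinf_continuous_on[OF CA] contg]) (use gU in auto)
    then show ?thesis using that inv(4) by (simp add: continuous_on_eq_continuous_at)
  qed
  have contg': "continuous (at y) (\<lambda>y'. g' y' v)" if y: "y \<in> V" for y v
  proof -
    let ?k = "\<lambda>y'. A (g y') (g' y v) - A (g y) (g' y v)"
    have k0: "(?k \<longlongrightarrow> 0) (at y)"
      using contAg[OF y, of "g' y v"] by (simp add: continuous_within LIM_zero)
    have "((\<lambda>y'. g' y' (?k y')) \<longlongrightarrow> 0) (at y)"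
    proof (rule Lim_null_comparison)
      show "\<forall>\<^sub>F y' in at y. norm (g' y' (?k y')) \<le> 2 * norm (?k y')"
        using eventually_at_in_open'[OF inv(4) y]
        by eventually_elim (use lower[OF gU(1)] Ag' in metis)
      show "((\<lambda>y'. 2 * norm (?k y')) \<longlongrightarrow> 0) (at y)"
        using tendsto_mult_left[OF tendsto_norm[OF k0], of 2] by simp
    qed
    from tendsto_diff[OF tendsto_const[of "g' y v"] this]
    have lim: "((\<lambda>y'. g' y v - g' y' (?k y')) \<longlongrightarrow> g' y v) (at y)" by simp
    have "((\<lambda>y'. g' y' v) \<longlongrightarrow> g' y v) (at y)"
      by (rule Lim_transform_within_open[OF lim inv(4) y]) (rule diff[OF y, symmetric])
    then show ?thesis by (simp add: continuous_within)
  qed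
  \<comment> \<open>The derivative of \<open>y \<mapsto> g' y v\<close> is a polynomial \<open>H\<close> in the values of \<open>g'\<close> and in second derivatives
    of \<open>f\<close> at \<open>g y\<close>, so differentiability of \<open>g\<close> and \<open>g'\<close> bootstraps itself.\<close>
  define AA where "AA j l x = frechet_derivative (\<lambda>x. A x j) (at x) l" for j l x
  define H where "H v u y = - (\<Sum>i\<in>Basis. (\<Sum>j\<in>Basis. \<Sum>l\<in>Basis.
      ((g' y v \<bullet> j) * (g' y u \<bullet> l)) * (AA j l (g y) \<bullet> i)) *\<^sub>R g' y i)" for v u y
  have CAA: "Cinf U (AA j l)" for j l
    unfolding AA_def by (rule Cinf_frechet_derivative[OF CA])
  have dh: "((\<lambda>y. g' y v) has_derivative (\<lambda>u. H v u y)) (at y)" if y: "y \<in> V" for y v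
  proof -
    let ?w = "g' y v"
    let ?k = "\<lambda>y'. A (g y') ?w - A (g y) ?w"
    have dAj: "((\<lambda>y'. A (g y') j) has_derivative (\<lambda>u. \<Sum>l\<in>Basis. (g' y u \<bullet> l) *\<^sub>R AA j l (g y))) (at y)" for j
    proof -
      have d: "((\<lambda>x. A x j) has_derivative (\<lambda>l. AA j l (g y))) (at (g y))"
        using Cinf_has_derivative[OF CA gU(2)[OF y]] by (simp add: AA_def)
      have "AA j w (g y) = (\<Sum>l\<in>Basis. (w \<bullet> l) *\<^sub>R AA j l (g y))" for w
        by (rule linear_euclidean_expand[OF has_derivative_linear[OF d]])
      then have "(\<lambda>u. AA j (g' y u) (g y)) = (\<lambda>u. \<Sum>l\<in>Basis. (g' y u \<bullet> l) *\<^sub>R AA j l (g y))"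
        by (intro ext)
      then show ?thesis using has_derivative_compose[OF g'(1)[OF y] d] by metis
    qed
    have dk0: "((\<lambda>y'. (\<Sum>j\<in>Basis. (?w \<bullet> j) *\<^sub>R A (g y') j) - A (g y) ?w) has_derivative
        (\<lambda>u. (\<Sum>j\<in>Basis. (?w \<bullet> j) *\<^sub>R (\<Sum>l\<in>Basis. (g' y u \<bullet> l) *\<^sub>R AA j l (g y))) - 0)) (at y)"
      by (intro has_derivative_diff has_derivative_sum has_derivative_scaleR_right has_derivative_const dAj)
    have dk: "(?k has_derivative (\<lambda>u. \<Sum>j\<in>Basis. (?w \<bullet> j) *\<^sub>R (\<Sum>l\<in>Basis. (g' y u \<bullet> l) *\<^sub>R AA j l (g y)))) (at y)"
      (is "(_ has_derivative ?dk) _")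
      by (rule has_derivative_transform_within_open[OF dk0[simplified] inv(4) y])
        (subst linear_euclidean_expand[OF linA, of _ ?w], simp_all)
    \<comment> \<open>The factor \<open>?k\<close> vanishes at y, so the product rule asks only for
      continuity of the other factor g'. This avoids a circle, as the derivative of g' is what is
      being computed.\<close>
    have "((\<lambda>y'. (?k y' \<bullet> i) *\<^sub>R g' y' i) has_derivative (\<lambda>u. (?dk u \<bullet> i) *\<^sub>R g' y i)) (at y)" for i
      by (rule has_derivative_scaleR_at_zero[OF has_derivative_inner_left[OF dk] _ contg'[OF y]]) simp
    then have "((\<lambda>y'. g' y v - (\<Sum>i\<in>Basis. (?k y' \<bullet> i) *\<^sub>R g' y' i)) has_derivative
        (\<lambda>u. 0 - (\<Sum>i\<in>Basis. (?dk u \<bullet> i) *\<^sub>R g' y i))) (at y)"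
      by (intro has_derivative_diff has_derivative_const has_derivative_sum) 
    then have "((\<lambda>y'. g' y' v) has_derivative (\<lambda>u. 0 - (\<Sum>i\<in>Basis. (?dk u \<bullet> i) *\<^sub>R g' y i))) (at y)"
      by (rule has_derivative_transform_within_open[OF _ inv(4) y])
        (subst (2) diff[OF y], assumption, subst linear_euclidean_expand[OF ling', of _ "?k _"], auto)
    moreover have "0 - (\<Sum>i\<in>Basis. (?dk u \<bullet> i) *\<^sub>R g' y i) = H v u y" for u
      by (simp add: H_def inner_sum_left scaleR_right.sum sum_distrib_left mult.assoc)
    ultimately show ?thesis by simp
  qed
  have "Ck_on k V g \<and> (\<forall>v. Ck_on k V (\<lambda>y. g' y v))" for k
  proof (induction k)
    case 0
    then show ?case using contg contg' by (auto intro!: continuous_at_imp_continuous_on)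
  next
    case (Suc k)
    have g: "Ck_on (Suc k) V g"
      using g'(1) Suc by (intro Ck_on_SucI[OF inv(4)]) auto
    have "Ck_on k V (H v u)" for v u
    proof -
      have "Ck_on k V (\<lambda>y. AA j l (g y))" for j l
        by (rule Ck_on_compose[OF inv(4) Cinf_open[OF f]])
          (use Suc CAA gU in \<open>auto simp: Cinf_def\<close>)
      moreover have "Ck_on k V (\<lambda>y. g' y w)" for w using Suc by blast
      ultimately have "Ck_on k V (\<lambda>y. - (\<Sum>i\<in>Basis. (\<Sum>j\<in>Basis. \<Sum>l\<in>Basis.
        ((g' y v \<bullet> j) * (g' y u \<bullet> l)) * (AA j l (g y) \<bullet> i)) *\<^sub>R g' y i))"
        by (intro Ck_on_linear_compose[OF bounded_linear_minus[OF bounded_linear_ident]] Ck_on_sum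
            Ck_on_bilinear[OF bounded_bilinear_scaleR] Ck_on_bilinear[OF bounded_bilinear_mult]
            Ck_on_linear_compose[OF bounded_linear_inner_left] inv(4))
      then show ?thesis by (simp add: H_def[abs_def])
    qed
    then have "Ck_on (Suc k) V (\<lambda>y. g' y v)" for v
      by (intro Ck_on_SucI[OF inv(4) dh]) auto
    with g show ?case by blast
  qed
  then have "Cinf V g" using inv(4) by (simp add: Cinf_def)
  with inv U0 that show thesis by blast
qed

text \<open>Mean value inequality on a ball; K bounds the operator norm of the derivative on the
  compact closed ball.\<close>

lemma Cinf_locally_Lipschitz:
  fixes f :: "'e::euclidean_space \<Rightarrow> 'f::euclidean_space"
  assumes f: "Cinf U f" and z0: "z0 \<in> U"
  obtains r K where "r > 0" "ball z0 r \<subseteq> U" "K \<ge> 0"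
    "\<And>x y. x \<in> ball z0 r \<Longrightarrow> y \<in> ball z0 r \<Longrightarrow> norm (f x - f y) \<le> K * norm (x - y)"
proof -
  obtain r where r: "r > 0" "cball z0 r \<subseteq> U"
    using Cinf_open[OF f] z0 open_contains_cball by blast
  define A where "A x = frechet_derivative f (at x)" for x
  define B where "B x = Blinfun (A x)" for x
  have dA: "(f has_derivative A x) (at x)" if "x \<in> U" for x
    using Cinf_has_derivative[OF f that] by (simp add: A_def)
  have BA: "blinfun_apply (B x) = A x" if "x \<in> U" for x
    using dA[OF that] by (simp add: B_def bounded_linear_Blinfun_apply has_derivative_bounded_linear)
  have "continuous_on U B"
    by (rule continuous_on_blinfun_componentwise)
      (use Cinf_continuous_on[OF Cinf_frechet_derivative[OF f]] BA in \<open>simp add: A_def cong: continuous_on_cong\<close>)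
  then have "compact (B ` cball z0 r)"
    by (rule compact_continuous_image[OF continuous_on_subset[OF _ r(2)] compact_cball])
  then have "bounded (B ` cball z0 r)" by (rule compact_imp_bounded)
  then obtain K where "\<forall>y\<in>B ` cball z0 r. norm y \<le> K"
    unfolding bounded_iff ..
  then have K: "norm (B x) \<le> K" if "x \<in> cball z0 r" for x
    using that by simp
  have "norm (f x - f y) \<le> K * norm (x - y)" if xy: "x \<in> ball z0 r" "y \<in> ball z0 r" for x y
  proof (rule differentiable_bound[where f = f and f' = A and B = K, OF convex_ball _ _ xy])
    show "(f has_derivative A x) (at x within ball z0 r)" if "x \<in> ball z0 r" for x
      by (rule has_derivative_at_withinI, rule dA) (use r that in auto)
    show "onorm (A x) \<le> K" if "x \<in> ball z0 r" for x
    proof -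
      have x: "x \<in> cball z0 r" using that by simp
      then have "blinfun_apply (B x) = A x" using r(2) by (intro BA) blast
      then show ?thesis using K[OF x] by (simp add: norm_blinfun.rep_eq)
    qed
  qed
  moreover have "K \<ge> 0" using K[of z0] r norm_ge_zero[of "B z0"] by (metis centre_in_cball less_eq_real_def order_trans)
  ultimately show thesis using r that[of r K] by (metis ball_subset_cball order_trans)
qed

text \<open>Gronwall's argument: by the Cauchy-Schwarz inequality the squared norm of h times exp
  (-2 K t) is nonincreasing, and it starts at 0.\<close>

lemma differential_inequality_zero:
  fixes h h' :: "real \<Rightarrow> 'f::euclidean_space"
  assumes h: "\<And>t. 0 \<le> t \<Longrightarrow> t \<le> 1 \<Longrightarrow> (h has_vector_derivative h' t) (at t)"
    and le: "\<And>t. 0 \<le> t \<Longrightarrow> t \<le> 1 \<Longrightarrow> norm (h' t) \<le> K * norm (h t)" and h0: "h 0 = 0"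
  shows "h 1 = 0"
proof -
  define s where "s t = (h t \<bullet> h t) * exp (- (2 * K * t))" for t
  have "s 1 \<le> s 0"
  proof (rule DERIV_nonpos_imp_nonincreasing[of 0 1 s])
    fix t :: real assume t: "0 \<le> t" "t \<le> 1"
    let ?d = "(2 * (h t \<bullet> h' t) - 2 * K * (h t \<bullet> h t)) * exp (- (2 * K * t))"
    have 1: "((\<lambda>t. h t \<bullet> h t) has_real_derivative 2 * (h t \<bullet> h' t)) (at t)"
      using bounded_bilinear.has_vector_derivative[OF bounded_bilinear_inner h[OF t] h[OF t]]
      by (simp add: has_real_derivative_iff_has_vector_derivative inner_commute)
    have "(s has_real_derivative ?d) (at t)"
      unfolding s_def by (auto intro!: derivative_eq_intros 1 simp: algebra_simps)
    moreover have "h t \<bullet> h' t \<le> K * (h t \<bullet> h t)"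
    proof -
      have "h t \<bullet> h' t \<le> norm (h t) * norm (h' t)" by (rule norm_cauchy_schwarz)
      also have "\<dots> \<le> norm (h t) * (K * norm (h t))" using le[OF t] by (rule mult_left_mono) simp
      finally show ?thesis by (simp add: power2_norm_eq_inner[symmetric] power2_eq_square mult_ac)
    qed
    then have "?d \<le> 0" by (simp add: mult_nonpos_nonneg)
    ultimately show "\<exists>y. (s has_real_derivative y) (at t) \<and> y \<le> 0" by blast
  qed simp
  then have "h 1 \<bullet> h 1 \<le> 0" by (simp add: s_def h0 mult_le_0_iff)
  then show ?thesis by (metis inner_eq_zero_iff inner_ge_zero order_antisym)
qed

section \<open>Charts and smooth functions\<close>

lemma openin_image_iff:
  assumes "inj_on \<phi> U" "B \<subseteq> U"
  shows "openin (top_of_set (\<phi> ` U)) (\<phi> ` B) \<longleftrightarrow> (\<exists>T. open T \<and> B = U \<inter> \<phi> -` T)"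
proof -
  have "\<phi> ` B = \<phi> ` U \<inter> T \<longleftrightarrow> B = U \<inter> \<phi> -` T" for T
    using assms by (auto simp: inj_on_def; blast)
  then show ?thesis by (auto simp: openin_open)
qed

lemma smooth_on_relative_preimage:
  assumes "smooth_on S f" "open T"
  obtains T' where "open T'" "\<And>x. x \<in> S \<Longrightarrow> f x \<in> T \<longleftrightarrow> x \<in> T'"
proof -
  obtain T' where "open T'" "S \<inter> f -` T = S \<inter> T'"
    using continuous_openin_preimage_gen[OF smooth_on_continuous_on[OF assms(1)] assms(2)]
    unfolding openin_open by blast
  then show thesis using that[of T'] by blast
qed

text \<open>\<open>smooth_fun_on\<close> for vector-valued functions, so that a chart is itself a
  smooth function and a map can be tested by composing it with charts.\<close>

definition smooth_fn :: "('a, 'e::euclidean_space) mfd \<Rightarrow> 'a set \<Rightarrow> ('a \<Rightarrow> 'g::euclidean_space) \<Rightarrow> bool" where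
  "smooth_fn M A F \<longleftrightarrow> (\<forall>(U, \<phi>)\<in>atlas M. smooth_on (\<phi> ` (A \<inter> U)) (F \<circ> inv_into U \<phi>))"

lemma smooth_fun_on_eq: "smooth_fun_on M A f = smooth_fn M A f"
  by (simp add: smooth_fun_on_def smooth_fn_def)

text \<open>The conditions on a manifold that do not refer to its global topology.\<close>

locale smooth_atlas =
  fixes M :: "('a, 'e::euclidean_space) mfd"
  assumes cover: "(\<Union>c\<in>atlas M. fst c) = pts M"
    and charts: "c \<in> atlas M \<Longrightarrow> \<exists>d. chart_of_dim d c"
    and compat: "c \<in> atlas M \<Longrightarrow> c' \<in> atlas M \<Longrightarrow> compatible c c'"

lemma smooth_manifold_atlas: "smooth_manifold M \<Longrightarrow> smooth_atlas M"
  unfolding smooth_manifold_def smooth_atlas_def by blast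

context smooth_atlas
begin

lemma atlas_at:
  assumes "x \<in> pts M" obtains U \<phi> where "(U, \<phi>) \<in> atlas M" "x \<in> U"
proof -
  obtain c where "c \<in> atlas M" "x \<in> fst c" using assms cover by blast
  then show thesis using that[of "fst c" "snd c"] by simp
qed

lemma atlas_sub: "(U, \<phi>) \<in> atlas M \<Longrightarrow> U \<subseteq> pts M"
  using cover by force

lemma atlas_max: "atlas M \<subseteq> max_atlas M"
proof
  fix c assume c: "c \<in> atlas M"
  then have "fst c \<subseteq> pts M" using cover by blast
  then show "c \<in> max_atlas M" unfolding max_atlas_def using c charts compat by blast
qed

lemma max_sub: "(U, \<phi>) \<in> max_atlas M \<Longrightarrow> U \<subseteq> pts M"
  unfolding max_atlas_def by simp

lemma max_chart: "(U, \<phi>) \<in> max_atlas M \<Longrightarrow> \<exists>d. chart_of_dim d (U, \<phi>)"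
  unfolding max_atlas_def by simp

lemma max_inj: "(U, \<phi>) \<in> max_atlas M \<Longrightarrow> inj_on \<phi> U"
  using max_chart by (auto simp: chart_of_dim_def)

lemma max_space:
  assumes "(U, \<phi>) \<in> max_atlas M"
  obtains W where "subspace W" "openin (top_of_set W) (\<phi> ` U)"
  using max_chart[OF assms] unfolding chart_of_dim_def by auto

lemma compat_max:
  assumes "(U, \<phi>) \<in> max_atlas M" "(V, \<psi>) \<in> atlas M"
  shows "\<exists>T. open T \<and> U \<inter> V = U \<inter> \<phi> -` T" "\<exists>T. open T \<and> U \<inter> V = V \<inter> \<psi> -` T"
    "smooth_on (\<phi> ` (U \<inter> V)) (\<lambda>z. \<psi> (inv_into U \<phi> z))" "smooth_on (\<psi> ` (U \<inter> V)) (\<lambda>z. \<phi> (inv_into V \<psi> z))"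
proof -
  have c: "compatible (U, \<phi>) (V, \<psi>)" "compatible (V, \<psi>) (U, \<phi>)"
    using assms unfolding max_atlas_def by auto
  have \<psi>: "inj_on \<psi> V" using assms(2) atlas_max max_inj by blast
  show "\<exists>T. open T \<and> U \<inter> V = U \<inter> \<phi> -` T"
    using c(1) openin_image_iff[OF max_inj[OF assms(1)], of "U \<inter> V"] by (simp add: compatible_def)
  show "\<exists>T. open T \<and> U \<inter> V = V \<inter> \<psi> -` T"
    using c(2) openin_image_iff[OF \<psi>, of "V \<inter> U"] by (simp add: compatible_def Int_commute)
  show "smooth_on (\<phi> ` (U \<inter> V)) (\<lambda>z. \<psi> (inv_into U \<phi> z))" "smooth_on (\<psi> ` (U \<inter> V)) (\<lambda>z. \<phi> (inv_into V \<psi> z))"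
    using c by (auto simp: compatible_def Int_commute o_def)
qed

lemma topspace_mtop: "topspace (mtop M) = pts M"
proof
  show "topspace (mtop M) \<subseteq> pts M" using openin_topspace[of "mtop M"] unfolding openin_mtop by simp
  have "openin (mtop M) (pts M)"
    unfolding openin_mtop using atlas_sub by (auto intro!: exI[of _ UNIV])
  then show "pts M \<subseteq> topspace (mtop M)" by (rule openin_subset)
qed

lemma max_open_preimage:
  assumes c: "(U, \<phi>) \<in> max_atlas M" and T: "open T"
  shows "openin (mtop M) (U \<inter> \<phi> -` T)"
  unfolding openin_mtop
proof (intro conjI ballI, goal_cases)
  case 1 then show ?case using max_sub[OF c] by blast
next
  case (2 c')
  obtain V \<psi> where c': "c' = (V, \<psi>)" by (cases c')
  have V: "(V, \<psi>) \<in> atlas M" using 2 c' by simp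
  have \<psi>: "inj_on \<psi> V" using V atlas_max max_inj by blast
  obtain T1 where T1: "open T1" "U \<inter> V = V \<inter> \<psi> -` T1" using compat_max(2)[OF c V] by blast
  obtain T2 where T2: "open T2" "\<And>z. z \<in> \<psi> ` (U \<inter> V) \<Longrightarrow> \<phi> (inv_into V \<psi> z) \<in> T \<longleftrightarrow> z \<in> T2"
    using smooth_on_relative_preimage[OF compat_max(4)[OF c V] T] by blast
  have "y \<in> U \<inter> \<phi> -` T \<longleftrightarrow> \<psi> y \<in> T1 \<inter> T2" if "y \<in> V" for y
    using T1(2) T2(2)[of "\<psi> y"] that \<psi> by auto
  then have "U \<inter> \<phi> -` T \<inter> V = V \<inter> \<psi> -` (T1 \<inter> T2)" by blast
  then show ?case using open_Int[OF T1(1) T2(1)] c' by auto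
qed

lemma max_open: "(U, \<phi>) \<in> max_atlas M \<Longrightarrow> openin (mtop M) U"
  using max_open_preimage[of U \<phi> UNIV] by simp

text \<open>The topology is defined by the charts of \<open>atlas M\<close>; a chart of the maximal
  atlas is compared with one of these near each point. T is the union of all open sets whose
  preimage in U lies in A.\<close>

lemma open_max_preimage:
  assumes c: "(U, \<phi>) \<in> max_atlas M" and A: "openin (mtop M) A"
  obtains T where "open T" "A \<inter> U = U \<inter> \<phi> -` T"
proof -
  have loc: "\<exists>T. open T \<and> \<phi> x \<in> T \<and> U \<inter> \<phi> -` T \<subseteq> A" if x: "x \<in> A" "x \<in> U" for x
  proof -
    obtain V \<psi> where V: "(V, \<psi>) \<in> atlas M" "x \<in> V" using x(2) max_sub[OF c] atlas_at by blast
    obtain T where T: "open T" "A \<inter> V = V \<inter> \<psi> -` T"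
      using A V(1) unfolding openin_mtop by blast
    obtain T1 where T1: "open T1" "U \<inter> V = U \<inter> \<phi> -` T1" using compat_max(1)[OF c V(1)] by blast
    obtain T2 where T2: "open T2" "\<And>z. z \<in> \<phi> ` (U \<inter> V) \<Longrightarrow> \<psi> (inv_into U \<phi> z) \<in> T \<longleftrightarrow> z \<in> T2"
      using smooth_on_relative_preimage[OF compat_max(3)[OF c V(1)] T(1)] by blast
    have 1: "y \<in> A" if "y \<in> U" "\<phi> y \<in> T1 \<inter> T2" for y
      using T1(2) T2(2)[of "\<phi> y"] that max_inj[OF c] T(2) by auto
    have "\<phi> x \<in> T1 \<inter> T2" using T1(2) T2(2)[of "\<phi> x"] x V(2) max_inj[OF c] T(2) by auto
    then show ?thesis using open_Int[OF T1(1) T2(1)] 1 by (intro exI[of _ "T1 \<inter> T2"]) auto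
  qed
  define T where "T = \<Union>{T. open T \<and> U \<inter> \<phi> -` T \<subseteq> A}"
  have "open T" unfolding T_def by blast
  moreover have "A \<inter> U = U \<inter> \<phi> -` T" unfolding T_def using loc by fast
  ultimately show thesis using that by blast
qed

lemma max_at:
  assumes "x \<in> pts M" obtains U \<phi> where "(U, \<phi>) \<in> max_atlas M" "x \<in> U"
  using atlas_at[OF assms] atlas_max by blast

text \<open>Members of the maximal atlas are by definition compatible with the charts of
  \<open>atlas M\<close>. Two of them are compared by passing locally through such a chart X around
  the given point.\<close>

lemma transition_smooth:
  assumes c: "(U, \<phi>) \<in> max_atlas M" and c': "(V, \<psi>) \<in> max_atlas M"
  shows "smooth_on (\<phi> ` (U \<inter> V)) (\<lambda>z. \<psi> (inv_into U \<phi> z))"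
proof (rule smooth_on_local)
  fix z assume "z \<in> \<phi> ` (U \<inter> V)"
  then obtain x where x: "x \<in> U" "x \<in> V" "z = \<phi> x" by blast
  obtain X \<theta> where X: "(X, \<theta>) \<in> atlas M" "x \<in> X" using x(1) max_sub[OF c] atlas_at by blast
  obtain T where T: "open T" "U \<inter> X = U \<inter> \<phi> -` T" using compat_max(1)[OF c X(1)] by blast
  have \<theta>: "inj_on \<theta> X" using X(1) atlas_max max_inj by blast
  note [simp] = inv_into_f_f[OF max_inj[OF c]] inv_into_f_f[OF \<theta>]
  have "smooth_on (\<phi> ` (U \<inter> V \<inter> X)) (\<lambda>z. \<psi> (inv_into X \<theta> (\<theta> (inv_into U \<phi> z))))"
    by (rule smooth_on_compose[OF smooth_on_subset[OF compat_max(3)[OF c X(1)]] compat_max(4)[OF c' X(1)]]) auto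
  then have "smooth_on (\<phi> ` (U \<inter> V) \<inter> T) (\<lambda>z. \<psi> (inv_into X \<theta> (\<theta> (inv_into U \<phi> z))))"
    by (rule smooth_on_subset) (use T in auto)
  then have "smooth_on (\<phi> ` (U \<inter> V) \<inter> T) (\<lambda>z. \<psi> (inv_into U \<phi> z))"
  proof (rule smooth_on_cong)
    fix w assume "w \<in> \<phi> ` (U \<inter> V) \<inter> T"
    then obtain y where y: "y \<in> U" "y \<in> V" "w = \<phi> y" "\<phi> y \<in> T" by blast
    then have "y \<in> X" using T by blast
    then show "\<psi> (inv_into X \<theta> (\<theta> (inv_into U \<phi> w))) = \<psi> (inv_into U \<phi> w)" using y by simp
  qed
  then show "\<exists>T. open T \<and> z \<in> T \<and> smooth_on (\<phi> ` (U \<inter> V) \<inter> T) (\<lambda>z. \<psi> (inv_into U \<phi> z))"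
    using T x X(2) by (intro exI[of _ T]) auto
qed

lemma smooth_chart_transfer:
  assumes c: "(U, \<phi>) \<in> max_atlas M" and c': "(V, \<psi>) \<in> max_atlas M"
    and F: "smooth_on (\<phi> ` (A \<inter> U)) (F \<circ> inv_into U \<phi>)"
  shows "smooth_on (\<psi> ` (A \<inter> U \<inter> V)) (F \<circ> inv_into V \<psi>)"
proof -
  note [simp] = inv_into_f_f[OF max_inj[OF c]] inv_into_f_f[OF max_inj[OF c']]
  have "smooth_on (\<psi> ` (A \<inter> U \<inter> V)) (\<lambda>z. (F \<circ> inv_into U \<phi>) (\<phi> (inv_into V \<psi> z)))"
    by (rule smooth_on_compose[OF smooth_on_subset[OF transition_smooth[OF c' c]] F]) auto
  then show ?thesis by (rule smooth_on_cong) auto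
qed

lemma smooth_chart_local:
  assumes c: "(U, \<phi>) \<in> max_atlas M"
    and loc: "\<And>x. x \<in> A \<Longrightarrow> x \<in> U \<Longrightarrow> \<exists>B. openin (mtop M) B \<and> x \<in> B \<and> smooth_on (\<phi> ` (A \<inter> B \<inter> U)) (F \<circ> inv_into U \<phi>)"
  shows "smooth_on (\<phi> ` (A \<inter> U)) (F \<circ> inv_into U \<phi>)"
proof (rule smooth_on_local)
  fix z assume "z \<in> \<phi> ` (A \<inter> U)"
  then obtain x where x: "x \<in> A" "x \<in> U" "z = \<phi> x" by blast
  obtain B where B: "openin (mtop M) B" "x \<in> B" "smooth_on (\<phi> ` (A \<inter> B \<inter> U)) (F \<circ> inv_into U \<phi>)"
    using loc[OF x(1,2)] by blast
  obtain T where T: "open T" "B \<inter> U = U \<inter> \<phi> -` T" using open_max_preimage[OF c B(1)] by blast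
  have "smooth_on (\<phi> ` (A \<inter> U) \<inter> T) (F \<circ> inv_into U \<phi>)"
    by (rule smooth_on_subset[OF B(3)]) (use T in auto)
  then show "\<exists>T. open T \<and> z \<in> T \<and> smooth_on (\<phi> ` (A \<inter> U) \<inter> T) (F \<circ> inv_into U \<phi>)"
    using T x B(2) by (intro exI[of _ T]) auto
qed

lemma smooth_fn_max:
  assumes F: "smooth_fn M A F" and c: "(U, \<phi>) \<in> max_atlas M"
  shows "smooth_on (\<phi> ` (A \<inter> U)) (F \<circ> inv_into U \<phi>)"
proof (rule smooth_chart_local[OF c])
  fix x assume x: "x \<in> A" "x \<in> U"
  obtain V \<psi> where V: "(V, \<psi>) \<in> atlas M" "x \<in> V" using x(2) max_sub[OF c] atlas_at by blast
  have V': "(V, \<psi>) \<in> max_atlas M" using V atlas_max by blast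
  have "smooth_on (\<psi> ` (A \<inter> V)) (F \<circ> inv_into V \<psi>)" using F V(1) unfolding smooth_fn_def by blast
  then show "\<exists>B. openin (mtop M) B \<and> x \<in> B \<and> smooth_on (\<phi> ` (A \<inter> B \<inter> U)) (F \<circ> inv_into U \<phi>)"
    using smooth_chart_transfer[OF V' c] max_open[OF V'] V(2) by blast
qed

text \<open>By smoothness of the transition maps the chart, and the neighbourhood on which it is
  used, may change from point to point.\<close>

lemma smooth_fnI:
  assumes loc: "\<And>x. x \<in> A \<Longrightarrow> x \<in> pts M \<Longrightarrow>
      \<exists>U \<phi> B. (U, \<phi>) \<in> max_atlas M \<and> openin (mtop M) B \<and> x \<in> B \<and> x \<in> U \<and>
        smooth_on (\<phi> ` (A \<inter> B \<inter> U)) (F \<circ> inv_into U \<phi>)"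
  shows "smooth_fn M A F"
  unfolding smooth_fn_def
proof (intro ballI, clarify)
  fix V \<psi> assume V: "(V, \<psi>) \<in> atlas M"
  then have V': "(V, \<psi>) \<in> max_atlas M" using atlas_max by blast
  show "smooth_on (\<psi> ` (A \<inter> V)) (F \<circ> inv_into V \<psi>)"
  proof (rule smooth_chart_local[OF V'])
    fix x assume x: "x \<in> A" "x \<in> V"
    then obtain U \<phi> B where U: "(U, \<phi>) \<in> max_atlas M" "openin (mtop M) B" "x \<in> B" "x \<in> U"
        "smooth_on (\<phi> ` (A \<inter> B \<inter> U)) (F \<circ> inv_into U \<phi>)"
      using loc max_sub[OF V'] by blast
    have "smooth_on (\<psi> ` (A \<inter> (B \<inter> U) \<inter> V)) (F \<circ> inv_into V \<psi>)"
      using smooth_chart_transfer[OF U(1) V' U(5)] by (simp add: Int_assoc)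
    then show "\<exists>B. openin (mtop M) B \<and> x \<in> B \<and> smooth_on (\<psi> ` (A \<inter> B \<inter> V)) (F \<circ> inv_into V \<psi>)"
      using openin_Int[OF U(2) max_open[OF U(1)]] U(3,4) by blast
  qed
qed

lemma smooth_fn_local:
  assumes loc: "\<And>x. x \<in> A \<Longrightarrow> x \<in> pts M \<Longrightarrow> \<exists>B. openin (mtop M) B \<and> x \<in> B \<and> smooth_fn M (A \<inter> B) F"
  shows "smooth_fn M A F"
proof (rule smooth_fnI)
  fix x assume x: "x \<in> A" "x \<in> pts M"
  obtain B where B: "openin (mtop M) B" "x \<in> B" "smooth_fn M (A \<inter> B) F" using loc[OF x] by blast
  obtain U \<phi> where "(U, \<phi>) \<in> max_atlas M" "x \<in> U" using max_at[OF x(2)] by blast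
  then show "\<exists>U \<phi> B. (U, \<phi>) \<in> max_atlas M \<and> openin (mtop M) B \<and> x \<in> B \<and> x \<in> U \<and>
        smooth_on (\<phi> ` (A \<inter> B \<inter> U)) (F \<circ> inv_into U \<phi>)"
    using B smooth_fn_max[OF B(3)] by blast
qed

lemma smooth_fn_subset: "smooth_fn M A F \<Longrightarrow> B \<subseteq> A \<Longrightarrow> smooth_fn M B F"
  unfolding smooth_fn_def by (fast elim: smooth_on_subset)

lemma smooth_fn_cong:
  assumes "smooth_fn M A F" "\<And>x. x \<in> A \<Longrightarrow> F x = G x"
  shows "smooth_fn M A G"
  unfolding smooth_fn_def
proof (intro ballI, clarify)
  fix U \<phi> assume U: "(U, \<phi>) \<in> atlas M"
  have inj: "inj_on \<phi> U" using U atlas_max max_inj by blast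
  have "smooth_on (\<phi> ` (A \<inter> U)) (F \<circ> inv_into U \<phi>)" using assms(1) U unfolding smooth_fn_def by blast
  then show "smooth_on (\<phi> ` (A \<inter> U)) (G \<circ> inv_into U \<phi>)"
    by (rule smooth_on_cong) (use assms(2) inv_into_f_f[OF inj] in auto)
qed

lemma smooth_fn_compose:
  assumes F: "smooth_fn M A F" and g: "smooth_on T g" and AT: "F ` A \<subseteq> T"
  shows "smooth_fn M A (\<lambda>x. g (F x))"
  unfolding smooth_fn_def
proof (intro ballI, clarify)
  fix U \<phi> assume U: "(U, \<phi>) \<in> atlas M"
  have inj: "inj_on \<phi> U" using U atlas_max max_inj by blast
  have "smooth_on (\<phi> ` (A \<inter> U)) (F \<circ> inv_into U \<phi>)" using F U unfolding smooth_fn_def by blast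
  then have "smooth_on (\<phi> ` (A \<inter> U)) (\<lambda>z. g ((F \<circ> inv_into U \<phi>) z))"
    by (rule smooth_on_compose[OF _ g]) (use AT inv_into_f_f[OF inj] in auto)
  then show "smooth_on (\<phi> ` (A \<inter> U)) ((\<lambda>x. g (F x)) \<circ> inv_into U \<phi>)" by (simp add: o_def)
qed

lemma smooth_fn_chart:
  assumes c: "(U, \<phi>) \<in> max_atlas M" and g: "smooth_on (\<phi> ` (A \<inter> U)) g"
    and F: "\<And>x. x \<in> A \<Longrightarrow> F x = g (\<phi> x)" and AU: "A \<subseteq> U"
  shows "smooth_fn M A F"
proof (rule smooth_fnI)
  fix x assume x: "x \<in> A" "x \<in> pts M"
  have "smooth_on (\<phi> ` (A \<inter> U)) (F \<circ> inv_into U \<phi>)"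
    by (rule smooth_on_cong[OF g]) (use F AU inv_into_f_f[OF max_inj[OF c]] in auto)
  then have "smooth_on (\<phi> ` (A \<inter> U \<inter> U)) (F \<circ> inv_into U \<phi>)" by simp
  then show "\<exists>U \<phi> B. (U, \<phi>) \<in> max_atlas M \<and> openin (mtop M) B \<and> x \<in> B \<and> x \<in> U \<and>
        smooth_on (\<phi> ` (A \<inter> B \<inter> U)) (F \<circ> inv_into U \<phi>)"
    using c max_open[OF c] x AU by blast
qed

lemma smooth_fn_coord: "(U, \<phi>) \<in> max_atlas M \<Longrightarrow> smooth_fn M U \<phi>"
  by (rule smooth_fn_chart[OF _ smooth_on_id]) auto

lemma smooth_fn_open_preimage:
  assumes F: "smooth_fn M B F" and B: "openin (mtop M) B" and T: "open T"
  shows "openin (mtop M) (B \<inter> F -` T)"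
proof (subst openin_subopen, intro ballI)
  fix x assume x: "x \<in> B \<inter> F -` T"
  have xM: "x \<in> pts M" using x B openin_subset[OF B] topspace_mtop by blast
  then obtain U \<phi> where U: "(U, \<phi>) \<in> max_atlas M" "x \<in> U" using max_at by blast
  obtain T2 where T2: "open T2" "\<And>z. z \<in> \<phi> ` (B \<inter> U) \<Longrightarrow> (F \<circ> inv_into U \<phi>) z \<in> T \<longleftrightarrow> z \<in> T2"
    using smooth_on_relative_preimage[OF smooth_fn_max[OF F U(1)] T] by blast
  have *: "y \<in> F -` T \<longleftrightarrow> \<phi> y \<in> T2" if "y \<in> B" "y \<in> U" for y
    using T2(2)[of "\<phi> y"] inv_into_f_f[OF max_inj[OF U(1)]] that by auto
  have "openin (mtop M) (B \<inter> (U \<inter> \<phi> -` T2))"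
    using openin_Int[OF B max_open_preimage[OF U(1) T2(1)]] .
  moreover have "x \<in> B \<inter> (U \<inter> \<phi> -` T2)" "B \<inter> (U \<inter> \<phi> -` T2) \<subseteq> B \<inter> F -` T"
    using * x U(2) by auto
  ultimately show "\<exists>S. openin (mtop M) S \<and> x \<in> S \<and> S \<subseteq> B \<inter> F -` T" by blast
qed

text \<open>Transition maps between f and any chart of the atlas factor through \<phi>, so being
  smoothly related to the single chart \<phi> is enough.\<close>

lemma max_atlasI:
  assumes c: "(U, \<phi>) \<in> max_atlas M" and A: "openin (mtop M) A" "A \<subseteq> U"
    and f: "inj_on f A" and W: "subspace W" "openin (top_of_set W) (f ` A)"
    and sm: "smooth_on (\<phi> ` A) (f \<circ> inv_into U \<phi>)" "smooth_on (f ` A) (\<phi> \<circ> inv_into A f)"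
  shows "(A, f) \<in> max_atlas M"
proof -
  note [simp] = inv_into_f_f[OF max_inj[OF c]] inv_into_f_f[OF f]
  have "compatible (A, f) c' \<and> compatible c' (A, f)" if c': "c' \<in> atlas M" for c'
  proof -
    obtain V \<psi> where V: "c' = (V, \<psi>)" by (cases c')
    then have m: "(V, \<psi>) \<in> max_atlas M" using c' atlas_max by blast
    note [simp] = inv_into_f_f[OF max_inj[OF m]]
    obtain T where T: "open T" "V \<inter> U = U \<inter> \<phi> -` T"
      using open_max_preimage[OF c max_open[OF m]] by blast
    obtain T2 where T2: "open T2" "\<And>z. z \<in> f ` A \<Longrightarrow> (\<phi> \<circ> inv_into A f) z \<in> T \<longleftrightarrow> z \<in> T2"
      using smooth_on_relative_preimage[OF sm(2) T(1)] by blast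
    have "y \<in> V \<longleftrightarrow> f y \<in> T2" if "y \<in> A" for y
      using T2(2)[of "f y"] T(2) A(2) that by auto
    then have "A \<inter> V = A \<inter> f -` T2" by blast
    then have 1: "openin (top_of_set (f ` A)) (f ` (A \<inter> V))"
      using openin_image_iff[OF f, of "A \<inter> V"] T2(1) by blast
    have "smooth_on (f ` (A \<inter> V)) (\<lambda>z. (\<lambda>w. \<psi> (inv_into U \<phi> w)) ((\<phi> \<circ> inv_into A f) z))"
      by (rule smooth_on_compose[OF smooth_on_subset[OF sm(2)] transition_smooth[OF c m]])
        (use A(2) in auto)
    then have 2: "smooth_on (f ` (A \<inter> V)) (\<psi> \<circ> inv_into A f)"
      by (rule smooth_on_cong) (use A(2) in auto)
    obtain T3 where "open T3" "A \<inter> V = V \<inter> \<psi> -` T3"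
      using open_max_preimage[OF m A(1)] by blast
    then have 3: "openin (top_of_set (\<psi> ` V)) (\<psi> ` (V \<inter> A))"
      using openin_image_iff[OF max_inj[OF m], of "A \<inter> V"] by (simp add: Int_commute) blast
    have "smooth_on (\<psi> ` (V \<inter> A)) (\<lambda>z. (f \<circ> inv_into U \<phi>) (\<phi> (inv_into V \<psi> z)))"
      by (rule smooth_on_compose[OF smooth_on_subset[OF transition_smooth[OF m c]] sm(1)])
        (use A(2) in auto)
    then have 4: "smooth_on (\<psi> ` (V \<inter> A)) (f \<circ> inv_into V \<psi>)"
      by (rule smooth_on_cong) (use A(2) in auto)
    show ?thesis unfolding V compatible_def using 1 2 3 4 by simp
  qed
  moreover have "A \<subseteq> pts M" using A(2) max_sub[OF c] by blast
  ultimately show ?thesis unfolding max_atlas_def chart_of_dim_def using f W by auto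
qed

text \<open>A transition map is a continuous injection of a nonempty open part of one subspace into
  the other, and invariance of dimension applies in both directions.\<close>

lemma chart_dim_unique:
  assumes c: "(U, \<phi>) \<in> max_atlas M" "(V, \<psi>) \<in> max_atlas M" and x: "x \<in> U" "x \<in> V"
    and d: "chart_of_dim d (U, \<phi>)" "chart_of_dim d' (V, \<psi>)"
  shows "d = d'"
proof -
  have le: "d \<le> d'" if c: "(U, \<phi>) \<in> max_atlas M" "(V, \<psi>) \<in> max_atlas M" and x: "x \<in> U" "x \<in> V"
    and d: "chart_of_dim d (U, \<phi>)" "chart_of_dim d' (V, \<psi>)" for U V \<phi> \<psi> d d'
  proof -
    obtain W W' where W: "subspace W" "dim W = d" "openin (top_of_set W) (\<phi> ` U)"
      and W': "subspace W'" "dim W' = d'" "openin (top_of_set W') (\<psi> ` V)"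
      using d unfolding chart_of_dim_def by blast
    obtain T where T: "open T" "V \<inter> U = U \<inter> \<phi> -` T"
      using open_max_preimage[OF c(1) max_open[OF c(2)]] by blast
    have "openin (top_of_set (\<phi> ` U)) (\<phi> ` (U \<inter> V))"
      using openin_image_iff[OF max_inj[OF c(1)], of "U \<inter> V"] T by (metis Int_commute inf_le1)
    then have o: "openin (top_of_set W) (\<phi> ` (U \<inter> V))" using W(3) openin_trans by blast
    note [simp] = inv_into_f_f[OF max_inj[OF c(1)]]
    have "dim W \<le> dim W'"
    proof (rule invariance_of_dimension_subspaces[OF o W(1) W'(1)])
      show "continuous_on (\<phi> ` (U \<inter> V)) (\<lambda>z. \<psi> (inv_into U \<phi> z))"
        using transition_smooth[OF c] by (rule smooth_on_continuous_on)
      show "(\<lambda>z. \<psi> (inv_into U \<phi> z)) \<in> \<phi> ` (U \<inter> V) \<rightarrow> W'"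
        using openin_imp_subset[OF W'(3)] by auto
      show "inj_on (\<lambda>z. \<psi> (inv_into U \<phi> z)) (\<phi> ` (U \<inter> V))"
        using max_inj[OF c(2)] by (auto simp: inj_on_def)
      show "\<phi> ` (U \<inter> V) \<noteq> {}" using x by blast
    qed
    then show ?thesis using W W' by simp
  qed
  show ?thesis using le[OF c x d] le[OF c(2,1) x(2,1) d(2,1)] by simp
qed

end

section \<open>Smooth maps and curves\<close>

lemma smooth_map_pts:
  assumes "smooth_map N M p" "smooth_atlas N" "smooth_atlas M" "x \<in> pts N"
  shows "p x \<in> pts M"
  using assms continuous_map_image_subset_topspace[of "mtop N" "mtop M" p]
  by (auto simp: smooth_map_def smooth_atlas.topspace_mtop)

lemma smooth_map_open_preimage:
  assumes "smooth_map N M p" "smooth_atlas N" "openin (mtop M) A"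
  shows "openin (mtop N) (pts N \<inter> p -` A)"
  using assms openin_continuous_map_preimage[of "mtop N" "mtop M" p A]
  by (auto simp: smooth_map_def smooth_atlas.topspace_mtop Collect_conj_eq vimage_def)

lemma smooth_map_fn:
  assumes p: "smooth_map N M p" and N: "smooth_atlas N" and M: "smooth_atlas M"
    and F: "smooth_fn M A F"
  shows "smooth_fn N (pts N \<inter> p -` A) (\<lambda>x. F (p x))"
proof -
  interpret N: smooth_atlas N by fact
  interpret M: smooth_atlas M by fact
  show ?thesis
  proof (rule N.smooth_fn_local)
    fix x assume x: "x \<in> pts N \<inter> p -` A" "x \<in> pts N"
    obtain V \<psi> where V: "(V, \<psi>) \<in> atlas M" "p x \<in> V"
      using M.atlas_at smooth_map_pts[OF p N M x(2)] by blast
    have V': "(V, \<psi>) \<in> max_atlas M" using V(1) M.atlas_max by blast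
    have "smooth_fn N (p -` V) (\<psi> \<circ> p)"
      using p V(1) unfolding smooth_map_def smooth_fn_def
      by (fastforce simp: o_assoc Int_commute)
    then have "smooth_fn N (p -` A \<inter> p -` V) (\<psi> \<circ> p)" by (rule N.smooth_fn_subset) blast
    then have "smooth_fn N (p -` A \<inter> p -` V) (\<lambda>x. (F \<circ> inv_into V \<psi>) ((\<psi> \<circ> p) x))"
      by (rule N.smooth_fn_compose[OF _ M.smooth_fn_max[OF F V']]) auto
    then have "smooth_fn N (p -` A \<inter> p -` V) (\<lambda>x. F (p x))"
      by (rule N.smooth_fn_cong) (use inv_into_f_f[OF M.max_inj[OF V']] in auto)
    then have "smooth_fn N (pts N \<inter> p -` A \<inter> (pts N \<inter> p -` V)) (\<lambda>x. F (p x))"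
      by (rule N.smooth_fn_subset) blast
    then show "\<exists>B. openin (mtop N) B \<and> x \<in> B \<and> smooth_fn N (pts N \<inter> p -` A \<inter> B) (\<lambda>x. F (p x))"
      using smooth_map_open_preimage[OF p N M.max_open[OF V']] x V(2) by blast
  qed
qed

text \<open>Continuity need not be checked separately: an open B is mapped into one chart V, and
  \<psi> o p is continuous on B.\<close>

lemma smooth_mapI:
  assumes N: "smooth_atlas N" and M: "smooth_atlas M"
    and loc: "\<And>x. x \<in> pts N \<Longrightarrow> \<exists>B V \<psi>. openin (mtop N) B \<and> x \<in> B \<and> (V, \<psi>) \<in> max_atlas M \<and> p ` B \<subseteq> V \<and>
      smooth_fn N B (\<lambda>x. \<psi> (p x))"
  shows "smooth_map N M p"
proof -
  interpret N: smooth_atlas N by fact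
  interpret M: smooth_atlas M by fact
  have pts: "p x \<in> pts M" if "x \<in> pts N" for x
    using loc[OF that] M.max_sub by blast
  have "openin (mtop N) {x \<in> pts N. p x \<in> G}" if G: "openin (mtop M) G" for G
  proof (subst openin_subopen, intro ballI)
    fix x assume x: "x \<in> {x \<in> pts N. p x \<in> G}"
    then obtain B V \<psi> where B: "openin (mtop N) B" "x \<in> B" "(V, \<psi>) \<in> max_atlas M" "p ` B \<subseteq> V"
      "smooth_fn N B (\<lambda>x. \<psi> (p x))" using loc[of x] by blast
    obtain T where T: "open T" "G \<inter> V = V \<inter> \<psi> -` T" using M.open_max_preimage[OF B(3) G] by blast
    have "openin (mtop N) (B \<inter> (\<lambda>x. \<psi> (p x)) -` T)"
      by (rule N.smooth_fn_open_preimage[OF B(5,1) T(1)])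
    moreover have "B \<inter> (\<lambda>x. \<psi> (p x)) -` T \<subseteq> {x \<in> pts N. p x \<in> G}"
      using B(4) T(2) openin_subset[OF B(1)] N.topspace_mtop by blast
    moreover have "x \<in> B \<inter> (\<lambda>x. \<psi> (p x)) -` T" using x B T by blast
    ultimately show "\<exists>S. openin (mtop N) S \<and> x \<in> S \<and> S \<subseteq> {x \<in> pts N. p x \<in> G}" by blast
  qed
  then have "continuous_map (mtop N) (mtop M) p"
    unfolding continuous_map_def using pts N.topspace_mtop M.topspace_mtop by auto
  moreover have "smooth_on (\<phi> ` (U \<inter> p -` V)) (\<psi> \<circ> p \<circ> inv_into U \<phi>)"
    if U: "(U, \<phi>) \<in> atlas N" and V: "(V, \<psi>) \<in> atlas M" for U \<phi> V \<psi>
  proof -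
    have V': "(V, \<psi>) \<in> max_atlas M" using V M.atlas_max by blast
    have "smooth_fn N (p -` V) (\<lambda>x. \<psi> (p x))"
    proof (rule N.smooth_fn_local)
      fix x assume x: "x \<in> p -` V" "x \<in> pts N"
      then obtain B X \<theta> where B: "openin (mtop N) B" "x \<in> B" "(X, \<theta>) \<in> max_atlas M" "p ` B \<subseteq> X"
        "smooth_fn N B (\<lambda>x. \<theta> (p x))" using loc[of x] by blast
      have "smooth_fn N (p -` V \<inter> B) (\<lambda>x. \<theta> (p x))" using B(5) by (rule N.smooth_fn_subset) blast
      then have "smooth_fn N (p -` V \<inter> B) (\<lambda>x. (\<lambda>z. \<psi> (inv_into X \<theta> z)) (\<theta> (p x)))"
        by (rule N.smooth_fn_compose[OF _ M.transition_smooth[OF B(3) V']]) (use B(4) in auto)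
      then have "smooth_fn N (p -` V \<inter> B) (\<lambda>x. \<psi> (p x))"
        by (rule N.smooth_fn_cong) (use B(4) inv_into_f_f[OF M.max_inj[OF B(3)]] in auto)
      then show "\<exists>B. openin (mtop N) B \<and> x \<in> B \<and> smooth_fn N (p -` V \<inter> B) (\<lambda>x. \<psi> (p x))"
        using B(1,2) by blast
    qed
    then have "smooth_on (\<phi> ` (p -` V \<inter> U)) ((\<lambda>x. \<psi> (p x)) \<circ> inv_into U \<phi>)"
      using U unfolding smooth_fn_def by blast
    then show ?thesis by (simp add: o_def Int_commute)
  qed
  ultimately show ?thesis unfolding smooth_map_def by blast
qed

lemma smooth_map_local:
  assumes N: "smooth_atlas N" and M: "smooth_atlas M"
    and loc: "\<And>x. x \<in> pts N \<Longrightarrow> \<exists>B q. openin (mtop N) B \<and> x \<in> B \<and> smooth_map N M q \<and> (\<forall>y\<in>B. q y = p y)"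
  shows "smooth_map N M p"
proof (rule smooth_mapI[OF N M])
  interpret N: smooth_atlas N by fact
  interpret M: smooth_atlas M by fact
  fix x assume x: "x \<in> pts N"
  then obtain B q where B: "openin (mtop N) B" "x \<in> B" "smooth_map N M q" "\<forall>y\<in>B. q y = p y"
    using loc by blast
  obtain V \<psi> where V: "(V, \<psi>) \<in> max_atlas M" "q x \<in> V"
    using M.max_at smooth_map_pts[OF B(3) N M x] by blast
  let ?B = "B \<inter> (pts N \<inter> q -` V)"
  have "smooth_fn N ?B (\<lambda>x. \<psi> (q x))"
    by (rule N.smooth_fn_subset[OF smooth_map_fn[OF B(3) N M M.smooth_fn_coord[OF V(1)]]]) blast
  then have "smooth_fn N ?B (\<lambda>x. \<psi> (p x))"
    by (rule N.smooth_fn_cong) (use B(4) in auto)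
  moreover have "openin (mtop N) ?B"
    using openin_Int[OF B(1) smooth_map_open_preimage[OF B(3) N M.max_open[OF V(1)]]] .
  moreover have "x \<in> ?B" "p ` ?B \<subseteq> V" using x B V(2) by auto
  ultimately show "\<exists>B V \<psi>. openin (mtop N) B \<and> x \<in> B \<and> (V, \<psi>) \<in> max_atlas M \<and> p ` B \<subseteq> V \<and>
      smooth_fn N B (\<lambda>x. \<psi> (p x))" using V(1) by blast
qed

lemma smooth_map_compose:
  assumes p: "smooth_map N M p" and q: "smooth_map M L q"
    and N: "smooth_atlas N" and M: "smooth_atlas M" and L: "smooth_atlas L"
  shows "smooth_map N L (\<lambda>x. q (p x))"
proof (rule smooth_mapI[OF N L])
  interpret N: smooth_atlas N by fact
  interpret M: smooth_atlas M by fact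
  interpret L: smooth_atlas L by fact
  fix x assume x: "x \<in> pts N"
  have px: "p x \<in> pts M" by (rule smooth_map_pts[OF p N M x])
  obtain V \<psi> where V: "(V, \<psi>) \<in> max_atlas L" "q (p x) \<in> V"
    using L.max_at smooth_map_pts[OF q M L px] by blast
  let ?A = "pts M \<inter> q -` V" and ?B = "pts N \<inter> p -` (pts M \<inter> q -` V)"
  have "openin (mtop N) ?B"
    using smooth_map_open_preimage[OF p N] smooth_map_open_preimage[OF q M L.max_open[OF V(1)]] by blast
  moreover have "smooth_fn N ?B (\<lambda>x. \<psi> (q (p x)))"
    using smooth_map_fn[OF p N M smooth_map_fn[OF q M L L.smooth_fn_coord[OF V(1)]]] .
  moreover have "x \<in> ?B" "(\<lambda>x. q (p x)) ` ?B \<subseteq> V" using x px V(2) by auto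
  ultimately show "\<exists>B V \<psi>. openin (mtop N) B \<and> x \<in> B \<and> (V, \<psi>) \<in> max_atlas L \<and> (\<lambda>x. q (p x)) ` B \<subseteq> V \<and>
      smooth_fn N B (\<lambda>x. \<psi> (q (p x)))" using V(1) by blast
qed

section \<open>Smooth curves\<close>

lemma real_line_simps [simp]: "pts real_line = UNIV" "atlas real_line = {(UNIV, \<lambda>t. t)}"
  by (simp_all add: real_line_def)

lemma smooth_atlas_real_line: "smooth_atlas real_line"
proof
  fix c c' :: "real set \<times> (real \<Rightarrow> real)"
  show "\<exists>d. chart_of_dim d c" if "c \<in> atlas real_line"
    using that unfolding chart_of_dim_def by (auto intro!: exI[of _ "dim (UNIV::real set)"] exI[of _ UNIV])
  show "compatible c c'" if "c \<in> atlas real_line" "c' \<in> atlas real_line"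
    using that by (auto simp: compatible_def o_def intro: smooth_on_id)
qed simp

lemma mtop_real_line [simp]: "openin (mtop real_line) A \<longleftrightarrow> open A"
  by (auto simp: openin_mtop vimage_def)

lemma smooth_fn_real_line [simp]: "smooth_fn real_line A F \<longleftrightarrow> smooth_on A F"
  by (simp add: smooth_fn_def o_def)

lemma smooth_curve_pts: "smooth_curve M c \<Longrightarrow> smooth_atlas M \<Longrightarrow> c t \<in> pts M"
  using smooth_map_pts[OF _ smooth_atlas_real_line, of M c t] by simp

lemma smooth_curve_open: "smooth_curve M c \<Longrightarrow> openin (mtop M) A \<Longrightarrow> open (c -` A)"
  using smooth_map_open_preimage[OF _ smooth_atlas_real_line, of M c A] by simp

lemma smooth_curve_fn:
  "smooth_curve M c \<Longrightarrow> smooth_atlas M \<Longrightarrow> smooth_fn M A F \<Longrightarrow> smooth_on (c -` A) (\<lambda>t. F (c t))"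
  using smooth_map_fn[OF _ smooth_atlas_real_line, of M c A F] by simp

lemma smooth_curve_local:
  assumes "smooth_atlas M" "\<And>t. \<exists>T d. open T \<and> t \<in> T \<and> smooth_curve M d \<and> (\<forall>s\<in>T. d s = c s)"
  shows "smooth_curve M c"
  by (rule smooth_map_local[OF smooth_atlas_real_line assms(1)]) (use assms(2) in simp)

lemma smooth_curve_reparam:
  assumes "smooth_curve M c" "smooth_atlas M" "smooth_on UNIV h"
  shows "smooth_curve M (\<lambda>t. c (h t))"
proof (rule smooth_map_compose[OF _ assms(1) smooth_atlas_real_line smooth_atlas_real_line assms(2)])
  show "smooth_map real_line real_line h"
    by (rule smooth_mapI[OF smooth_atlas_real_line smooth_atlas_real_line], rule exI[of _ UNIV], rule exI[of _ UNIV],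
        rule exI[of _ "\<lambda>t. t"])
      (use assms(3) smooth_atlas.atlas_max[OF smooth_atlas_real_line] in auto)
qed

context smooth_atlas
begin

lemma smooth_curve_chart:
  assumes c: "(U, \<phi>) \<in> max_atlas M" and \<gamma>: "smooth_on UNIV \<gamma>" "\<And>t. \<gamma> t \<in> \<phi> ` U"
  shows "smooth_curve M (\<lambda>t. inv_into U \<phi> (\<gamma> t))"
proof (rule smooth_mapI[OF smooth_atlas_real_line smooth_atlas_axioms])
  fix t
  have 1: "(\<lambda>t. inv_into U \<phi> (\<gamma> t)) ` UNIV \<subseteq> U" using \<gamma>(2) by (auto intro: inv_into_into)
  have 2: "smooth_on UNIV (\<lambda>t. \<phi> (inv_into U \<phi> (\<gamma> t)))"
    by (rule smooth_on_cong[OF \<gamma>(1)]) (use \<gamma>(2) f_inv_into_f in metis)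
  show "\<exists>B V \<psi>. openin (mtop real_line) B \<and> t \<in> B \<and> (V, \<psi>) \<in> max_atlas M \<and> (\<lambda>t. inv_into U \<phi> (\<gamma> t)) ` B \<subseteq> V \<and>
      smooth_fn real_line B (\<lambda>x. \<psi> (inv_into U \<phi> (\<gamma> x)))"
    by (rule exI[of _ UNIV], rule exI[of _ U], rule exI[of _ \<phi>]) (use 1 2 c in auto)
qed

lemma smooth_curve_const: "x \<in> pts M \<Longrightarrow> smooth_curve M (\<lambda>t. x)"
proof -
  assume "x \<in> pts M"
  then obtain U \<phi> where "(U, \<phi>) \<in> max_atlas M" "x \<in> U" using max_at by blast
  then show ?thesis
    using smooth_curve_chart[of U \<phi> "\<lambda>t. \<phi> x"] inv_into_f_f[OF max_inj] by (simp add: smooth_on_const)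
qed

section \<open>Joining points by smooth curves\<close>

lemma smooth_component_refl: "x \<in> A \<Longrightarrow> x \<in> pts M \<Longrightarrow> x \<in> smooth_component M A x"
  unfolding smooth_component_def using smooth_curve_const by blast

lemma smooth_component_sub: "smooth_component M A x \<subseteq> A"
  unfolding smooth_component_def by auto

text \<open>The pieces are slowed down to rest at the junction, so that the concatenation is smooth.\<close>

lemma smooth_component_trans:
  assumes "y \<in> smooth_component M A x" "z \<in> smooth_component M A y"
  shows "z \<in> smooth_component M A x"
proof -
  obtain c where c: "smooth_curve M c" "range c \<subseteq> A" "c 0 = x" "c 1 = y"
    using assms(1) unfolding smooth_component_def by blast
  obtain d where d: "smooth_curve M d" "range d \<subseteq> A" "d 0 = y" "d 1 = z"
    using assms(2) unfolding smooth_component_def by blast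
  \<comment> \<open>The first piece has arrived at y by time 1/3 and the second leaves y only after
    time 2/3, so both formulas are constant around the switch at 1/2.\<close>
  define e where "e t = (if t < 1/2 then c (step (3 * t)) else d (step (3 * t - 2)))" for t
  have lin: "smooth_on UNIV (\<lambda>t::real. 3 * t)" by (intro smooth_on_mult smooth_on_const smooth_on_id)
  have st: "smooth_on UNIV (\<lambda>t. step (3 * t))" "smooth_on UNIV (\<lambda>t. step (3 * t - 2))"
    by (rule smooth_on_compose[OF lin smooth_on_step[of UNIV]], simp,
        rule smooth_on_compose[OF smooth_on_diff[OF lin smooth_on_const] smooth_on_step[of UNIV]], simp)
  have ce: "smooth_curve M (\<lambda>t. c (step (3 * t)))" "smooth_curve M (\<lambda>t. d (step (3 * t - 2)))"
    by (rule smooth_curve_reparam[OF _ smooth_atlas_axioms]; fact)+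
  have "smooth_curve M e"
  proof (rule smooth_curve_local[OF smooth_atlas_axioms])
    fix t :: real
    have 1: "c (step (3 * s)) = e s" if "s < 2/3" for s
      using that c(4) d(3) by (simp add: e_def step_ge_1 step_le_0)
    have 2: "d (step (3 * s - 2)) = e s" if "s > 1/2" for s
      using that by (simp add: e_def)
    show "\<exists>T d. open T \<and> t \<in> T \<and> smooth_curve M d \<and> (\<forall>s\<in>T. d s = e s)"
    proof (cases "t < 2/3")
      case True
      then show ?thesis using ce(1) 1
        by (intro exI[of _ "{..<2/3}"] exI[of _ "\<lambda>t. c (step (3 * t))"]) auto
    next
      case False
      then show ?thesis using ce(2) 2
        by (intro exI[of _ "{1/2<..}"] exI[of _ "\<lambda>t. d (step (3 * t - 2))"]) auto
    qed
  qed
  moreover have "range e \<subseteq> A" using c(2) d(2) by (auto simp: e_def)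
  moreover have "e 0 = x" "e 1 = z" using c d by (auto simp: e_def step_le_0 step_ge_1)
  ultimately show ?thesis unfolding smooth_component_def by blast
qed

text \<open>A smooth curve is defined on the whole line, while the segment between the two
  coordinate points may leave the chart when prolonged. The parameter h, a squared sine, runs from 0
  to 1 and never leaves the unit interval, so the curve stays in the convex set S for all
  times.\<close>

lemma smooth_component_segment:
  assumes c: "(U, \<phi>) \<in> max_atlas M" and S: "convex S" "S \<subseteq> \<phi> ` U" "\<phi> x \<in> S" "\<phi> y \<in> S" "x \<in> U" "y \<in> U"
    and A: "U \<inter> \<phi> -` S \<subseteq> A"
  shows "y \<in> smooth_component M A x"
proof -
  define h where "h t = (sin (pi / 2 * t))\<^sup>2" for t :: real
  have h: "0 \<le> h t" "h t \<le> 1" "h 0 = 0" "h 1 = 1" for t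
    by (simp_all add: h_def abs_square_le_1)
  have "smooth_on UNIV (\<lambda>t::real. pi / 2 * t)" by (intro smooth_on_mult smooth_on_const smooth_on_id)
  then have "smooth_on UNIV (\<lambda>t::real. sin (pi / 2 * t))"
    by (rule smooth_on_compose[OF _ smooth_on_sin[of UNIV]]) simp
  from smooth_on_mult[OF this this] have sh: "smooth_on UNIV h"
    by (simp add: h_def[abs_def] power2_eq_square)
  define \<gamma> where "\<gamma> t = \<phi> x + h t *\<^sub>R (\<phi> y - \<phi> x)" for t
  have s\<gamma>: "smooth_on UNIV \<gamma>"
    unfolding \<gamma>_def[abs_def] by (intro smooth_on_add smooth_on_scaleR sh smooth_on_const)
  have S\<gamma>: "\<gamma> t \<in> S" for t
  proof -
    have "\<gamma> t = (1 - h t) *\<^sub>R \<phi> x + h t *\<^sub>R \<phi> y" by (simp add: \<gamma>_def algebra_simps)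
    then show ?thesis using S(1,3,4) h(1,2)[of t] by (simp add: convexD)
  qed
  let ?c = "\<lambda>t. inv_into U \<phi> (\<gamma> t)"
  have "smooth_curve M ?c" by (rule smooth_curve_chart[OF c s\<gamma>]) (use S\<gamma> S(2) in blast)
  moreover have "?c t \<in> A" for t
  proof -
    have "\<gamma> t \<in> \<phi> ` U" using S\<gamma> S(2) by blast
    then have "?c t \<in> U" "\<phi> (?c t) \<in> S" using S\<gamma>[of t] by (auto simp: inv_into_into f_inv_into_f)
    then show ?thesis using A by blast
  qed
  moreover have "?c 0 = x" "?c 1 = y"
    using S(5,6) inv_into_f_f[OF max_inj[OF c]] by (auto simp: \<gamma>_def h)
  ultimately show ?thesis unfolding smooth_component_def by blast
qed

end

section \<open>Tangent and cotangent spaces in coordinates\<close>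

text \<open>The coordinate vector d\<phi>(v), recovered from the values of the derivation v on the
  components of \<phi>.\<close>

definition coord :: "('a \<Rightarrow> 'e::euclidean_space) \<Rightarrow> 'a tvec \<Rightarrow> 'e" where
  "coord \<phi> v = (\<Sum>b\<in>Basis. v (\<lambda>y. \<phi> y \<bullet> b) *\<^sub>R b)"

lemma coord_combination: "coord \<phi> (\<lambda>f. a * u f + b * v f) = a *\<^sub>R coord \<phi> u + b *\<^sub>R coord \<phi> v"
  by (simp add: coord_def algebra_simps sum.distrib scaleR_sum_right)

lemma smooth_at_iff: "smooth_at M x f \<longleftrightarrow> (\<exists>A. openin (mtop M) A \<and> x \<in> A \<and> smooth_fn M A f)"
  by (simp add: smooth_at_def smooth_fun_on_eq)

text \<open>The difference quotients lie in W, and a subspace of a Euclidean space is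
  closed.\<close>

lemma subspace_has_vector_derivative:
  fixes \<gamma> :: "real \<Rightarrow> 'e::euclidean_space"
  assumes d: "(\<gamma> has_vector_derivative w) (at 0)" and W: "subspace W"
    and T: "open T" "0 \<in> T" "\<And>t. t \<in> T \<Longrightarrow> \<gamma> t \<in> W"
  shows "w \<in> W"
proof (rule Lim_in_closed_set[OF closed_subspace[OF W]])
  show "((\<lambda>t. (1 / t) *\<^sub>R (\<gamma> t - \<gamma> 0)) \<longlongrightarrow> w) (at 0)"
  proof (rule LIM_zero_cancel, rule tendsto_norm_zero_cancel)
    have lim: "((\<lambda>t. norm (\<gamma> t - \<gamma> 0 - t *\<^sub>R w) / norm t) \<longlongrightarrow> 0) (at 0)"
      using d by (simp add: has_vector_derivative_def has_derivative_iff_norm)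
    have eq: "norm (\<gamma> t - \<gamma> 0 - t *\<^sub>R w) / norm t = norm ((1 / t) *\<^sub>R (\<gamma> t - \<gamma> 0) - w)" if "t \<noteq> 0" for t
    proof -
      have "(1 / t) *\<^sub>R (\<gamma> t - \<gamma> 0) - w = (1 / t) *\<^sub>R (\<gamma> t - \<gamma> 0 - t *\<^sub>R w)" using that by (simp add: algebra_simps)
      then show ?thesis by simp
    qed
    show "((\<lambda>t. norm ((1 / t) *\<^sub>R (\<gamma> t - \<gamma> 0) - w)) \<longlongrightarrow> 0) (at 0)"
      by (rule Lim_transform_eventually[OF lim]) (use eq in \<open>auto simp only: eventually_at_filter intro!: always_eventually\<close>)
  qed
  show "\<forall>\<^sub>F t in at 0. (1 / t) *\<^sub>R (\<gamma> t - \<gamma> 0) \<in> W"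
    using eventually_at_in_open'[OF T(1,2)] by eventually_elim (use T W in \<open>auto intro: subspace_mul subspace_diff\<close>)
qed simp

context smooth_atlas
begin

lemma smooth_at_chartE:
  assumes c: "(U, \<phi>) \<in> max_atlas M" and x: "x \<in> U" and f: "smooth_at M x f"
  obtains V g B where "Cinf V g" "openin (mtop M) B" "x \<in> B" "B \<subseteq> U"
    "\<And>y. y \<in> B \<Longrightarrow> \<phi> y \<in> V" "\<And>y. y \<in> B \<Longrightarrow> f y = g (\<phi> y)"
proof -
  obtain A where A: "openin (mtop M) A" "x \<in> A" "smooth_fn M A f" using f unfolding smooth_at_iff by blast
  have "\<phi> x \<in> \<phi> ` (A \<inter> U)" using A(2) x by blast
  then obtain V g where V: "Cinf V g" "\<phi> x \<in> V"
    "\<And>z. z \<in> \<phi> ` (A \<inter> U) \<Longrightarrow> z \<in> V \<Longrightarrow> g z = (f \<circ> inv_into U \<phi>) z"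
    using smooth_onE[OF smooth_fn_max[OF A(3) c]] by metis
  let ?B = "A \<inter> (U \<inter> \<phi> -` V)"
  have "openin (mtop M) ?B" using openin_Int[OF A(1) max_open_preimage[OF c Cinf_open[OF V(1)]]] .
  moreover have "f y = g (\<phi> y)" if "y \<in> ?B" for y
    using V(3)[of "\<phi> y"] that inv_into_f_f[OF max_inj[OF c]] by auto
  ultimately show thesis using that[of V g ?B] V A(2) x by blast
qed

lemma smooth_fn_chartI:
  assumes c: "(U, \<phi>) \<in> max_atlas M" and "B \<subseteq> U" and g: "Cinf V g"
    and "\<And>y. y \<in> B \<Longrightarrow> \<phi> y \<in> V" "\<And>y. y \<in> B \<Longrightarrow> f y = g (\<phi> y)"
  shows "smooth_fn M B f"
  by (rule smooth_fn_chart[OF c Cinf_imp_smooth_on[OF g]]) (use assms in auto)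

lemma smooth_at_inner:
  assumes c: "(U, \<phi>) \<in> max_atlas M" and x: "x \<in> U"
  shows "smooth_at M x (\<lambda>y. \<phi> y \<bullet> a)"
  unfolding smooth_at_iff
  using smooth_fn_compose[OF smooth_fn_coord[OF c] smooth_on_linear[of "\<lambda>z. z \<bullet> a" UNIV]] max_open[OF c] x
  by (auto simp: bounded_linear.linear[OF bounded_linear_inner_left])

lemma velocity_chart:
  assumes c: "(U, \<phi>) \<in> max_atlas M" and \<gamma>: "smooth_curve M \<gamma>" "\<gamma> 0 \<in> U"
  shows "((\<lambda>t. \<phi> (\<gamma> t)) has_vector_derivative coord \<phi> (velocity M \<gamma>)) (at 0)"
proof -
  have "Cinf (\<gamma> -` U) (\<lambda>t. \<phi> (\<gamma> t))"
    using smooth_curve_fn[OF \<gamma>(1) smooth_atlas_axioms smooth_fn_coord[OF c]]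
      smooth_on_open[OF smooth_curve_open[OF \<gamma>(1) max_open[OF c]]] by blast
  then have "((\<lambda>t. \<phi> (\<gamma> t)) has_derivative frechet_derivative (\<lambda>t. \<phi> (\<gamma> t)) (at 0)) (at 0)"
    by (rule Cinf_has_derivative) (use \<gamma>(2) in simp)
  then have "(\<lambda>t. \<phi> (\<gamma> t)) differentiable at 0" by (auto simp: differentiable_def)
  then obtain w where w: "((\<lambda>t. \<phi> (\<gamma> t)) has_vector_derivative w) (at 0)"
    using vector_derivative_works by blast
  have "velocity M \<gamma> (\<lambda>y. \<phi> y \<bullet> b) = w \<bullet> b" for b
  proof -
    have "((\<lambda>t. \<phi> (\<gamma> t) \<bullet> b) has_vector_derivative w \<bullet> b) (at 0)"
      by (rule bounded_linear.has_vector_derivative[OF bounded_linear_inner_left w])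
    then have "deriv (\<lambda>t. \<phi> (\<gamma> t) \<bullet> b) 0 = w \<bullet> b"
      by (simp add: has_real_derivative_iff_has_vector_derivative DERIV_imp_deriv)
    then show ?thesis using smooth_at_inner[OF c \<gamma>(2)] by (simp add: velocity_def)
  qed
  then have "coord \<phi> (velocity M \<gamma>) = w" by (simp add: coord_def euclidean_representation)
  with w show ?thesis by simp
qed

text \<open>The chain rule along a curve representing v. It shows that a velocity is determined by
  its coordinate vector, which is how the linear structure of \<open>tangent\<close> is
  obtained.\<close>

lemma tangent_apply:
  assumes c: "(U, \<phi>) \<in> max_atlas M" and v: "v \<in> tangent M x" and g: "Cinf V g"
    and B: "openin (mtop M) B" "x \<in> B" "B \<subseteq> U"
    and V: "\<And>y. y \<in> B \<Longrightarrow> \<phi> y \<in> V" "\<And>y. y \<in> B \<Longrightarrow> f y = g (\<phi> y)"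
  shows "v f = frechet_derivative g (at (\<phi> x)) (coord \<phi> v)"
proof -
  obtain \<gamma> where \<gamma>: "v = velocity M \<gamma>" "smooth_curve M \<gamma>" "\<gamma> 0 = x" using v unfolding tangent_def by blast
  have "smooth_fn M B f" by (rule smooth_fn_chartI[OF c B(3) g V])
  then have sm: "smooth_at M x f" using B unfolding smooth_at_iff by blast
  have xU: "\<gamma> 0 \<in> U" using \<gamma>(3) B by blast
  have "(g has_derivative frechet_derivative g (at (\<phi> (\<gamma> 0)))) (at (\<phi> (\<gamma> 0)))"
    using Cinf_has_derivative[OF g] V(1)[OF B(2)] \<gamma>(3) by simp
  from vector_derivative_diff_chain_within[OF velocity_chart[OF c \<gamma>(2) xU] has_derivative_at_withinI[OF this]]
  have "((\<lambda>t. g (\<phi> (\<gamma> t))) has_vector_derivative frechet_derivative g (at (\<phi> x)) (coord \<phi> v)) (at 0)"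
    by (simp add: o_def \<gamma>)
  then have "((\<lambda>t. f (\<gamma> t)) has_vector_derivative frechet_derivative g (at (\<phi> x)) (coord \<phi> v)) (at 0)"
    by (rule has_vector_derivative_transform_within_open[OF _ smooth_curve_open[OF \<gamma>(2) B(1)]])
      (use \<gamma>(3) B(2) V(2) in auto)
  then have "deriv (\<lambda>t. f (\<gamma> t)) 0 = frechet_derivative g (at (\<phi> x)) (coord \<phi> v)"
    by (simp add: has_real_derivative_iff_has_vector_derivative DERIV_imp_deriv)
  then show ?thesis using sm \<gamma> by (simp add: velocity_def)
qed

lemma tangent_nonsmooth: "v \<in> tangent M x \<Longrightarrow> \<not> smooth_at M x f \<Longrightarrow> v f = 0"
  unfolding tangent_def velocity_def by auto

lemma tangent_pts: "v \<in> tangent M x \<Longrightarrow> x \<in> pts M"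
  unfolding tangent_def using smooth_curve_pts[OF _ smooth_atlas_axioms] by blast

lemma tangent_eqI:
  assumes c: "(U, \<phi>) \<in> max_atlas M" "x \<in> U" and v: "v \<in> tangent M x" "v' \<in> tangent M x"
    and eq: "coord \<phi> v = coord \<phi> v'"
  shows "v = v'"
proof
  fix f show "v f = v' f"
  proof (cases "smooth_at M x f")
    case True
    obtain V g B where "Cinf V g" "openin (mtop M) B" "x \<in> B" "B \<subseteq> U"
      "\<And>y. y \<in> B \<Longrightarrow> \<phi> y \<in> V" "\<And>y. y \<in> B \<Longrightarrow> f y = g (\<phi> y)"
      by (rule smooth_at_chartE[OF c True]) (rule that)
    then show ?thesis using tangent_apply[OF c(1) v(1), of V g B f] tangent_apply[OF c(1) v(2), of V g B f] eq
      by simp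
  next
    case False
    then show ?thesis using tangent_nonsmooth[OF v(1)] tangent_nonsmooth[OF v(2)] by simp
  qed
qed

lemma coord_inner:
  assumes c: "(U, \<phi>) \<in> max_atlas M" "x \<in> U" and v: "v \<in> tangent M x"
  shows "v (\<lambda>y. \<phi> y \<bullet> a) = coord \<phi> v \<bullet> a"
proof -
  have "Cinf UNIV (\<lambda>z. z \<bullet> a)"
    using smooth_on_linear[of "\<lambda>z. z \<bullet> a" UNIV] smooth_on_open[of UNIV "\<lambda>z. z \<bullet> a"]
    by (auto simp: bounded_linear.linear[OF bounded_linear_inner_left])
  moreover have "frechet_derivative (\<lambda>z. z \<bullet> a) (at (\<phi> x)) = (\<lambda>z. z \<bullet> a)"
    by (rule frechet_derivative_at[symmetric]) (rule bounded_linear_imp_has_derivative[OF bounded_linear_inner_left])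
  ultimately show ?thesis
    using tangent_apply[OF c(1) v _ max_open[OF c(1)] c(2), of UNIV "\<lambda>z. z \<bullet> a"] by simp
qed

text \<open>The parameter \<open>e * sin (1 / e * t)\<close> has derivative 1 at 0 and absolute
  value at most e. A straight line is thereby traversed with the right velocity without leaving the
  chart, for all times.\<close>

lemma curve_in_direction:
  assumes c: "(U, \<phi>) \<in> max_atlas M" "x \<in> U" and e: "e > 0" "\<And>s. \<bar>s\<bar> \<le> e \<Longrightarrow> \<phi> x + s *\<^sub>R w \<in> \<phi> ` U"
  obtains \<gamma> where "smooth_curve M \<gamma>" "\<gamma> 0 = x" "coord \<phi> (velocity M \<gamma>) = w"
    "\<And>t. \<gamma> t \<in> U \<and> (\<exists>s. \<phi> (\<gamma> t) = \<phi> x + s *\<^sub>R w)"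
proof -
  let ?\<gamma> = "\<lambda>t. inv_into U \<phi> (\<phi> x + (e * sin (1 / e * t)) *\<^sub>R w)"
  have in_U: "\<phi> x + (e * sin (1 / e * t)) *\<^sub>R w \<in> \<phi> ` U" for t
    using e by (intro e(2)) (auto simp: abs_mult)
  have "smooth_on UNIV (\<lambda>t::real. sin (1 / e * t))"
    by (rule smooth_on_compose[OF smooth_on_mult[OF smooth_on_const smooth_on_id] smooth_on_sin[of UNIV]]) simp
  then have "smooth_on UNIV (\<lambda>t. \<phi> x + (e * sin (1 / e * t)) *\<^sub>R w)"
    by (intro smooth_on_add smooth_on_scaleR smooth_on_mult smooth_on_const)
  then have 1: "smooth_curve M ?\<gamma>" by (rule smooth_curve_chart[OF c(1)]) (rule in_U)
  have 0: "?\<gamma> 0 = x" using inv_into_f_f[OF max_inj[OF c(1)] c(2)] by simp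
  have \<phi>: "\<phi> (?\<gamma> t) = \<phi> x + (e * sin (1 / e * t)) *\<^sub>R w" for t
    by (rule f_inv_into_f[OF in_U])
  have "((\<lambda>t. \<phi> x + (e * sin (1 / e * t)) *\<^sub>R w) has_vector_derivative w) (at 0)"
    using e(1) by (auto intro!: derivative_eq_intros simp: has_real_derivative_iff_has_vector_derivative[symmetric])
  then have "((\<lambda>t. \<phi> (?\<gamma> t)) has_vector_derivative w) (at 0)" by (simp only: \<phi>)
  then have "coord \<phi> (velocity M ?\<gamma>) = w"
    using velocity_chart[OF c(1) 1] 0 c(2) vector_derivative_unique_at by metis
  moreover have "?\<gamma> t \<in> U \<and> (\<exists>s. \<phi> (?\<gamma> t) = \<phi> x + s *\<^sub>R w)" for t
    using \<phi> inv_into_into[OF in_U] by blast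
  ultimately show thesis using that 0 1 by blast
qed

lemma small_segment:
  fixes z w :: "'v::euclidean_space"
  assumes W: "openin (top_of_set W) S" "subspace W" and z: "z \<in> S" "w \<in> W"
  obtains e where "e > 0" "\<And>s. \<bar>s\<bar> \<le> e \<Longrightarrow> z + s *\<^sub>R w \<in> S"
proof -
  obtain r where r: "r > 0" "ball z r \<inter> W \<subseteq> S"
    using W(1) z(1) unfolding openin_contains_ball by blast
  let ?e = "r / (2 * (norm w + 1))"
  have e: "?e > 0" using r(1) by (simp add: add_nonneg_pos)
  have "z + s *\<^sub>R w \<in> S" if s: "\<bar>s\<bar> \<le> ?e" for s
  proof -
    have "z \<in> W" using z(1) openin_imp_subset[OF W(1)] by blast
    then have "z + s *\<^sub>R w \<in> W" using W(2) z(2) by (simp add: subspace_add subspace_mul)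
    moreover have "norm (s *\<^sub>R w) < r"
    proof -
      have "norm (s *\<^sub>R w) \<le> ?e * norm w"
        using mult_right_mono[OF s norm_ge_zero[of w]] by simp
      also have "\<dots> < r"
      proof -
        have "0 < norm w + 2" by (rule add_nonneg_pos) auto
        then have "norm w < 2 * (norm w + 1)" by simp
        then have "r * norm w < r * (2 * (norm w + 1))" using r(1) by (rule mult_strict_left_mono)
        then show ?thesis by (simp add: divide_simps add_nonneg_pos)
      qed
      finally show ?thesis .
    qed
    ultimately show ?thesis using r(2) by (auto simp: dist_norm)
  qed
  with e show thesis using that by blast
qed

lemma coord_in_subspace:
  assumes c: "(U, \<phi>) \<in> max_atlas M" "x \<in> U" and W: "subspace W" "\<phi> ` U \<subseteq> W" and v: "v \<in> tangent M x"
  shows "coord \<phi> v \<in> W"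
proof -
  obtain \<gamma> where \<gamma>: "v = velocity M \<gamma>" "smooth_curve M \<gamma>" "\<gamma> 0 = x" using v unfolding tangent_def by blast
  show ?thesis
    by (rule subspace_has_vector_derivative[OF _ W(1) smooth_curve_open[OF \<gamma>(2) max_open[OF c(1)]]])
      (use velocity_chart[OF c(1) \<gamma>(2)] \<gamma> c(2) W(2) in auto)
qed

lemma tangent_exists:
  assumes c: "(U, \<phi>) \<in> max_atlas M" "x \<in> U" and W: "subspace W" "openin (top_of_set W) (\<phi> ` U)" and w: "w \<in> W"
  obtains v where "v \<in> tangent M x" "coord \<phi> v = w"
proof -
  obtain e where e: "e > 0" "\<And>s. \<bar>s\<bar> \<le> e \<Longrightarrow> \<phi> x + s *\<^sub>R w \<in> \<phi> ` U"
    using small_segment[OF W(2,1) imageI[OF c(2)] w] by blast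
  obtain \<gamma> where "smooth_curve M \<gamma>" "\<gamma> 0 = x" "coord \<phi> (velocity M \<gamma>) = w"
    using curve_in_direction[OF c e] by metis
  then show thesis using that unfolding tangent_def by blast
qed

text \<open>A combination of velocities is not visibly the velocity of a curve. A curve w with the
  combined coordinate vector exists in a chart, and w agrees with the combination on smooth
  functions by the chain rule and on all others by the default value 0.\<close>

lemma tangent_combination:
  assumes u: "u \<in> tangent M x" and v: "v \<in> tangent M x"
  shows "(\<lambda>f. a * u f + b * v f) \<in> tangent M x"
proof -
  obtain U \<phi> where c: "(U, \<phi>) \<in> max_atlas M" "x \<in> U" using max_at[OF tangent_pts[OF u]] by blast
  obtain W where W: "subspace W" "openin (top_of_set W) (\<phi> ` U)" using max_space[OF c(1)] by blast
  have "a *\<^sub>R coord \<phi> u + b *\<^sub>R coord \<phi> v \<in> W"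
    using coord_in_subspace[OF c W(1) openin_imp_subset[OF W(2)]] u v W(1) by (simp add: subspace_add subspace_mul)
  then obtain w where w: "w \<in> tangent M x" "coord \<phi> w = a *\<^sub>R coord \<phi> u + b *\<^sub>R coord \<phi> v"
    using tangent_exists[OF c W] by blast
  have "w f = a * u f + b * v f" for f
  proof (cases "smooth_at M x f")
    case True
    obtain V g B where V: "Cinf V g" "openin (mtop M) B" "x \<in> B" "B \<subseteq> U"
      "\<And>y. y \<in> B \<Longrightarrow> \<phi> y \<in> V" "\<And>y. y \<in> B \<Longrightarrow> f y = g (\<phi> y)"
      by (rule smooth_at_chartE[OF c True]) (rule that)
    have "linear (frechet_derivative g (at (\<phi> x)))"
      using has_derivative_linear[OF Cinf_has_derivative[OF V(1) V(5)[OF V(3)]]] .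
    then show ?thesis
      using tangent_apply[OF c(1) u V] tangent_apply[OF c(1) v V] tangent_apply[OF c(1) w(1) V] w(2)
      by (simp add: linear_add linear_cmul)
  next
    case False
    then show ?thesis using tangent_nonsmooth[OF u] tangent_nonsmooth[OF v] tangent_nonsmooth[OF w(1)] by simp
  qed
  then have "w = (\<lambda>f. a * u f + b * v f)" by blast
  with w(1) show ?thesis by simp
qed

lemma tangent_zero: "x \<in> pts M \<Longrightarrow> (\<lambda>f. 0) \<in> tangent M x"
proof -
  assume "x \<in> pts M"
  then have "velocity M (\<lambda>t. x) \<in> tangent M x" unfolding tangent_def using smooth_curve_const by blast
  from tangent_combination[OF this this, of 0 0] show ?thesis by simp
qed

lemma tangent_sum:
  assumes "x \<in> pts M" "\<And>i. i \<in> I \<Longrightarrow> v i \<in> tangent M x"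
  shows "(\<lambda>f. \<Sum>i\<in>I. a i * v i f) \<in> tangent M x"
proof (cases "finite I")
  case True
  then show ?thesis using assms(2)
  proof (induction I)
    case empty
    then show ?case using tangent_zero[OF assms(1)] by simp
  next
    case (insert i I)
    then show ?case using tangent_combination[of "v i" x "\<lambda>f. \<Sum>i\<in>I. a i * v i f" "a i" 1] by simp
  qed
qed (use tangent_zero[OF assms(1)] in simp)

section \<open>Covectors and dual bases\<close>

lemma cotangent_combination:
  "\<xi> \<in> cotangent M x \<Longrightarrow> \<eta> \<in> cotangent M x \<Longrightarrow> (\<lambda>v. a * \<xi> v + b * \<eta> v) \<in> cotangent M x"
  by (auto simp: cotangent_def algebra_simps)

lemma cotangent_zero: "(\<lambda>v. 0) \<in> cotangent M x"
  by (simp add: cotangent_def)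

lemma cotangent_sum:
  assumes "\<And>i. i \<in> I \<Longrightarrow> \<xi> i \<in> cotangent M x"
  shows "(\<lambda>v. \<Sum>i\<in>I. a i * \<xi> i v) \<in> cotangent M x"
proof (cases "finite I")
  case True
  then show ?thesis using assms
  proof (induction I)
    case (insert i I)
    then show ?case using cotangent_combination[of "\<xi> i" x "\<lambda>v. \<Sum>i\<in>I. a i * \<xi> i v" "a i" 1] by simp
  qed (simp add: cotangent_zero)
qed (simp add: cotangent_zero)

lemma cotangent_linear:
  "\<xi> \<in> cotangent M x \<Longrightarrow> u \<in> tangent M x \<Longrightarrow> v \<in> tangent M x \<Longrightarrow>
    \<xi> (\<lambda>f. a * u f + b * v f) = a * \<xi> u + b * \<xi> v"
  unfolding cotangent_def by blast

lemma cotangent_at_zero: "\<xi> \<in> cotangent M x \<Longrightarrow> x \<in> pts M \<Longrightarrow> \<xi> (\<lambda>f. 0) = 0"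
  using cotangent_linear[OF _ tangent_zero tangent_zero, of \<xi> x 0 0] by simp

lemma cotangent_outside: "\<xi> \<in> cotangent M x \<Longrightarrow> v \<notin> tangent M x \<Longrightarrow> \<xi> v = 0"
  unfolding cotangent_def by blast

lemma cotangent_eqI:
  assumes "\<xi> \<in> cotangent M x" "\<eta> \<in> cotangent M x" "\<And>v. v \<in> tangent M x \<Longrightarrow> \<xi> v = \<eta> v"
  shows "\<xi> = \<eta>"
proof
  fix v show "\<xi> v = \<eta> v"
    using assms(3) cotangent_outside[OF assms(1)] cotangent_outside[OF assms(2)] by (cases "v \<in> tangent M x") auto
qed

lemma cotangent_sum_apply:
  assumes \<xi>: "\<xi> \<in> cotangent M x" and x: "x \<in> pts M" and v: "\<And>i. i \<in> I \<Longrightarrow> v i \<in> tangent M x"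
  shows "\<xi> (\<lambda>f. \<Sum>i\<in>I. a i * v i f) = (\<Sum>i\<in>I. a i * \<xi> (v i))"
proof (cases "finite I")
  case True
  then show ?thesis using v
  proof (induction I)
    case (insert i I)
    then show ?case
      using cotangent_linear[OF \<xi>, of "v i" "\<lambda>f. \<Sum>i\<in>I. a i * v i f" "a i" 1] tangent_sum[OF x, of I v a] by simp
  qed (use cotangent_at_zero[OF \<xi> x] in simp)
qed (use cotangent_at_zero[OF \<xi> x] in simp)

lemma differential_cotangent: "differential M f x \<in> cotangent M x"
  unfolding cotangent_def differential_def using tangent_combination by auto

lemma differential_apply: "v \<in> tangent M x \<Longrightarrow> differential M f x v = v f"
  by (simp add: differential_def)

lemma tangent_separated:
  assumes "u \<in> tangent M x" "v \<in> tangent M x" "\<And>\<eta>. \<eta> \<in> cotangent M x \<Longrightarrow> \<eta> u = \<eta> v"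
  shows "u = v"
proof
  fix f show "u f = v f" using assms(3)[OF differential_cotangent[of f]] assms(1,2) by (simp add: differential_apply)
qed

text \<open>The chart takes values in a subspace W, so the standard basis need not consist of
  coordinates of tangent vectors. For an orthonormal basis I of W, the vectors E with coordinates in
  I are dual to the differentials of the functions \<open>\<phi> y \<bullet> b\<close>.\<close>

lemma tangent_basis:
  assumes c: "(U, \<phi>) \<in> max_atlas M" "x \<in> U"
  obtains I :: "'e set" and E where "finite I" "\<And>b. b \<in> I \<Longrightarrow> E b \<in> tangent M x"
    "\<And>v. v \<in> tangent M x \<Longrightarrow> v = (\<lambda>f. \<Sum>b\<in>I. v (\<lambda>y. \<phi> y \<bullet> b) * E b f)"
proof -
  obtain W where W: "subspace W" "openin (top_of_set W) (\<phi> ` U)" using max_space[OF c(1)] by blast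
  obtain I where I: "I \<subseteq> W" "pairwise orthogonal I" "\<And>b. b \<in> I \<Longrightarrow> norm b = 1" "independent I" "span I = W"
    using orthonormal_basis_subspace[OF W(1)] by metis
  have fin: "finite I" using I(4) independent_imp_finite by blast
  have "\<exists>v. v \<in> tangent M x \<and> coord \<phi> v = b" if "b \<in> I" for b
    using tangent_exists[OF c W] I(1) that by blast
  then obtain E where E: "\<And>b. b \<in> I \<Longrightarrow> E b \<in> tangent M x" "\<And>b. b \<in> I \<Longrightarrow> coord \<phi> (E b) = b" by metis
  have xM: "x \<in> pts M" using c max_sub by blast
  have "v = (\<lambda>f. \<Sum>b\<in>I. v (\<lambda>y. \<phi> y \<bullet> b) * E b f)" if v: "v \<in> tangent M x" for v
  proof (rule tangent_eqI[OF c v tangent_sum[OF xM E(1)]])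
    have "coord \<phi> v \<in> span I"
      using coord_in_subspace[OF c W(1) openin_imp_subset[OF W(2)] v] I(5) by simp
    then have "coord \<phi> v = (\<Sum>b\<in>I. (coord \<phi> v \<bullet> b) *\<^sub>R b)"
      using I(2,3) fin by (simp add: orthonormal_basis_expand)
    also have "\<dots> = coord \<phi> (\<lambda>f. \<Sum>b\<in>I. v (\<lambda>y. \<phi> y \<bullet> b) * E b f)"
    proof -
      have "coord \<phi> (\<lambda>f. \<Sum>b\<in>J. v (\<lambda>y. \<phi> y \<bullet> b) * E b f) = (\<Sum>b\<in>J. v (\<lambda>y. \<phi> y \<bullet> b) *\<^sub>R b)"
        if "finite J" "J \<subseteq> I" for J
        using that
      proof (induction J)
        case (insert b J)
        then show ?case
          using coord_combination[of \<phi> "v (\<lambda>y. \<phi> y \<bullet> b)" "E b" 1 "\<lambda>f. \<Sum>b\<in>J. v (\<lambda>y. \<phi> y \<bullet> b) * E b f"]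
          by (simp add: E(2))
      qed (simp add: coord_def)
      then show ?thesis using fin coord_inner[OF c v] by simp
    qed
    finally show "coord \<phi> v = coord \<phi> (\<lambda>f. \<Sum>b\<in>I. v (\<lambda>y. \<phi> y \<bullet> b) * E b f)" .
  qed
  with fin E(1) show thesis using that by blast
qed

section \<open>Bivectors\<close>

lemma bivector_linear:
  assumes "smooth_bivector M \<pi>" "x \<in> pts M" "\<xi> \<in> cotangent M x" "\<eta> \<in> cotangent M x" "\<zeta> \<in> cotangent M x"
  shows "\<pi> x (\<lambda>v. a * \<xi> v + b * \<eta> v) \<zeta> = a * \<pi> x \<xi> \<zeta> + b * \<pi> x \<eta> \<zeta>"
  using assms unfolding smooth_bivector_def by blast

lemma bivector_skew:
  assumes "smooth_bivector M \<pi>" "x \<in> pts M" "\<xi> \<in> cotangent M x" "\<eta> \<in> cotangent M x"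
  shows "\<pi> x \<xi> \<eta> = - \<pi> x \<eta> \<xi>"
  using assms unfolding smooth_bivector_def by blast

lemma bivector_sum:
  assumes \<pi>: "smooth_bivector M \<pi>" and x: "x \<in> pts M" and \<xi>: "\<And>i. i \<in> I \<Longrightarrow> \<xi> i \<in> cotangent M x" and \<zeta>: "\<zeta> \<in> cotangent M x"
  shows "\<pi> x (\<lambda>v. \<Sum>i\<in>I. a i * \<xi> i v) \<zeta> = (\<Sum>i\<in>I. a i * \<pi> x (\<xi> i) \<zeta>)"
proof -
  have 0: "\<pi> x (\<lambda>v. 0) \<zeta> = 0"
    using bivector_linear[OF \<pi> x cotangent_zero cotangent_zero \<zeta>, of 0 0] by simp
  show ?thesis
  proof (cases "finite I")
    case True
    then show ?thesis using \<xi>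
    proof (induction I)
      case (insert i I)
      then show ?case
        using bivector_linear[OF \<pi> x, of "\<xi> i" "\<lambda>v. \<Sum>i\<in>I. a i * \<xi> i v" \<zeta> "a i" 1] cotangent_sum[of I \<xi> x a] \<zeta> by simp
    qed (use 0 in simp)
  qed (use 0 in simp)
qed

text \<open>Existence is finite-dimensional duality: in the basis E the components of the vector are
  the values of the bivector on \<xi> and the dual differentials. Uniqueness holds because
  differentials of functions separate tangent vectors.\<close>

lemma sharp_unique_existence:
  assumes \<pi>: "smooth_bivector M \<pi>" and x: "x \<in> pts M" and \<xi>: "\<xi> \<in> cotangent M x"
  shows "\<exists>!v. v \<in> tangent M x \<and> (\<forall>\<eta>\<in>cotangent M x. \<eta> v = \<pi> x \<xi> \<eta>)"
proof (rule ex_ex1I)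
  obtain U \<phi> where c: "(U, \<phi>) \<in> max_atlas M" "x \<in> U" using max_at[OF x] by blast
  obtain I :: "'e set" and E where I: "finite I" "\<And>b. b \<in> I \<Longrightarrow> E b \<in> tangent M x"
    "\<And>v. v \<in> tangent M x \<Longrightarrow> v = (\<lambda>f. \<Sum>b\<in>I. v (\<lambda>y. \<phi> y \<bullet> b) * E b f)"
    by (rule tangent_basis[OF c]) (rule that)
  let ?d = "\<lambda>b. differential M (\<lambda>y. \<phi> y \<bullet> b) x"
  let ?v = "\<lambda>f. \<Sum>b\<in>I. \<pi> x \<xi> (?d b) * E b f"
  have "\<eta> ?v = \<pi> x \<xi> \<eta>" if \<eta>: "\<eta> \<in> cotangent M x" for \<eta>
  proof -
    have "\<eta> = (\<lambda>v. \<Sum>b\<in>I. \<eta> (E b) * ?d b v)"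
    proof (rule cotangent_eqI[OF \<eta> cotangent_sum[OF differential_cotangent]])
      fix v assume v: "v \<in> tangent M x"
      have "\<eta> v = \<eta> (\<lambda>f. \<Sum>b\<in>I. v (\<lambda>y. \<phi> y \<bullet> b) * E b f)" using I(3)[OF v] by (rule arg_cong)
      also have "\<dots> = (\<Sum>b\<in>I. v (\<lambda>y. \<phi> y \<bullet> b) * \<eta> (E b))" by (rule cotangent_sum_apply[OF \<eta> x I(2)])
      finally show "\<eta> v = (\<Sum>b\<in>I. \<eta> (E b) * ?d b v)" using v by (simp add: differential_apply mult.commute)
    qed
    \<comment> \<open>The expansion of \<eta> is used in the first argument, where linearity is
      available; skew-symmetry moves it there and back.\<close>
    then have "\<pi> x \<eta> \<xi> = \<pi> x (\<lambda>v. \<Sum>b\<in>I. \<eta> (E b) * ?d b v) \<xi>" by (rule arg_cong)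
    also have "\<dots> = (\<Sum>b\<in>I. \<eta> (E b) * \<pi> x (?d b) \<xi>)"
      by (rule bivector_sum[OF \<pi> x differential_cotangent \<xi>])
    also have "\<dots> = (\<Sum>b\<in>I. - (\<pi> x \<xi> (?d b) * \<eta> (E b)))"
    proof (rule sum.cong[OF refl])
      fix b
      show "\<eta> (E b) * \<pi> x (?d b) \<xi> = - (\<pi> x \<xi> (?d b) * \<eta> (E b))"
        using bivector_skew[OF \<pi> x \<xi> differential_cotangent[of "\<lambda>y. \<phi> y \<bullet> b"]] by simp
    qed
    also have "\<dots> = - (\<Sum>b\<in>I. \<pi> x \<xi> (?d b) * \<eta> (E b))" by (rule sum_negf)
    also have "(\<Sum>b\<in>I. \<pi> x \<xi> (?d b) * \<eta> (E b)) = \<eta> ?v"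
      by (rule cotangent_sum_apply[OF \<eta> x I(2), symmetric])
    finally show ?thesis using bivector_skew[OF \<pi> x \<xi> \<eta>] by simp
  qed
  moreover have "?v \<in> tangent M x" by (rule tangent_sum[OF x I(2)])
  ultimately show "\<exists>v. v \<in> tangent M x \<and> (\<forall>\<eta>\<in>cotangent M x. \<eta> v = \<pi> x \<xi> \<eta>)"
    by (intro exI[of _ ?v] conjI ballI)
next
  fix u v
  assume "u \<in> tangent M x \<and> (\<forall>\<eta>\<in>cotangent M x. \<eta> u = \<pi> x \<xi> \<eta>)"
    and "v \<in> tangent M x \<and> (\<forall>\<eta>\<in>cotangent M x. \<eta> v = \<pi> x \<xi> \<eta>)"
  then show "u = v" by (intro tangent_separated) auto
qed

lemma sharp_tangent:
  assumes "smooth_bivector M \<pi>" "x \<in> pts M" "\<xi> \<in> cotangent M x"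
  shows "sharp M \<pi> x \<xi> \<in> tangent M x"
  unfolding sharp_def using theI'[OF sharp_unique_existence[OF assms]] by blast

lemma sharp_apply:
  assumes "smooth_bivector M \<pi>" "x \<in> pts M" "\<xi> \<in> cotangent M x" "\<eta> \<in> cotangent M x"
  shows "\<eta> (sharp M \<pi> x \<xi>) = \<pi> x \<xi> \<eta>"
  unfolding sharp_def using theI'[OF sharp_unique_existence[OF assms(1-3)]] assms(4) by blast

lemma sharp_eqI:
  assumes "smooth_bivector M \<pi>" "x \<in> pts M" "\<xi> \<in> cotangent M x"
    and "v \<in> tangent M x" "\<And>\<eta>. \<eta> \<in> cotangent M x \<Longrightarrow> \<eta> v = \<pi> x \<xi> \<eta>"
  shows "sharp M \<pi> x \<xi> = v"
  using tangent_separated[OF sharp_tangent[OF assms(1-3)] assms(4)] sharp_apply[OF assms(1-3)] assms(5) by simp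

lemma sharp_combination:
  assumes \<pi>: "smooth_bivector M \<pi>" "x \<in> pts M" and \<xi>: "\<xi> \<in> cotangent M x" and \<eta>: "\<eta> \<in> cotangent M x"
  shows "sharp M \<pi> x (\<lambda>v. a * \<xi> v + b * \<eta> v) = (\<lambda>f. a * sharp M \<pi> x \<xi> f + b * sharp M \<pi> x \<eta> f)"
proof (rule sharp_eqI[OF \<pi> cotangent_combination[OF \<xi> \<eta>]])
  show "(\<lambda>f. a * sharp M \<pi> x \<xi> f + b * sharp M \<pi> x \<eta> f) \<in> tangent M x"
    by (rule tangent_combination[OF sharp_tangent[OF \<pi> \<xi>] sharp_tangent[OF \<pi> \<eta>]])
  fix \<zeta> assume \<zeta>: "\<zeta> \<in> cotangent M x"
  show "\<zeta> (\<lambda>f. a * sharp M \<pi> x \<xi> f + b * sharp M \<pi> x \<eta> f) = \<pi> x (\<lambda>v. a * \<xi> v + b * \<eta> v) \<zeta>"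
    using cotangent_linear[OF \<zeta> sharp_tangent[OF \<pi> \<xi>] sharp_tangent[OF \<pi> \<eta>]] sharp_apply[OF \<pi> \<xi> \<zeta>] sharp_apply[OF \<pi> \<eta> \<zeta>]
      bivector_linear[OF \<pi> \<xi> \<eta> \<zeta>] by simp
qed

end

section \<open>Tangent maps\<close>

lemma push_combination: "push M p x (\<lambda>f. a * u f + b * v f) = (\<lambda>f. a * push M p x u f + b * push M p x v f)"
  by (auto simp: push_def)

locale smooth_atlas_map = N: smooth_atlas N + M: smooth_atlas M
  for N :: "('a, 'e::euclidean_space) mfd" and M :: "('b, 'f::euclidean_space) mfd" +
  fixes p :: "'a \<Rightarrow> 'b"
  assumes smooth: "smooth_map N M p"
begin

lemma smooth_at_compose: 
  assumes x: "x \<in> pts N" and f: "smooth_at M (p x) f" shows "smooth_at N x (\<lambda>y. f (p y))"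
proof -
  obtain A where A: "openin (mtop M) A" "p x \<in> A" "smooth_fn M A f" using f unfolding smooth_at_iff by blast
  then show ?thesis unfolding smooth_at_iff
    using smooth_map_open_preimage[OF smooth N.smooth_atlas_axioms A(1)]
      smooth_map_fn[OF smooth N.smooth_atlas_axioms M.smooth_atlas_axioms A(3)] x by blast
qed

lemma push_velocity:
  assumes "smooth_curve N c"
  shows "push M p (c 0) (velocity N c) = velocity M (\<lambda>t. p (c t))"
proof
  fix f
  have "smooth_at M (p (c 0)) f \<Longrightarrow> smooth_at N (c 0) (f \<circ> p)"
    using smooth_at_compose[OF smooth_curve_pts[OF assms N.smooth_atlas_axioms]] by (simp add: o_def)
  then show "push M p (c 0) (velocity N c) f = velocity M (\<lambda>t. p (c t)) f"
    by (simp add: push_def velocity_def)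
qed

lemma smooth_curve_image: "smooth_curve N c \<Longrightarrow> smooth_curve M (\<lambda>t. p (c t))"
  by (rule smooth_map_compose[OF _ smooth smooth_atlas_real_line N.smooth_atlas_axioms M.smooth_atlas_axioms])

lemma push_tangent: "v \<in> tangent N x \<Longrightarrow> push M p x v \<in> tangent M (p x)"
  unfolding tangent_def using push_velocity smooth_curve_image by fastforce

lemma pull_cotangent: "\<xi> \<in> cotangent M (p x) \<Longrightarrow> pull N M p x \<xi> \<in> cotangent N x"
  unfolding cotangent_def[of N] pull_def
  using N.tangent_combination M.cotangent_linear push_tangent by (auto simp: push_combination)

lemma pull_apply: "v \<in> tangent N x \<Longrightarrow> pull N M p x \<xi> v = \<xi> (push M p x v)"
  by (simp add: pull_def)

lemma push_apply:
  "smooth_at M (p x) f \<Longrightarrow> push M p x v f = v (\<lambda>y. f (p y))"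
  by (simp add: push_def o_def)

lemma pull_differential:
  assumes "smooth_at M (p x) f"
  shows "pull N M p x (differential M f (p x)) = differential N (\<lambda>y. f (p y)) x"
proof -
  have 1: "pull N M p x (differential M f (p x)) \<in> cotangent N x"
    by (rule pull_cotangent) (rule M.differential_cotangent)
  have 2: "differential N (\<lambda>y. f (p y)) x \<in> cotangent N x" by (rule N.differential_cotangent)
  show ?thesis
  proof (rule N.cotangent_eqI[OF 1 2])
    fix v assume v: "v \<in> tangent N x"
    show "pull N M p x (differential M f (p x)) v = differential N (\<lambda>y. f (p y)) x v"
      using pull_apply[OF v, of "differential M f (p x)"] M.differential_apply[OF push_tangent[OF v], of f]
        N.differential_apply[OF v, of "\<lambda>y. f (p y)"] push_apply[OF assms, of v] by simp
  qed
qed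

text \<open>A covector that kills the kernel of a surjective linear map factors through it: \<zeta>
  is \<eta> composed with an arbitrary choice s of preimages, and \<open>wd\<close> makes it
  independent of this choice, hence linear.\<close>

lemma cotangent_factors:
  assumes \<eta>: "\<eta> \<in> cotangent N x" and x: "x \<in> pts N" and onto: "push M p x ` tangent N x = tangent M (p x)"
    and ker: "\<And>v. v \<in> tangent N x \<Longrightarrow> push M p x v = (\<lambda>f. 0) \<Longrightarrow> \<eta> v = 0"
  obtains \<zeta> where "\<zeta> \<in> cotangent M (p x)" "\<eta> = pull N M p x \<zeta>"
proof -
  define s where "s w = (SOME v. v \<in> tangent N x \<and> push M p x v = w)" for w
  have s: "s w \<in> tangent N x" "push M p x (s w) = w" if "w \<in> tangent M (p x)" for w
  proof -
    have "w \<in> push M p x ` tangent N x" using that onto by simp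
    then have "\<exists>v. v \<in> tangent N x \<and> push M p x v = w" by (elim imageE) (intro exI conjI, simp_all)
    then have "s w \<in> tangent N x \<and> push M p x (s w) = w" unfolding s_def by (rule someI_ex)
    then show "s w \<in> tangent N x" "push M p x (s w) = w" by simp_all
  qed
  have wd: "\<eta> u = \<eta> v" if "u \<in> tangent N x" "v \<in> tangent N x" "push M p x u = push M p x v" for u v
  proof -
    have "push M p x (\<lambda>f. 1 * u f + (-1) * v f) = (\<lambda>f. 0)" unfolding push_combination using that(3) by simp
    then have "\<eta> (\<lambda>f. 1 * u f + (-1) * v f) = 0" by (rule ker[OF N.tangent_combination[OF that(1,2)]])
    then show ?thesis using N.cotangent_linear[OF \<eta> that(1,2), of 1 "-1"] by simp
  qed
  define \<zeta> where "\<zeta> w = (if w \<in> tangent M (p x) then \<eta> (s w) else 0)" for w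
  have "\<zeta> \<in> cotangent M (p x)"
    unfolding cotangent_def
  proof (intro CollectI conjI allI impI ballI)
    fix u v a b assume uv: "u \<in> tangent M (p x)" "v \<in> tangent M (p x)"
    have "\<eta> (s (\<lambda>f. a * u f + b * v f)) = \<eta> (\<lambda>f. a * s u f + b * s v f)"
      by (rule wd[OF s(1)[OF M.tangent_combination[OF uv]] N.tangent_combination[OF s(1)[OF uv(1)] s(1)[OF uv(2)]]])
        (simp only: push_combination s(2)[OF M.tangent_combination[OF uv]] s(2)[OF uv(1)] s(2)[OF uv(2)])
    then show "\<zeta> (\<lambda>f. a * u f + b * v f) = a * \<zeta> u + b * \<zeta> v"
      using uv M.tangent_combination[OF uv] N.cotangent_linear[OF \<eta> s(1)[OF uv(1)] s(1)[OF uv(2)]]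
      by (simp add: \<zeta>_def)
  qed (simp add: \<zeta>_def)
  moreover have "\<eta> = pull N M p x \<zeta>"
  proof (rule N.cotangent_eqI[OF \<eta> pull_cotangent[OF calculation]])
    fix v assume v: "v \<in> tangent N x"
    note w = push_tangent[OF v]
    have "\<eta> v = \<eta> (s (push M p x v))" by (rule wd[OF v s(1)[OF w] s(2)[OF w, symmetric]])
    then show "\<eta> v = pull N M p x \<zeta> v" using w by (simp add: pull_apply[OF v] \<zeta>_def)
  qed
  ultimately show thesis by (rule that)
qed

end

text \<open>\<open>push\<close> takes the default value 0 on functions that are not smooth at the
  image point, so functoriality requires that composition with q preserve smoothness.\<close>

lemma push_push:
  assumes "smooth_atlas_map M L q"  "p x \<in> pts M"
  shows "push L q (p x) (push M p x v) = push L (\<lambda>y. q (p y)) x v"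
  using smooth_atlas_map.smooth_at_compose[OF assms] by (auto simp: push_def o_def)

lemma pull_pull:
  assumes "smooth_atlas_map N M p" "smooth_atlas_map M L q" "x \<in> pts N"
  shows "pull N M p x (pull M L q (p x) \<xi>) = pull N L (\<lambda>y. q (p y)) x \<xi>"
proof
  interpret p: smooth_atlas_map N M p by fact
  have "p x \<in> pts M"
    using smooth_map_pts[OF p.smooth p.N.smooth_atlas_axioms p.M.smooth_atlas_axioms assms(3)] .
  then show "pull N M p x (pull M L q (p x) \<xi>) v = pull N L (\<lambda>y. q (p y)) x \<xi> v" for v
    using push_push[OF assms(2), of p x v] p.push_tangent by (simp add: pull_def)
qed

section \<open>Initial submanifolds\<close>

lemma submfd_simps [simp]:
  "pts (submfd M X) = X"
  by (simp add: submfd_def)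

text \<open>\<open>(C, \<phi>)\<close> is a chart of \<open>X\<close>, cut out of the chart \<open>(U, \<phi>)\<close> of \<open>M\<close> by the linear subspace \<open>W\<close>.\<close>

definition adapted ::
  "('a, 'e::euclidean_space) mfd \<Rightarrow> 'a set \<Rightarrow> 'a set \<Rightarrow> ('a \<Rightarrow> 'e) \<Rightarrow> 'a set \<Rightarrow> 'e set \<Rightarrow> bool" where
  "adapted M X U \<phi> C W \<longleftrightarrow> (C, \<phi>) \<in> atlas (submfd M X) \<and> (U, \<phi>) \<in> max_atlas M \<and> subspace W \<and>
     C \<subseteq> U \<inter> X \<and> (\<forall>y\<in>U. y \<in> C \<longleftrightarrow> \<phi> y \<in> W) \<and> (\<forall>y\<in>C. smooth_component M (U \<inter> X) y \<subseteq> C)"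

context smooth_atlas
begin

text \<open>B is the preimage of a coordinate ball, whose points are joined to its centre by
  segments. This turns statements about curves issuing from x into statements about neighbourhoods
  of x.\<close>

lemma ball_component:
  assumes A: "openin (mtop M) A" "x \<in> A"
  obtains B where "openin (mtop M) B" "x \<in> B" "B \<subseteq> A" "\<And>y. y \<in> B \<Longrightarrow> y \<in> smooth_component M B x"
proof -
  have "x \<in> pts M" using openin_subset[OF A(1)] topspace_mtop A(2) by blast
  then obtain U \<phi> where c: "(U, \<phi>) \<in> max_atlas M" "x \<in> U" using max_at by blast
  obtain W where W: "subspace W" "openin (top_of_set W) (\<phi> ` U)" using max_space[OF c(1)] by blast
  obtain T where T: "open T" "A \<inter> U = U \<inter> \<phi> -` T" by (rule open_max_preimage[OF c(1) A(1)])
  obtain T2 where T2: "open T2" "\<phi> ` U = W \<inter> T2" using W(2) unfolding openin_open by blast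
  have "\<phi> x \<in> T \<inter> T2" using T(2) T2(2) A(2) c(2) by blast
  then obtain r where r: "r > 0" "ball (\<phi> x) r \<subseteq> T \<inter> T2"
    using open_Int[OF T(1) T2(1)] open_contains_ball by blast
  let ?B = "U \<inter> \<phi> -` ball (\<phi> x) r"
  have sub: "W \<inter> ball (\<phi> x) r \<subseteq> \<phi> ` U" using r(2) T2(2) by blast
  have "y \<in> smooth_component M ?B x" if y: "y \<in> ?B" for y
  proof (rule smooth_component_segment[OF c(1), of "W \<inter> ball (\<phi> x) r"])
    show "convex (W \<inter> ball (\<phi> x) r)" by (intro convex_Int subspace_imp_convex W(1) convex_ball)
  qed (use sub y c(2) T2(2) r(1) in auto)
  moreover have "?B \<subseteq> A" using r(2) T(2) by blast
  moreover have "x \<in> ?B" using c(2) r(1) by simp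
  moreover have "openin (mtop M) ?B" by (rule max_open_preimage[OF c(1) open_ball])
  ultimately show thesis using that by blast
qed

lemma atlas_submfd_adapted:
  assumes "(C, \<phi>) \<in> atlas (submfd M X)"
  obtains U W where "adapted M X U \<phi> C W"
proof -
  obtain U x W where c: "C = smooth_component M (U \<inter> X) x" "x \<in> U \<inter> X" "(U, \<phi>) \<in> max_atlas M"
      "subspace W" "\<phi> ` C = \<phi> ` U \<inter> W"
    using assms unfolding submfd_def by auto
  have C: "C \<subseteq> U \<inter> X" unfolding c(1) by (rule smooth_component_sub)
  have "y \<in> C \<longleftrightarrow> \<phi> y \<in> W" if y: "y \<in> U" for y
  proof -
    have "y \<in> C \<longleftrightarrow> \<phi> y \<in> \<phi> ` C" using C y inj_on_image_mem_iff[OF max_inj[OF c(3)], of y C] by blast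
    then show ?thesis using c(5) y by blast
  qed
  moreover have "smooth_component M (U \<inter> X) y \<subseteq> C" if "y \<in> C" for y
    using that smooth_component_trans unfolding c(1) by blast
  ultimately have "adapted M X U \<phi> C W" unfolding adapted_def using assms c C by blast
  then show thesis by (rule that)
qed

text \<open>In a chart with convex image the whole linear slice is joined to x by segments. The
  smooth component of x therefore equals the slice as soon as it does not leave it.\<close>

lemma adapted_convexI:
  assumes c: "(U, \<phi>) \<in> max_atlas M" and S: "\<phi> ` U = S" "convex S" and W: "subspace W"
    and x: "x \<in> U" "\<phi> x \<in> W" and X: "\<And>y. y \<in> U \<Longrightarrow> \<phi> y \<in> W \<Longrightarrow> y \<in> X"
    and comp: "\<And>y. y \<in> smooth_component M (U \<inter> X) x \<Longrightarrow> \<phi> y \<in> W"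
  shows "adapted M X U \<phi> {y \<in> U. \<phi> y \<in> W} W"
proof -
  let ?C = "{y \<in> U. \<phi> y \<in> W}"
  have "y \<in> smooth_component M (U \<inter> X) x" if y: "y \<in> ?C" for y
    by (rule smooth_component_segment[OF c, of "S \<inter> W"])
      (use S x y X subspace_imp_convex[OF W] in \<open>auto intro: convex_Int\<close>)
  then have C: "smooth_component M (U \<inter> X) x = ?C" using comp smooth_component_sub by blast
  have "(?C, \<phi>) \<in> atlas (submfd M X)"
  proof -
    have "\<phi> ` ?C = \<phi> ` U \<inter> W" by blast
    then have "\<exists>W. subspace W \<and> \<phi> ` smooth_component M (U \<inter> X) x = \<phi> ` U \<inter> W" using W C by auto
    moreover have "x \<in> U \<inter> X" using x X by blast
    ultimately show ?thesis unfolding submfd_def using c C by (auto intro!: exI[of _ U] exI[of _ x])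
  qed
  moreover have "smooth_component M (U \<inter> X) y \<subseteq> ?C" if "y \<in> ?C" for y
    using that smooth_component_trans unfolding C[symmetric] by blast
  ultimately show ?thesis unfolding adapted_def using c W X by auto
qed

text \<open>Small balls in a slice are convex, so their points are joined to y inside A. With A the
  domain of a second adapted chart, this shows that two slices overlap in a relatively open
  set.\<close>

lemma adapted_local:
  assumes ad: "adapted M X U \<phi> C W" and y: "y \<in> C" and A: "openin (mtop M) A" "y \<in> A"
  obtains T where "open T" "\<phi> y \<in> T" "\<And>z. z \<in> C \<Longrightarrow> \<phi> z \<in> T \<Longrightarrow> z \<in> smooth_component M (A \<inter> X) y"
proof -
  have c: "(U, \<phi>) \<in> max_atlas M" "subspace W" "C \<subseteq> U \<inter> X" "\<And>y. y \<in> U \<Longrightarrow> y \<in> C \<longleftrightarrow> \<phi> y \<in> W"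
    using ad unfolding adapted_def by auto
  obtain W0 where W0: "subspace W0" "openin (top_of_set W0) (\<phi> ` U)" using max_space[OF c(1)] by blast
  obtain T where T: "open T" "A \<inter> U = U \<inter> \<phi> -` T" by (rule open_max_preimage[OF c(1) A(1)])
  obtain T2 where T2: "open T2" "\<phi> ` U = W0 \<inter> T2" using W0(2) unfolding openin_open by blast
  have yU: "y \<in> U" using y c(3) by blast
  then have "\<phi> y \<in> T \<inter> T2" using T(2) T2(2) A(2) by blast
  then obtain r where r: "r > 0" "ball (\<phi> y) r \<subseteq> T \<inter> T2"
    using open_Int[OF T(1) T2(1)] open_contains_ball by blast
  let ?S = "W0 \<inter> W \<inter> ball (\<phi> y) r"
  have sub: "?S \<subseteq> \<phi> ` U" using r(2) T2(2) by blast
  have "z \<in> smooth_component M (A \<inter> X) y" if z: "z \<in> C" "\<phi> z \<in> ball (\<phi> y) r" for z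
  proof (rule smooth_component_segment[OF c(1) _ sub])
    show "convex ?S" by (intro convex_Int subspace_imp_convex W0(1) c(2) convex_ball)
    have zU: "z \<in> U" using z c(3) by blast
    show "\<phi> y \<in> ?S" "\<phi> z \<in> ?S" using y z yU zU c(4) T2(2) r(1) by auto
    show "U \<inter> \<phi> -` ?S \<subseteq> A \<inter> X" using r(2) T(2) c(3,4) by blast
  qed (use yU z c(3) in auto)
  then show thesis using that[of "ball (\<phi> y) r"] r(1) by auto
qed

lemma adapted_dim:
  assumes ad: "adapted M X U \<phi> C W" and W0: "subspace W0" "openin (top_of_set W0) (\<phi> ` U)"
  shows "chart_of_dim (dim (W0 \<inter> W)) (C, \<phi>)"
proof -
  have c: "(U, \<phi>) \<in> max_atlas M" "subspace W" "C \<subseteq> U \<inter> X" "\<And>y. y \<in> U \<Longrightarrow> y \<in> C \<longleftrightarrow> \<phi> y \<in> W"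
    using ad unfolding adapted_def by auto
  obtain T2 where T2: "open T2" "\<phi> ` U = W0 \<inter> T2" using W0(2) unfolding openin_open by blast
  have "\<phi> ` C = \<phi> ` U \<inter> W" using c(3,4) by blast
  then have "\<phi> ` C = (W0 \<inter> W) \<inter> T2" using T2(2) by blast
  then have "openin (top_of_set (W0 \<inter> W)) (\<phi> ` C)" using T2(1) unfolding openin_open by blast
  moreover have "inj_on \<phi> C" using max_inj[OF c(1)] c(3) by (auto intro: inj_on_subset)
  moreover have "subspace (W0 \<inter> W)" using W0(1) c(2) by (rule subspace_inter)
  ultimately show ?thesis unfolding chart_of_dim_def by auto
qed

text \<open>Only the covering has to be verified for a given subset. Images of slices are open in
  linear subspaces, overlaps are open by \<open>adapted_local\<close>, and transition maps are
  restrictions of those of M.\<close>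

lemma submfd_atlasI:
  assumes "\<And>x. x \<in> X \<Longrightarrow> \<exists>C \<phi>. (C, \<phi>) \<in> atlas (submfd M X) \<and> x \<in> C"
  shows "smooth_atlas (submfd M X)"
proof
  have "fst c \<subseteq> X" if "c \<in> atlas (submfd M X)" for c
    using atlas_submfd_adapted[of "fst c" "snd c" X] that unfolding adapted_def by (metis le_inf_iff prod.collapse)
  moreover have "x \<in> (\<Union>c\<in>atlas (submfd M X). fst c)" if x: "x \<in> X" for x
  proof -
    obtain C \<phi> where "(C, \<phi>) \<in> atlas (submfd M X)" "x \<in> C" using assms[OF x] by blast
    then show ?thesis by (intro UN_I[of "(C, \<phi>)"]) simp_all
  qed
  ultimately show "(\<Union>c\<in>atlas (submfd M X). fst c) = pts (submfd M X)" by auto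
  fix c assume c: "c \<in> atlas (submfd M X)"
  obtain C \<phi> where C: "c = (C, \<phi>)" by (cases c)
  obtain U W where ad: "adapted M X U \<phi> C W" using atlas_submfd_adapted c C by blast
  then have m: "(U, \<phi>) \<in> max_atlas M" "C \<subseteq> U \<inter> X" unfolding adapted_def by auto
  obtain W0 where W0: "subspace W0" "openin (top_of_set W0) (\<phi> ` U)" using max_space[OF m(1)] by blast
  show "\<exists>d. chart_of_dim d c" using adapted_dim[OF ad W0] C by blast
  fix c' assume c': "c' \<in> atlas (submfd M X)"
  obtain C' \<psi> where C': "c' = (C', \<psi>)" by (cases c')
  obtain U' W' where ad': "adapted M X U' \<psi> C' W'" using atlas_submfd_adapted c' C' by blast
  then have m': "(U', \<psi>) \<in> max_atlas M" "C' \<subseteq> U' \<inter> X" "\<And>y. y \<in> C' \<Longrightarrow> smooth_component M (U' \<inter> X) y \<subseteq> C'"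
    unfolding adapted_def by auto
  have inj: "inj_on \<phi> C" using max_inj[OF m(1)] m(2) by (auto intro: inj_on_subset)
  have "\<exists>T. open T \<and> C \<inter> C' = C \<inter> \<phi> -` T"
  proof -
    have loc: "\<exists>T. open T \<and> \<phi> y \<in> T \<and> C \<inter> \<phi> -` T \<subseteq> C'" if y: "y \<in> C \<inter> C'" for y
    proof -
      obtain T where T: "open T" "\<phi> y \<in> T" "\<And>z. z \<in> C \<Longrightarrow> \<phi> z \<in> T \<Longrightarrow> z \<in> smooth_component M (U' \<inter> X) y"
        using adapted_local[OF ad _ max_open[OF m'(1)], of y] y m'(2) by blast
      then show ?thesis using m'(3)[of y] y by blast
    qed
    let ?T = "\<Union>{T. open T \<and> C \<inter> \<phi> -` T \<subseteq> C'}"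
    have "open ?T" by blast
    moreover have "C \<inter> C' = C \<inter> \<phi> -` ?T" using loc by fast
    ultimately show ?thesis by blast
  qed
  then have "openin (top_of_set (\<phi> ` C)) (\<phi> ` (C \<inter> C'))" using openin_image_iff[OF inj, of "C \<inter> C'"] by blast
  moreover have "smooth_on (\<phi> ` (C \<inter> C')) (\<psi> \<circ> inv_into C \<phi>)"
  proof (rule smooth_on_cong)
    show "smooth_on (\<phi> ` (C \<inter> C')) (\<lambda>z. \<psi> (inv_into U \<phi> z))"
      by (rule smooth_on_subset[OF transition_smooth[OF m(1) m'(1)]]) (use m(2) m'(2) in blast)
    fix z assume "z \<in> \<phi> ` (C \<inter> C')"
    then obtain y where y: "y \<in> C" "z = \<phi> y" by blast
    then show "\<psi> (inv_into U \<phi> z) = (\<psi> \<circ> inv_into C \<phi>) z"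
      using inv_into_f_f[OF inj y(1)] inv_into_f_f[OF max_inj[OF m(1)], of y] m(2) by auto
  qed
  ultimately show "compatible c c'" unfolding C C' compatible_def by simp
qed

end

text \<open>The local content of \<open>initial_submanifold\<close>, without constant dimension,
  separation and countability, so that it is at hand for preimages while these remaining properties
  are still being proved.\<close>

locale submanifold = M: smooth_atlas M + N: smooth_atlas "submfd M X"
  for M :: "('a, 'e::euclidean_space) mfd" and X +
  assumes sub: "X \<subseteq> pts M"
begin

lemma adapted_at:
  assumes "x \<in> X" obtains U \<phi> C W where "adapted M X U \<phi> C W" "x \<in> C"
proof -
  obtain C \<phi> where C: "(C, \<phi>) \<in> atlas (submfd M X)" "x \<in> C" using assms N.atlas_at[of x] by auto
  then show thesis using M.atlas_submfd_adapted[OF C(1)] that by blast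
qed

lemma adaptedD:
  assumes "adapted M X U \<phi> C W"
  shows "(C, \<phi>) \<in> max_atlas (submfd M X)" "(U, \<phi>) \<in> max_atlas M" "subspace W" "C \<subseteq> U" "C \<subseteq> X"
    "y \<in> U \<Longrightarrow> y \<in> C \<longleftrightarrow> \<phi> y \<in> W" "y \<in> C \<Longrightarrow> smooth_component M (U \<inter> X) y \<subseteq> C"
  using assms N.atlas_max unfolding adapted_def by blast+

lemma incl_smooth: "smooth_map (submfd M X) M (\<lambda>x. x)"
proof (rule smooth_mapI[OF N.smooth_atlas_axioms M.smooth_atlas_axioms])
  fix x assume "x \<in> pts (submfd M X)"
  then have "x \<in> X" by simp
  then obtain U \<phi> C W where ad: "adapted M X U \<phi> C W" "x \<in> C" by (rule adapted_at)
  note c = adaptedD[OF ad(1)]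
  show "\<exists>B V \<psi>. openin (mtop (submfd M X)) B \<and> x \<in> B \<and> (V, \<psi>) \<in> max_atlas M \<and> (\<lambda>x. x) ` B \<subseteq> V \<and>
      smooth_fn (submfd M X) B (\<lambda>x. \<psi> x)"
    by (rule exI[of _ C], rule exI[of _ U], rule exI[of _ \<phi>])
      (use N.max_open[OF c(1)] N.smooth_fn_coord[OF c(1)] c(2,4) ad(2) in auto)
qed

sublocale incl: smooth_atlas_map "submfd M X" M "\<lambda>x. x"
  by unfold_locales (rule incl_smooth)

lemma open_trace: "openin (mtop M) A \<Longrightarrow> openin (mtop (submfd M X)) (X \<inter> A)"
  using smooth_map_open_preimage[OF incl_smooth N.smooth_atlas_axioms] by simp

text \<open>The universal property of initial submanifolds. A small neighbourhood B of z is swept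
  out by smooth curves from z inside B; their images are curves in U and X from \<open>f z\<close>,
  hence stay in the slice C through \<open>f z\<close>, where \<phi> serves as a chart of X.\<close>

lemma initial:
  assumes L: "smooth_atlas L" and f: "smooth_map L M f" and fX: "\<And>z. z \<in> pts L \<Longrightarrow> f z \<in> X"
  shows "smooth_map L (submfd M X) f"
proof (rule smooth_mapI[OF L N.smooth_atlas_axioms])
  interpret L: smooth_atlas L by fact
  interpret f: smooth_atlas_map L M f by unfold_locales fact
  fix z assume z: "z \<in> pts L"
  obtain U \<phi> C W where ad: "adapted M X U \<phi> C W" "f z \<in> C" using adapted_at[OF fX[OF z]] by blast
  note c = adaptedD[OF ad(1)]
  have "openin (mtop L) (pts L \<inter> f -` U)" by (rule smooth_map_open_preimage[OF f L M.max_open[OF c(2)]])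
  moreover have "z \<in> pts L \<inter> f -` U" using z ad(2) c(4) by blast
  ultimately obtain B where B: "openin (mtop L) B" "z \<in> B" "B \<subseteq> pts L \<inter> f -` U"
      "\<And>y. y \<in> B \<Longrightarrow> y \<in> smooth_component L B z"
    by (rule L.ball_component) (rule that)
  have "f y \<in> C" if y: "y \<in> B" for y
  proof -
    obtain d where d: "smooth_curve L d" "range d \<subseteq> B" "d 0 = z" "d 1 = y"
      using B(4)[OF y] unfolding smooth_component_def by blast
    have "f (d t) \<in> U \<inter> X" for t
    proof -
      have "d t \<in> B" using d(2) by blast
      then show ?thesis using B(3) fX by blast
    qed
    then have "range (\<lambda>t. f (d t)) \<subseteq> U \<inter> X" by blast
    then have "f y \<in> smooth_component M (U \<inter> X) (f z)"
      unfolding smooth_component_def using f.smooth_curve_image[OF d(1)] d(3,4)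
      by (intro CollectI exI[of _ "\<lambda>t. f (d t)"]) simp
    then show ?thesis using c(7)[OF ad(2)] by blast
  qed
  then have "f ` B \<subseteq> C" by blast
  moreover have "smooth_fn L B (\<lambda>x. \<phi> (f x))"
    by (rule L.smooth_fn_subset[OF smooth_map_fn[OF f L M.smooth_atlas_axioms M.smooth_fn_coord[OF c(2)]]]) (rule B(3))
  ultimately show "\<exists>B V \<psi>. openin (mtop L) B \<and> z \<in> B \<and> (V, \<psi>) \<in> max_atlas (submfd M X) \<and> f ` B \<subseteq> V \<and>
      smooth_fn L B (\<lambda>x. \<psi> (f x))" using B(1,2) c(1) by blast
qed

lemma smooth_curve_submfd: "smooth_curve M c \<Longrightarrow> range c \<subseteq> X \<Longrightarrow> smooth_curve (submfd M X) c"
  by (rule initial[OF smooth_atlas_real_line]) auto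

text \<open>By the universal property the smooth curves of X are exactly the smooth curves of M with
  range in X, and the inclusion preserves velocities.\<close>

lemma tangent_sub_eq:
  "tangent_sub M X x = {velocity M c | c. smooth_curve M c \<and> range c \<subseteq> X \<and> c 0 = x}"
proof -
  have 1: "incl_push M x (velocity (submfd M X) c) = velocity M c" if "smooth_curve (submfd M X) c" "c 0 = x" for c
    using incl.push_velocity[OF that(1)] that(2) by simp
  have 2: "smooth_curve (submfd M X) c \<longleftrightarrow> smooth_curve M c \<and> range c \<subseteq> X" for c
    using smooth_curve_submfd incl.smooth_curve_image[of c] smooth_curve_pts[OF _ N.smooth_atlas_axioms, of c] by auto
  show ?thesis
    unfolding tangent_sub_def tangent_def 2[symmetric]
  proof (intro set_eqI iffI)
    fix v assume "v \<in> incl_push M x ` {velocity (submfd M X) c |c. smooth_curve (submfd M X) c \<and> c 0 = x}"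
    then obtain c where "v = incl_push M x (velocity (submfd M X) c)" "smooth_curve (submfd M X) c" "c 0 = x" by blast
    then show "v \<in> {velocity M c |c. smooth_curve M c \<and> range c \<subseteq> X \<and> c 0 = x}"
      using 1 2[of c] by (intro CollectI exI[of _ c]) simp
  next
    fix v assume "v \<in> {velocity M c |c. smooth_curve M c \<and> range c \<subseteq> X \<and> c 0 = x}"
    then obtain c where c: "v = velocity M c" "smooth_curve (submfd M X) c" "c 0 = x" using 2 by blast
    then have "v = incl_push M x (velocity (submfd M X) c)" using 1 by simp
    then show "v \<in> incl_push M x ` {velocity (submfd M X) c |c. smooth_curve (submfd M X) c \<and> c 0 = x}"
      using c(2,3) by blast
  qed
qed

lemma tangent_sub_tangent: "tangent_sub M X x \<subseteq> tangent M x"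
  unfolding tangent_sub_eq tangent_def by blast

lemma tangent_sub_chart:
  assumes ad: "adapted M X U \<phi> C W" and x: "x \<in> C"
  shows "tangent_sub M X x = {v \<in> tangent M x. coord \<phi> v \<in> W}"
proof (intro set_eqI iffI)
  note c = adaptedD[OF ad]
  fix v assume v: "v \<in> tangent_sub M X x"
  then obtain \<gamma> where \<gamma>: "v = velocity M \<gamma>" "smooth_curve M \<gamma>" "range \<gamma> \<subseteq> X" "\<gamma> 0 = x" unfolding tangent_sub_eq by blast
  have "coord \<phi> v \<in> W"
  proof (rule subspace_has_vector_derivative[OF _ c(3)])
    show "((\<lambda>t. \<phi> (\<gamma> t)) has_vector_derivative coord \<phi> v) (at 0)"
      using M.velocity_chart[OF c(2) \<gamma>(2)] \<gamma>(1,4) x c(4) by blast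
    show "open (\<gamma> -` C)" by (rule smooth_curve_open[OF smooth_curve_submfd[OF \<gamma>(2,3)] N.max_open[OF c(1)]])
    show "\<phi> (\<gamma> t) \<in> W" if "t \<in> \<gamma> -` C" for t using that c(4,6) by blast
  qed (use \<gamma>(4) x in simp)
  then show "v \<in> {v \<in> tangent M x. coord \<phi> v \<in> W}" using v tangent_sub_tangent by blast
next
  note c = adaptedD[OF ad]
  fix v assume v: "v \<in> {v \<in> tangent M x. coord \<phi> v \<in> W}"
  have xU: "x \<in> U" using x c(4) by blast
  obtain W0 where W0: "subspace W0" "openin (top_of_set W0) (\<phi> ` U)" using M.max_space[OF c(2)] by blast
  have "coord \<phi> v \<in> W0" using M.coord_in_subspace[OF c(2) xU W0(1) openin_imp_subset[OF W0(2)]] v by blast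
  then obtain e where e: "e > 0" "\<And>s. \<bar>s\<bar> \<le> e \<Longrightarrow> \<phi> x + s *\<^sub>R coord \<phi> v \<in> \<phi> ` U"
    using M.small_segment[OF W0(2,1) imageI[OF xU]] by metis
  obtain \<gamma> where \<gamma>: "smooth_curve M \<gamma>" "\<gamma> 0 = x" "coord \<phi> (velocity M \<gamma>) = coord \<phi> v"
    "\<And>t. \<gamma> t \<in> U \<and> (\<exists>s. \<phi> (\<gamma> t) = \<phi> x + s *\<^sub>R coord \<phi> v)"
    by (rule M.curve_in_direction[OF c(2) xU e]) (assumption, rule that)
  \<comment> \<open>The curve runs along a straight line in direction \<open>coord \<phi> v\<close>,
    which lies in W, so it does not leave the slice.\<close>
  have "\<gamma> t \<in> X" for t
  proof -
    have "\<phi> x \<in> W" using c(6)[OF xU] x by blast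
    then have "\<phi> (\<gamma> t) \<in> W" using \<gamma>(4)[of t] v c(3) by (auto simp: subspace_add subspace_mul)
    then show ?thesis using c(5,6) \<gamma>(4)[of t] by blast
  qed
  moreover have "velocity M \<gamma> = v"
    by (rule M.tangent_eqI[OF c(2) xU]) (use \<gamma> v in \<open>auto simp: tangent_def\<close>)
  ultimately show "v \<in> tangent_sub M X x" unfolding tangent_sub_eq using \<gamma>(1,2) by blast
qed

text \<open>The inclusion is an immersion: a chart of X is the restriction of a chart \<phi> of M,
  and \<open>coord \<phi>\<close> gives the same vector before and after pushing forward.\<close>

lemma incl_push_inj:
  assumes u: "u \<in> tangent (submfd M X) x" "u' \<in> tangent (submfd M X) x" and eq: "incl_push M x u = incl_push M x u'"
  shows "u = u'"
proof -
  have "x \<in> X" using N.tangent_pts[OF u(1)] by simp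
  then obtain U \<phi> C W where ad: "adapted M X U \<phi> C W" "x \<in> C" using adapted_at by blast
  note c = adaptedD[OF ad(1)]
  have co: "coord \<phi> w = coord \<phi> (incl_push M x w)" for w
    using M.smooth_at_inner[OF c(2), of x] ad(2) c(4) by (simp add: coord_def incl.push_apply subsetD)
  have "coord \<phi> u = coord \<phi> u'" by (subst (1 2) co) (simp only: eq)
  then show ?thesis by (rule N.tangent_eqI[OF c(1) ad(2) u])
qed

text \<open>The coordinate expression of f extends to an open set of the model space by the meaning
  of \<open>smooth_on\<close>; F is this extension composed with \<phi>. Agreement is claimed on a
  set D open in X only, since B may meet X in further sheets.\<close>

lemma local_extension:
  assumes f: "smooth_fn (submfd M X) A f" and A: "openin (mtop (submfd M X)) A" "x \<in> A"
  obtains F B D where "openin (mtop M) B" "smooth_fn M B F" "openin (mtop (submfd M X)) D" "x \<in> D" "D \<subseteq> A \<inter> B"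
    "\<And>y. y \<in> D \<Longrightarrow> F y = f y"
proof -
  have "x \<in> X" using openin_subset[OF A(1)] N.topspace_mtop A(2) by auto
  then obtain U \<phi> C W where ad: "adapted M X U \<phi> C W" "x \<in> C" using adapted_at by blast
  note c = adaptedD[OF ad(1)]
  have "\<phi> x \<in> \<phi> ` (A \<inter> C)" using ad(2) A(2) by blast
  then obtain V g where V: "Cinf V g" "\<phi> x \<in> V"
    "\<And>z. z \<in> \<phi> ` (A \<inter> C) \<Longrightarrow> z \<in> V \<Longrightarrow> g z = (f \<circ> inv_into C \<phi>) z"
    using smooth_onE[OF N.smooth_fn_max[OF f c(1)]] by metis
  have 1: "openin (mtop M) (U \<inter> \<phi> -` V)" by (rule M.max_open_preimage[OF c(2) Cinf_open[OF V(1)]])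
  have 2: "smooth_fn M (U \<inter> \<phi> -` V) (\<lambda>y. g (\<phi> y))" by (rule M.smooth_fn_chartI[OF c(2) _ V(1)]) auto
  have 3: "openin (mtop (submfd M X)) (A \<inter> (C \<inter> \<phi> -` V))"
    by (rule openin_Int[OF A(1) N.max_open_preimage[OF c(1) Cinf_open[OF V(1)]]])
  have 4: "g (\<phi> y) = f y" if "y \<in> A \<inter> (C \<inter> \<phi> -` V)" for y
    using V(3)[of "\<phi> y"] that inv_into_f_f[OF N.max_inj[OF c(1)], of y] by auto
  show thesis
    by (rule that[OF 1 2 3 _ _ 4]) (use A(2) ad(2) V(2) c(4) in auto)
qed

text \<open>\<alpha> is written in the coordinate differentials of an adapted chart of X, and these
  are restrictions of coordinate differentials of M.\<close>

lemma cotangent_extension: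
  assumes \<alpha>: "\<alpha> \<in> cotangent (submfd M X) x" and x: "x \<in> X"
  obtains \<xi> where "\<xi> \<in> cotangent M x" "\<alpha> = pull (submfd M X) M (\<lambda>y. y) x \<xi>"
proof -
  obtain U \<phi> C W where ad: "adapted M X U \<phi> C W" "x \<in> C" using adapted_at[OF x] by blast
  note c = adaptedD[OF ad(1)]
  obtain I :: "'e set" and E where I: "finite I" "\<And>b. b \<in> I \<Longrightarrow> E b \<in> tangent (submfd M X) x"
    "\<And>v. v \<in> tangent (submfd M X) x \<Longrightarrow> v = (\<lambda>f. \<Sum>b\<in>I. v (\<lambda>y. \<phi> y \<bullet> b) * E b f)"
    by (rule N.tangent_basis[OF c(1) ad(2)]) (rule that)
  let ?\<xi> = "\<lambda>v. \<Sum>b\<in>I. \<alpha> (E b) * differential M (\<lambda>y. \<phi> y \<bullet> b) x v"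
  have 1: "?\<xi> \<in> cotangent M x" by (rule M.cotangent_sum[OF M.differential_cotangent])
  have "\<alpha> = pull (submfd M X) M (\<lambda>y. y) x ?\<xi>"
  proof (rule N.cotangent_eqI[OF \<alpha> incl.pull_cotangent[OF 1]])
    fix u assume u: "u \<in> tangent (submfd M X) x"
    have "\<alpha> u = \<alpha> (\<lambda>f. \<Sum>b\<in>I. u (\<lambda>y. \<phi> y \<bullet> b) * E b f)" using I(3)[OF u] by (rule arg_cong)
    also have "\<dots> = (\<Sum>b\<in>I. u (\<lambda>y. \<phi> y \<bullet> b) * \<alpha> (E b))"
      by (rule N.cotangent_sum_apply[OF \<alpha> _ I(2)]) (use x in simp_all)
    also have "\<dots> = ?\<xi> (incl_push M x u)"
    proof (rule sum.cong[OF refl])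
      fix b
      have "smooth_at M x (\<lambda>y. \<phi> y \<bullet> b)" by (rule M.smooth_at_inner[OF c(2)]) (use ad(2) c(4) in blast)
      then show "u (\<lambda>y. \<phi> y \<bullet> b) * \<alpha> (E b) = \<alpha> (E b) * differential M (\<lambda>y. \<phi> y \<bullet> b) x (incl_push M x u)"
        using M.differential_apply[OF incl.push_tangent[OF u], of "\<lambda>y. \<phi> y \<bullet> b"] incl.push_apply[of x "\<lambda>y. \<phi> y \<bullet> b" u] by simp
    qed
    finally show "\<alpha> u = pull (submfd M X) M (\<lambda>y. y) x ?\<xi> u" by (simp only: incl.pull_apply[OF u])
  qed
  with 1 show thesis by (rule that)
qed

lemma Hausdorff: "Hausdorff_space (mtop M) \<Longrightarrow> Hausdorff_space (mtop (submfd M X))"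
  unfolding Hausdorff_space_def
proof (intro allI impI)
  fix x y assume H: "\<forall>x y. x \<in> topspace (mtop M) \<and> y \<in> topspace (mtop M) \<and> x \<noteq> y \<longrightarrow>
      (\<exists>U V. openin (mtop M) U \<and> openin (mtop M) V \<and> x \<in> U \<and> y \<in> V \<and> disjnt U V)"
    and "x \<in> topspace (mtop (submfd M X)) \<and> y \<in> topspace (mtop (submfd M X)) \<and> x \<noteq> y"
  then have xy: "x \<in> X" "y \<in> X" "x \<noteq> y" using N.topspace_mtop by auto
  then obtain U V where "openin (mtop M) U" "openin (mtop M) V" "x \<in> U" "y \<in> V" "disjnt U V"
    using H sub M.topspace_mtop by (metis subsetD)
  then show "\<exists>U V. openin (mtop (submfd M X)) U \<and> openin (mtop (submfd M X)) V \<and> x \<in> U \<and> y \<in> V \<and> disjnt U V"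
    using open_trace xy by (intro exI[of _ "X \<inter> U"] exI[of _ "X \<inter> V"]) (auto simp: disjnt_def)
qed

end

lemma initial_submanifold_locale: "smooth_atlas M \<Longrightarrow> initial_submanifold M X \<Longrightarrow> submanifold M X"
  unfolding initial_submanifold_def submanifold_def submanifold_axioms_def using smooth_manifold_atlas by blast

section \<open>Submersions and preimages\<close>

lemma linear_projection:
  fixes W :: "'e::euclidean_space set"
  assumes "subspace W"
  obtains P where "linear P" "\<And>v. P v \<in> W" "\<And>w. w \<in> W \<Longrightarrow> P w = w"
proof -
  obtain I where I: "I \<subseteq> W" "pairwise orthogonal I" "\<And>b. b \<in> I \<Longrightarrow> norm b = 1" "independent I" "span I = W"
    using orthonormal_basis_subspace[OF assms] by metis
  have fin: "finite I" using I(4) independent_imp_finite by blast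
  let ?P = "\<lambda>v. \<Sum>b\<in>I. (v \<bullet> b) *\<^sub>R b"
  have 1: "linear ?P"
    by (intro linear_compose_sum ballI linearI) (simp_all add: inner_add_left scaleR_add_left)
  have 2: "?P v \<in> W" for v using I(1) assms by (auto intro!: subspace_sum subspace_mul)
  have 3: "?P w = w" if "w \<in> W" for w
    using that I(2,3,5) fin by (intro orthonormal_basis_expand) auto
  show thesis by (rule that[OF 1 2 3])
qed

lemma linear_section:
  fixes L :: "'e::euclidean_space \<Rightarrow> 'f::euclidean_space"
  assumes W: "subspace W" and W': "subspace W'" and L: "linear L" and onto: "\<And>w. w \<in> W' \<Longrightarrow> \<exists>v\<in>W. L v = w"
  obtains B where "linear B" "\<And>v. B v \<in> W" "\<And>w. w \<in> W' \<Longrightarrow> L (B w) = w"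
proof -
  obtain I where I: "I \<subseteq> W'" "pairwise orthogonal I" "\<And>b. b \<in> I \<Longrightarrow> norm b = 1" "independent I" "span I = W'"
    using orthonormal_basis_subspace[OF W'] by metis
  have fin: "finite I" using I(4) independent_imp_finite by blast
  obtain s where s: "\<And>b. b \<in> I \<Longrightarrow> s b \<in> W" "\<And>b. b \<in> I \<Longrightarrow> L (s b) = b"
    using onto I(1) by (metis subsetD)
  let ?B = "\<lambda>v. \<Sum>b\<in>I. (v \<bullet> b) *\<^sub>R s b"
  have 1: "linear ?B"
    by (intro linear_compose_sum ballI linearI) (simp_all add: inner_add_left scaleR_add_left)
  have 2: "?B v \<in> W" for v using s(1) W by (auto intro!: subspace_sum subspace_mul)
  have 3: "L (?B w) = w" if "w \<in> W'" for w
  proof -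
    have "L (?B w) = (\<Sum>b\<in>I. (w \<bullet> b) *\<^sub>R b)"
      using s(2) by (simp add: linear_sum[OF L] linear_cmul[OF L])
    also have "\<dots> = w" using that I(2,3,5) fin by (intro orthonormal_basis_expand) auto
    finally show ?thesis .
  qed
  show thesis by (rule that[OF 1 2 3])
qed

text \<open>The preimage of K in W is the direct sum of the kernel and the image of K under the
  section B.\<close>

lemma dim_linear_preimage:
  fixes L :: "'e::euclidean_space \<Rightarrow> 'f::euclidean_space"
  assumes W: "subspace W" and L: "linear L" and B: "linear B" "\<And>v. B v \<in> W" "\<And>w. w \<in> W' \<Longrightarrow> L (B w) = w"
    and LW: "\<And>w. w \<in> W \<Longrightarrow> L w \<in> W'" and K: "subspace K" "K \<subseteq> W'"
  shows "dim {w \<in> W. L w \<in> K} = dim {w \<in> W. L w = 0} + dim K"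
proof -
  let ?S = "{w \<in> W. L w = 0}" and ?T = "B ` K"
  have S: "subspace ?S"
    using W by (auto simp: subspace_def linear_0[OF L] linear_add[OF L] linear_cmul[OF L])
  have T: "subspace ?T" by (rule linear_subspace_image[OF B(1) K(1)])
  have LB: "L (B k) = k" if "k \<in> K" for k using that B(3) K(2) by blast
  have "?S \<inter> ?T = {0}"
    using LB subspace_0[OF S] subspace_0[OF T] linear_0[OF B(1)] by auto
  moreover have "{x + y |x y. x \<in> ?S \<and> y \<in> ?T} = {w \<in> W. L w \<in> K}"
  proof (intro set_eqI iffI)
    fix w assume "w \<in> {x + y |x y. x \<in> ?S \<and> y \<in> ?T}"
    then obtain x k where "w = x + B k" "x \<in> W" "L x = 0" "k \<in> K" by blast
    then show "w \<in> {w \<in> W. L w \<in> K}" using B(2) W LB by (simp add: subspace_add linear_add[OF L])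
  next
    fix w assume w: "w \<in> {w \<in> W. L w \<in> K}"
    have "w = (w - B (L w)) + B (L w)" by simp
    moreover have "w - B (L w) \<in> ?S" using w B(2) W LB by (simp add: subspace_diff linear_diff[OF L])
    moreover have "B (L w) \<in> ?T" using w by blast
    ultimately show "w \<in> {x + y |x y. x \<in> ?S \<and> y \<in> ?T}" by blast
  qed
  moreover have "dim ?T = dim K"
  proof (rule dim_image_eq[OF B(1)])
    have "span K = K" using K(1) by (simp add: span_eq_iff)
    then show "inj_on B (span K)" using LB by (metis inj_onI)
  qed
  ultimately show ?thesis using dim_sums_Int[OF S T] by simp
qed

locale submersion_atlas = smooth_atlas_map N M p
  for N :: "('a, 'e::euclidean_space) mfd" and M :: "('b, 'f::euclidean_space) mfd" and p +
  assumes onto: "x \<in> pts N \<Longrightarrow> push M p x ` tangent N x = tangent M (p x)"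
begin

lemma p_pts: "x \<in> pts N \<Longrightarrow> p x \<in> pts M"
  by (rule smooth_map_pts[OF smooth N.smooth_atlas_axioms M.smooth_atlas_axioms])

text \<open>In the chart \<open>\<Phi>(z) = z - B (A z) + B (f z)\<close>, where \<open>A\<close> is the derivative of the coordinate
  expression \<open>f\<close> of \<open>p\<close> and \<open>B\<close> a right inverse of \<open>A\<close>, the submersion \<open>p\<close> becomes the linear map \<open>A\<close>.\<close>

lemma submersion_chart:
  assumes x: "x \<in> pts N" and V: "(V, \<psi>) \<in> max_atlas M" "p x \<in> V" and W': "subspace W'" "openin (top_of_set W') (\<psi> ` V)"
  obtains U \<Phi> A B W r where "(U, \<Phi>) \<in> max_atlas N" "x \<in> U" "p ` U \<subseteq> V" "linear A" "subspace W" "r > 0"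
    "\<Phi> ` U = W \<inter> ball (\<Phi> x) r" "\<And>y. y \<in> U \<Longrightarrow> \<psi> (p y) = A (\<Phi> y)" "\<And>w. A w \<in> W'"
    "linear B" "\<And>v. B v \<in> W" "\<And>w. w \<in> W' \<Longrightarrow> A (B w) = w"
proof -
  obtain U0 \<phi> where c: "(U0, \<phi>) \<in> max_atlas N" "x \<in> U0" using N.max_at[OF x] by blast
  obtain W where W: "subspace W" "openin (top_of_set W) (\<phi> ` U0)" using N.max_space[OF c(1)] by blast
  \<comment> \<open>Chart values lie in the subspaces W and W' only, and off W the extension g is
    arbitrary. The projections make the model maps depend on g along W alone and take values in
    W'.\<close>
  obtain P where P: "linear P" "\<And>v. P v \<in> W" "\<And>w. w \<in> W \<Longrightarrow> P w = w" by (rule linear_projection[OF W(1)]) (rule that)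
  obtain P' where P': "linear P'" "\<And>v. P' v \<in> W'" "\<And>w. w \<in> W' \<Longrightarrow> P' w = w"
    by (rule linear_projection[OF W'(1)]) (rule that)
  define B0 where "B0 = U0 \<inter> (pts N \<inter> p -` V)"
  have B0: "openin (mtop N) B0" "x \<in> B0" "B0 \<subseteq> U0"
    unfolding B0_def using openin_Int[OF N.max_open[OF c(1)] smooth_map_open_preimage[OF smooth N.smooth_atlas_axioms M.max_open[OF V(1)]]]
      c(2) x V(2) by auto
  define z0 where "z0 = \<phi> x"
  have sf: "smooth_fn N B0 (\<lambda>y. \<psi> (p y))"
    by (rule N.smooth_fn_subset[OF smooth_map_fn[OF smooth N.smooth_atlas_axioms M.smooth_atlas_axioms M.smooth_fn_coord[OF V(1)]]])
      (auto simp: B0_def)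
  have "z0 \<in> \<phi> ` (B0 \<inter> U0)" unfolding z0_def using B0 by blast
  then obtain Q g where g: "Cinf Q g" "z0 \<in> Q"
    "\<And>z. z \<in> \<phi> ` (B0 \<inter> U0) \<Longrightarrow> z \<in> Q \<Longrightarrow> g z = ((\<lambda>y. \<psi> (p y)) \<circ> inv_into U0 \<phi>) z"
    using smooth_onE[OF N.smooth_fn_max[OF sf c(1)]] by metis
  have g_eq: "g (\<phi> y) = \<psi> (p y)" if "y \<in> B0" "\<phi> y \<in> Q" for y
    using g(3)[of "\<phi> y"] that B0(3) inv_into_f_f[OF N.max_inj[OF c(1)], of y] by auto
  have \<phi>W: "\<phi> y \<in> W" if "y \<in> U0" for y using that openin_imp_subset[OF W(2)] by blast
  have \<psi>W: "\<psi> (p y) \<in> W'" if "y \<in> B0" for y using that openin_imp_subset[OF W'(2)] unfolding B0_def by blast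
  have z0W: "z0 \<in> W" unfolding z0_def by (rule \<phi>W[OF c(2)])
  define D where "D = frechet_derivative g (at z0)"
  have D: "(g has_derivative D) (at z0)" unfolding D_def by (rule Cinf_has_derivative[OF g(1,2)])
  have linD: "linear D" using has_derivative_linear[OF D] .
  define A where "A w = P' (D (P w))" for w
  have linA: "linear A"
    unfolding A_def[abs_def] using linear_compose[OF linear_compose[OF P(1) linD] P'(1)] by (simp add: o_def)
  have coordp: "coord \<psi> (push M p x v) = D (coord \<phi> v)" if v: "v \<in> tangent N x" for v
  proof (rule euclidean_eqI)
    fix b
    have 1: "push M p x v (\<lambda>y. \<psi> y \<bullet> b) = v (\<lambda>y. \<psi> (p y) \<bullet> b)"
      by (rule push_apply[OF M.smooth_at_inner[OF V]])
    have "Cinf Q (\<lambda>z. g z \<bullet> b)"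
      using g(1) by (auto simp: Cinf_def intro: Ck_on_linear_compose[OF bounded_linear_inner_left])
    moreover have "openin (mtop N) (B0 \<inter> (U0 \<inter> \<phi> -` Q))"
      by (rule openin_Int[OF B0(1) N.max_open_preimage[OF c(1) Cinf_open[OF g(1)]]])
    moreover have "x \<in> B0 \<inter> (U0 \<inter> \<phi> -` Q)" using B0 c(2) g(2) z0_def by blast
    ultimately have "v (\<lambda>y. \<psi> (p y) \<bullet> b) = frechet_derivative (\<lambda>z. g z \<bullet> b) (at (\<phi> x)) (coord \<phi> v)"
      by (rule N.tangent_apply[OF c(1) v]) (use g_eq in auto)
    also have "frechet_derivative (\<lambda>z. g z \<bullet> b) (at (\<phi> x)) = (\<lambda>v. D v \<bullet> b)"
      by (rule frechet_derivative_at[symmetric]) (rule has_derivative_inner_left[OF D[unfolded z0_def]])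
    finally show "coord \<psi> (push M p x v) \<bullet> b = D (coord \<phi> v) \<bullet> b"
      using M.coord_inner[OF V push_tangent[OF v], of b] 1 by simp
  qed
  have Aonto: "\<exists>v\<in>W. A v = w" if w: "w \<in> W'" for w
  proof -
    obtain v' where v': "v' \<in> tangent M (p x)" "coord \<psi> v' = w" by (rule M.tangent_exists[OF V W' w])
    then have "v' \<in> push M p x ` tangent N x" using onto[OF x] by simp
    then obtain v where v: "v \<in> tangent N x" "v' = push M p x v" by (rule imageE) (rule that)
    have "coord \<phi> v \<in> W" by (rule N.coord_in_subspace[OF c W(1) openin_imp_subset[OF W(2)] v(1)])
    moreover from this have "A (coord \<phi> v) = w" using coordp[OF v(1)] v' v(2) w P(3) P'(3) by (simp add: A_def)
    ultimately show ?thesis by blast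
  qed
  obtain B where B: "linear B" "\<And>v. B v \<in> W" "\<And>w. w \<in> W' \<Longrightarrow> A (B w) = w"
    by (rule linear_section[OF W(1) W'(1) linA Aonto]) (assumption, rule that)
  define F where "F z = (z + B (P' (g (P z)))) - B (A z)" for z
  define Q' where "Q' = P -` Q"
  have Q': "open Q'" unfolding Q'_def
    using open_vimage[OF Cinf_open[OF g(1)]] linear_continuous_on[of P UNIV] P(1) linear_conv_bounded_linear by blast
  have "Cinf Q' (\<lambda>z. g (P z))"
  proof (rule Cinf_compose[OF _ g(1)])
    show "Cinf Q' P" using smooth_on_linear[OF P(1)] smooth_on_open[OF Q'] by blast
  qed (auto simp: Q'_def)
  then have "smooth_on Q' (\<lambda>z. g (P z))" by (rule Cinf_imp_smooth_on) simp
  then have "smooth_on Q' F" unfolding F_def[abs_def]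
    by (intro smooth_on_diff smooth_on_add smooth_on_id smooth_on_linear_compose[OF B(1)] smooth_on_linear_compose[OF P'(1)]
        smooth_on_linear[OF linA])
  then have CF: "Cinf Q' F" using smooth_on_open[OF Q'] by blast
  have z0Q': "z0 \<in> Q'" using g(2) P(3)[OF z0W] by (simp add: Q'_def)
  have bl: "bounded_linear B" "bounded_linear P" "bounded_linear P'" "bounded_linear A"
    using B(1) P(1) P'(1) linA by (simp_all add: linear_conv_bounded_linear)
  have dF: "(F has_derivative (\<lambda>u. u)) (at z0)"
  proof -
    have "((\<lambda>z. g (P z)) has_derivative (\<lambda>u. D (P u))) (at z0)"
      by (rule has_derivative_compose[OF bounded_linear_imp_has_derivative[OF bl(2)]]) (simp add: P(3)[OF z0W] D)
    then have "((\<lambda>z. B (P' (g (P z)))) has_derivative (\<lambda>u. B (P' (D (P u))))) (at z0)"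
      by (intro bounded_linear.has_derivative[OF bl(1)] bounded_linear.has_derivative[OF bl(3)])
    moreover have "((\<lambda>z. B (A z)) has_derivative (\<lambda>u. B (A u))) (at z0)"
      by (rule bounded_linear.has_derivative[OF bl(1) bounded_linear_imp_has_derivative[OF bl(4)]])
    ultimately have "(F has_derivative (\<lambda>u. (u + B (P' (D (P u)))) - B (A u))) (at z0)"
      unfolding F_def[abs_def] by (intro has_derivative_diff has_derivative_add has_derivative_ident)
    then show ?thesis by (simp add: A_def)
  qed
  obtain U' V' h where inv: "open U'" "U' \<subseteq> Q'" "z0 \<in> U'" "homeomorphism U' V' F h" "Cinf V' h"
    by (rule Cinf_inverse_function[OF CF z0Q' dF]) (rule that)
  have hF: "h (F z) = z" "F z \<in> V'" if "z \<in> U'" for z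
    using inv(4) that unfolding homeomorphism_def by blast+
  have Fh: "F (h w) = w" "h w \<in> U'" if "w \<in> V'" for w
    using inv(4) that unfolding homeomorphism_def by blast+
  \<comment> \<open>B takes values in W, so F displaces points by vectors of W. It thus preserves W
    in both directions, and the new chart has its image in W again.\<close>
  have FW: "F z \<in> W \<longleftrightarrow> z \<in> W" for z
  proof -
    have d: "F z - z \<in> W" using W(1) B(2) by (simp add: F_def subspace_diff)
    have "F z = (F z - z) + z" "z = F z - (F z - z)" by simp_all
    then show ?thesis using d W(1) by (metis subspace_add subspace_diff)
  qed
  \<comment> \<open>As A o B is the identity on W', the two terms involving A z cancel and A (F z)
    is the coordinate expression of p at z.\<close>
  have AF: "A (F (\<phi> y)) = \<psi> (p y)" if y: "y \<in> B0" "\<phi> y \<in> U'" for y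
  proof -
    have yW: "P (\<phi> y) = \<phi> y" using P(3) \<phi>W B0(3) y(1) by blast
    have "\<phi> y \<in> Q" using inv(2) y(2) yW unfolding Q'_def by auto
    then have e: "g (P (\<phi> y)) = \<psi> (p y)" using g_eq y(1) yW by simp
    have "A w \<in> W'" for w unfolding A_def by (rule P'(2))
    then show ?thesis using B(3) \<psi>W[OF y(1)] P'(3)[OF \<psi>W[OF y(1)]]
      by (simp add: F_def e linear_add[OF linA] linear_diff[OF linA])
  qed
  obtain T where T: "open T" "\<phi> ` B0 = W \<inter> T"
  proof -
    obtain T1 where T1: "open T1" "B0 \<inter> U0 = U0 \<inter> \<phi> -` T1" by (rule N.open_max_preimage[OF c(1) B0(1)])
    obtain T2 where T2: "open T2" "\<phi> ` U0 = W \<inter> T2" using W(2) unfolding openin_open by blast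
    have "B0 = U0 \<inter> \<phi> -` T1" using T1(2) B0(3) by blast
    then have "\<phi> ` B0 = \<phi> ` U0 \<inter> T1" by auto
    then have "\<phi> ` B0 = W \<inter> (T2 \<inter> T1)" by (simp only: T2(2) Int_assoc)
    with open_Int[OF T2(1) T1(1)] show thesis by (rule that)
  qed
  have V'T: "open (V' \<inter> h -` T)"
    by (rule continuous_open_preimage[OF Cinf_continuous_on[OF inv(5)] Cinf_open[OF inv(5)] T(1)])
  have "F z0 \<in> V' \<inter> h -` T"
    using hF[OF inv(3)] T(2) B0(2) unfolding z0_def by auto
  \<comment> \<open>A ball, because \<open>adapted_convexI\<close> requires a chart with convex
    image. It is small enough for h to send its part in W back into the coordinates of B0.\<close>
  then obtain r where r: "r > 0" "ball (F z0) r \<subseteq> V' \<inter> h -` T" using V'T open_contains_ball by blast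
  define \<Phi> where "\<Phi> y = F (\<phi> y)" for y
  define U where "U = B0 \<inter> (U0 \<inter> \<phi> -` (U' \<inter> F -` ball (F z0) r))"
  have "open (U' \<inter> F -` ball (F z0) r)"
    by (rule continuous_open_preimage[OF continuous_on_subset[OF Cinf_continuous_on[OF CF] inv(2)] inv(1) open_ball])
  then have Uo: "openin (mtop N) U" unfolding U_def
    by (intro openin_Int B0(1) N.max_open_preimage[OF c(1)])
  have U: "U \<subseteq> U0" "U \<subseteq> B0" "\<And>y. y \<in> U \<Longrightarrow> \<phi> y \<in> U'" unfolding U_def by blast+
  have \<Phi>U: "\<Phi> ` U = W \<inter> ball (\<Phi> x) r"
  proof (intro set_eqI iffI)
    fix w assume "w \<in> \<Phi> ` U"
    then show "w \<in> W \<inter> ball (\<Phi> x) r" using FW \<phi>W unfolding U_def \<Phi>_def z0_def by auto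
  next
    fix w assume w: "w \<in> W \<inter> ball (\<Phi> x) r"
    then have "w \<in> V'" "h w \<in> T" using r(2) unfolding \<Phi>_def z0_def by blast+
    moreover have "h w \<in> W" using FW[of "h w"] Fh(1)[OF \<open>w \<in> V'\<close>] w by simp
    ultimately obtain y where y: "y \<in> B0" "\<phi> y = h w" using T(2) by (metis IntI imageE)
    then have "y \<in> U" unfolding U_def using B0(3) Fh[OF \<open>w \<in> V'\<close>] w by (auto simp: \<Phi>_def z0_def)
    moreover have "\<Phi> y = w" unfolding \<Phi>_def using y(2) Fh(1)[OF \<open>w \<in> V'\<close>] by simp
    ultimately show "w \<in> \<Phi> ` U" by blast
  qed
  have inj\<Phi>: "inj_on \<Phi> U"
  proof (rule inj_onI)
    fix y y' assume "y \<in> U" "y' \<in> U" "\<Phi> y = \<Phi> y'"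
    then have "\<phi> y = \<phi> y'" using hF(1)[OF U(3)] unfolding \<Phi>_def by metis
    then show "y = y'" using N.max_inj[OF c(1)] U(1) \<open>y \<in> U\<close> \<open>y' \<in> U\<close> by (auto simp: inj_on_def)
  qed
  note [simp] = inv_into_f_f[OF N.max_inj[OF c(1)]] inv_into_f_f[OF inj\<Phi>]
  have "(U, \<Phi>) \<in> max_atlas N"
  proof (rule N.max_atlasI[OF c(1) Uo U(1) inj\<Phi> W(1)])
    show "openin (top_of_set W) (\<Phi> ` U)" unfolding \<Phi>U by (auto simp: openin_open)
    have "smooth_on (\<phi> ` U) F" by (rule Cinf_imp_smooth_on[OF CF]) (use U(3) inv(2) in blast)
    then show "smooth_on (\<phi> ` U) (\<Phi> \<circ> inv_into U0 \<phi>)"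
      by (rule smooth_on_cong) (use U(1) in \<open>auto simp: \<Phi>_def subsetD\<close>)
    have "smooth_on (\<Phi> ` U) h" by (rule Cinf_imp_smooth_on[OF inv(5)]) (use U(3) hF(2) \<Phi>_def in auto)
    then show "smooth_on (\<Phi> ` U) (\<phi> \<circ> inv_into U \<Phi>)"
    proof (rule smooth_on_cong)
      fix w assume "w \<in> \<Phi> ` U"
      then obtain y where y: "y \<in> U" "w = \<Phi> y" by blast
      have "h (\<Phi> y) = \<phi> y" unfolding \<Phi>_def by (rule hF(1)[OF U(3)[OF y(1)]])
      then show "h w = (\<phi> \<circ> inv_into U \<Phi>) w" using y by simp
    qed
  qed
  moreover have "x \<in> U" unfolding U_def using B0(2) c(2) inv(3) r(1) z0_def by auto
  moreover have "p ` U \<subseteq> V" using U(2) unfolding B0_def by blast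
  moreover have "\<psi> (p y) = A (\<Phi> y)" if "y \<in> U" for y
    using AF[OF subsetD[OF U(2) that] U(3)[OF that]] by (simp add: \<Phi>_def)
  moreover have "A w \<in> W'" for w unfolding A_def by (rule P'(2))
  ultimately show thesis using that linA W(1) r(1) \<Phi>U B by blast
qed

end

lemma manifold_dim:
  assumes "smooth_manifold M"
  obtains d where "\<And>U \<phi> d' x. (U, \<phi>) \<in> max_atlas M \<Longrightarrow> x \<in> U \<Longrightarrow> chart_of_dim d' (U, \<phi>) \<Longrightarrow> d' = d"
proof -
  interpret smooth_atlas M by (rule smooth_manifold_atlas[OF assms])
  obtain d where d: "\<forall>c\<in>atlas M. chart_of_dim d c" using assms unfolding smooth_manifold_def by blast
  have "d' = d" if c: "(U, \<phi>) \<in> max_atlas M" "x \<in> U" "chart_of_dim d' (U, \<phi>)" for U \<phi> d' x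
  proof -
    obtain V \<psi> where V: "(V, \<psi>) \<in> atlas M" "x \<in> V" using c max_sub atlas_at by blast
    have "(V, \<psi>) \<in> max_atlas M" using V(1) atlas_max by blast
    then show ?thesis using chart_dim_unique[OF c(1) _ c(2) V(2) c(3)] d V(1) by blast
  qed
  then show thesis by (rule that)
qed

context submersion_atlas
begin

text \<open>In coordinates where p is the linear map A and X is the subspace W', the preimage of X
  is the subspace of vectors sent into W' by A. A curve in the preimage projects to a curve in X
  within V, hence into C, so smooth components do not leave the slice. The two dimension formulas
  show later that the slices all have the same dimension.\<close>

lemma preimage_chart:
  assumes X: "submanifold M X" and x: "x \<in> pts N" "p x \<in> X"
  obtains U \<Phi> A W V \<psi> C W' W1 where "adapted M X V \<psi> C W'" "p x \<in> C"
    "adapted N {z \<in> pts N. p z \<in> X} U \<Phi> {z \<in> U. p z \<in> C} (A -` W')" "x \<in> U"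
    "p ` U \<subseteq> V" "\<And>y. y \<in> U \<Longrightarrow> \<psi> (p y) = A (\<Phi> y)" "linear A"
    "subspace W" "openin (top_of_set W) (\<Phi> ` U)" "subspace W1" "openin (top_of_set W1) (\<psi> ` V)"
    "dim (W \<inter> A -` W') = dim {w \<in> W. A w = 0} + dim (W1 \<inter> W')" "dim W = dim {w \<in> W. A w = 0} + dim W1"
proof -
  interpret X: submanifold M X by fact
  obtain V \<psi> C W' where ad: "adapted M X V \<psi> C W'" "p x \<in> C" using X.adapted_at[OF x(2)] by blast
  note c = X.adaptedD[OF ad(1)]
  have px: "p x \<in> V" using ad(2) c(4) by blast
  obtain W1 where W1: "subspace W1" "openin (top_of_set W1) (\<psi> ` V)" using M.max_space[OF c(2)] by blast
  obtain U \<Phi> A B W r where U: "(U, \<Phi>) \<in> max_atlas N" "x \<in> U" "p ` U \<subseteq> V" "linear A" "subspace W" "r > 0"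
    "\<Phi> ` U = W \<inter> ball (\<Phi> x) r" "\<And>y. y \<in> U \<Longrightarrow> \<psi> (p y) = A (\<Phi> y)" "\<And>w. A w \<in> W1"
    "linear B" "\<And>v. B v \<in> W" "\<And>w. w \<in> W1 \<Longrightarrow> A (B w) = w"
    by (rule submersion_chart[OF x(1) c(2) px W1]) (rule that)
  let ?P = "{z \<in> pts N. p z \<in> X}"
  have C: "p y \<in> C \<longleftrightarrow> A (\<Phi> y) \<in> W'" if "y \<in> U" for y
  proof -
    have "p y \<in> V" using U(3) that by blast
    then show ?thesis using c(6)[of "p y"] U(8)[OF that] by simp
  qed
  have sub: "subspace (A -` W')" using linear_subspace_vimage[OF U(4) c(3)] .
  have "adapted N ?P U \<Phi> {y \<in> U. \<Phi> y \<in> A -` W'} (A -` W')"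
  proof (rule N.adapted_convexI[OF U(1) U(7) _ sub U(2)])
    show "convex (W \<inter> ball (\<Phi> x) r)" by (intro convex_Int subspace_imp_convex U(5) convex_ball)
    show "\<Phi> x \<in> A -` W'" using C[OF U(2)] ad(2) by simp
    show "y \<in> ?P" if "y \<in> U" "\<Phi> y \<in> A -` W'" for y
      using that C[of y] c(5) N.max_sub[OF U(1)] by auto
    show "\<Phi> y \<in> A -` W'" if y: "y \<in> smooth_component N (U \<inter> ?P) x" for y
    proof -
      obtain d where d: "smooth_curve N d" "range d \<subseteq> U \<inter> ?P" "d 0 = x" "d 1 = y"
        using y unfolding smooth_component_def by blast
      have "p (d t) \<in> V \<inter> X" for t
      proof -
        have "d t \<in> U \<inter> ?P" using d(2) by blast
        then show ?thesis using U(3) by blast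
      qed
      then have "range (\<lambda>t. p (d t)) \<subseteq> V \<inter> X" by blast
      then have "p y \<in> smooth_component M (V \<inter> X) (p x)"
        unfolding smooth_component_def using smooth_curve_image[OF d(1)] d(3,4)
        by (intro CollectI exI[of _ "\<lambda>t. p (d t)"]) simp
      then have "p y \<in> C" using c(7)[OF ad(2)] by blast
      moreover have "y \<in> U" using y N.smooth_component_sub by blast
      ultimately show ?thesis using C by simp
    qed
  qed
  moreover have "{y \<in> U. \<Phi> y \<in> A -` W'} = {z \<in> U. p z \<in> C}" using C by auto
  ultimately have 3: "adapted N ?P U \<Phi> {z \<in> U. p z \<in> C} (A -` W')" by simp
  have 9: "openin (top_of_set W) (\<Phi> ` U)" unfolding U(7) by (auto simp: openin_open)
  have "dim {w \<in> W. A w \<in> W1 \<inter> W'} = dim {w \<in> W. A w = 0} + dim (W1 \<inter> W')"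
    by (rule dim_linear_preimage[OF U(5,4,10,11,12)]) (use U(9) W1 c(3) in \<open>auto intro: subspace_inter\<close>)
  moreover have "{w \<in> W. A w \<in> W1 \<inter> W'} = W \<inter> A -` W'" using U(9) by blast
  ultimately have 12: "dim (W \<inter> A -` W') = dim {w \<in> W. A w = 0} + dim (W1 \<inter> W')" by simp
  have "dim {w \<in> W. A w \<in> W1} = dim {w \<in> W. A w = 0} + dim W1"
    by (rule dim_linear_preimage[OF U(5,4,10,11,12)]) (use U(9) W1 in auto)
  then have 13: "dim W = dim {w \<in> W. A w = 0} + dim W1" using U(9) by simp
  show thesis by (rule that[OF ad 3 U(2,3,8,4,5) 9 W1 12 13])
qed

lemma preimage_submanifold:
  assumes X: "submanifold M X"
  shows "submanifold N {z \<in> pts N. p z \<in> X}"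
proof -
  have "smooth_atlas (submfd N {z \<in> pts N. p z \<in> X})"
  proof (rule N.submfd_atlasI)
    fix x assume x: "x \<in> {z \<in> pts N. p z \<in> X}"
    then have x': "x \<in> pts N" "p x \<in> X" by auto
    obtain U \<Phi> A W V \<psi> C W' W1 where "adapted M X V \<psi> C W'" "p x \<in> C"
      and ad: "adapted N {z \<in> pts N. p z \<in> X} U \<Phi> {z \<in> U. p z \<in> C} (A -` W')" "x \<in> U"
      by (rule preimage_chart[OF X x']) (rule that)
    then show "\<exists>C \<phi>. (C, \<phi>) \<in> atlas (submfd N {z \<in> pts N. p z \<in> X}) \<and> x \<in> C"
      unfolding adapted_def by blast
  qed
  then show ?thesis
    unfolding submanifold_def submanifold_axioms_def using N.smooth_atlas_axioms by blast
qed

lemma coord_push: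
  assumes U: "(U, \<Phi>) \<in> max_atlas N" "x \<in> U" and V: "(V, \<psi>) \<in> max_atlas M" "p x \<in> V"
    and A: "linear A" "\<And>y. y \<in> U \<Longrightarrow> \<psi> (p y) = A (\<Phi> y)" and v: "v \<in> tangent N x"
  shows "coord \<psi> (push M p x v) = A (coord \<Phi> v)"
proof (rule euclidean_eqI)
  fix b
  have bl: "bounded_linear (\<lambda>z. A z \<bullet> b)"
    using A(1) by (intro bounded_linear_compose[OF bounded_linear_inner_left]) (simp add: linear_conv_bounded_linear)
  have 1: "push M p x v (\<lambda>y. \<psi> y \<bullet> b) = v (\<lambda>y. \<psi> (p y) \<bullet> b)"
    by (rule push_apply[OF M.smooth_at_inner[OF V]])
  have "Cinf UNIV (\<lambda>z. A z \<bullet> b)"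
    using smooth_on_linear[OF bounded_linear.linear[OF bl], of UNIV] smooth_on_open[of UNIV] by blast
  then have "v (\<lambda>y. \<psi> (p y) \<bullet> b) = frechet_derivative (\<lambda>z. A z \<bullet> b) (at (\<Phi> x)) (coord \<Phi> v)"
    by (rule N.tangent_apply[OF U(1) v _ N.max_open[OF U(1)] U(2)]) (use A(2) in auto)
  also have "frechet_derivative (\<lambda>z. A z \<bullet> b) (at (\<Phi> x)) = (\<lambda>z. A z \<bullet> b)"
    by (rule frechet_derivative_at[symmetric]) (rule bounded_linear_imp_has_derivative[OF bl])
  finally show "coord \<psi> (push M p x v) \<bullet> b = A (coord \<Phi> v) \<bullet> b"
    using M.coord_inner[OF V push_tangent[OF v], of b] 1 by simp
qed

text \<open>In the charts of \<open>preimage_chart\<close> both sides say that A maps the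
  coordinates of v into W'.\<close>

lemma preimage_tangent_sub:
  assumes X: "submanifold M X" and x: "x \<in> pts N" "p x \<in> X"
  shows "tangent_sub N {z \<in> pts N. p z \<in> X} x = {v \<in> tangent N x. push M p x v \<in> tangent_sub M X (p x)}"
proof -
  interpret X: submanifold M X by fact
  interpret P: submanifold N "{z \<in> pts N. p z \<in> X}" by (rule preimage_submanifold[OF X])
  obtain U \<Phi> A W V \<psi> C W' W1 where ad: "adapted M X V \<psi> C W'" "p x \<in> C"
    and ad': "adapted N {z \<in> pts N. p z \<in> X} U \<Phi> {z \<in> U. p z \<in> C} (A -` W')" "x \<in> U"
    and A: "p ` U \<subseteq> V" "\<And>y. y \<in> U \<Longrightarrow> \<psi> (p y) = A (\<Phi> y)" "linear A"
    by (rule preimage_chart[OF X x]) (rule that)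
  note c = X.adaptedD[OF ad(1)]
  note c' = P.adaptedD[OF ad'(1)]
  have px: "p x \<in> V" using A(1) ad'(2) by blast
  have "tangent_sub N {z \<in> pts N. p z \<in> X} x = {v \<in> tangent N x. coord \<Phi> v \<in> A -` W'}"
    by (rule P.tangent_sub_chart[OF ad'(1)]) (use ad'(2) ad(2) in simp)
  also have "\<dots> = {v \<in> tangent N x. coord \<psi> (push M p x v) \<in> W'}"
    using coord_push[OF c'(2) ad'(2) c(2) px A(3,2)] by auto
  also have "\<dots> = {v \<in> tangent N x. push M p x v \<in> tangent_sub M X (p x)}"
    unfolding X.tangent_sub_chart[OF ad] using push_tangent by blast
  finally show ?thesis .
qed

text \<open>The preimage carries the topology of the fibre product of N and X over M. Countable
  bases and the comparison with the subspace topology are deduced from this form of its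
  neighbourhoods.\<close>

lemma preimage_base:
  assumes X: "submanifold M X" and G: "openin (mtop (submfd N {z \<in> pts N. p z \<in> X})) G" "x \<in> G"
  obtains A B where "openin (mtop N) A" "openin (mtop (submfd M X)) B" "x \<in> A" "p x \<in> B"
    "A \<inter> p -` B \<subseteq> G"
proof -
  interpret X: submanifold M X by fact
  interpret P: submanifold N "{z \<in> pts N. p z \<in> X}" by (rule preimage_submanifold[OF X])
  have x: "x \<in> pts N" "p x \<in> X" using openin_subset[OF G(1)] G(2) P.N.topspace_mtop by auto
  obtain U \<Phi> A W V \<psi> C W' W1 where ad: "adapted M X V \<psi> C W'" "p x \<in> C"
    and ad': "adapted N {z \<in> pts N. p z \<in> X} U \<Phi> {z \<in> U. p z \<in> C} (A -` W')" "x \<in> U"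
    by (rule preimage_chart[OF X x]) (rule that)
  note c = X.adaptedD[OF ad(1)]
  note c' = P.adaptedD[OF ad'(1)]
  obtain T where T: "open T" "G \<inter> {z \<in> U. p z \<in> C} = {z \<in> U. p z \<in> C} \<inter> \<Phi> -` T"
    by (rule P.N.open_max_preimage[OF c'(1) G(1)])
  show thesis
  proof (rule that[OF N.max_open_preimage[OF c'(2) T(1)] X.N.max_open[OF c(1)]])
    show "x \<in> U \<inter> \<Phi> -` T" using T(2) G(2) ad'(2) ad(2) by blast
    show "p x \<in> C" by fact
    show "U \<inter> \<Phi> -` T \<inter> p -` C \<subseteq> G" using T(2) by blast
  qed
qed

lemma preimage_restrict_smooth:
  assumes X: "submanifold M X"
  shows "smooth_map (submfd N {z \<in> pts N. p z \<in> X}) (submfd M X) p"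
proof -
  interpret X: submanifold M X by fact
  interpret P: submanifold N "{z \<in> pts N. p z \<in> X}" by (rule preimage_submanifold[OF X])
  show ?thesis
  proof (rule X.initial[OF P.N.smooth_atlas_axioms])
    show "smooth_map (submfd N {z \<in> pts N. p z \<in> X}) M p"
      using smooth_map_compose[OF P.incl_smooth smooth P.N.smooth_atlas_axioms N.smooth_atlas_axioms M.smooth_atlas_axioms] .
  qed auto
qed

text \<open>What remains beyond the local charts is constancy of the dimension, from the dimension
  formulas, and a countable base, built from products of members of countable bases of N and
  X.\<close>

lemma preimage_initial:
  assumes N: "smooth_manifold N" and M: "smooth_manifold M" and X: "initial_submanifold M X"
  shows "initial_submanifold N {z \<in> pts N. p z \<in> X}"
proof -
  let ?P = "{z \<in> pts N. p z \<in> X}"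
  have subX: "submanifold M X" by (rule initial_submanifold_locale[OF M.smooth_atlas_axioms X])
  have mX: "smooth_manifold (submfd M X)" using X unfolding initial_submanifold_def by blast
  interpret X: submanifold M X by (rule subX)
  interpret P: submanifold N ?P by (rule preimage_submanifold[OF subX])
  obtain n where n: "\<And>U \<phi> d' x. (U, \<phi>) \<in> max_atlas N \<Longrightarrow> x \<in> U \<Longrightarrow> chart_of_dim d' (U, \<phi>) \<Longrightarrow> d' = n"
    by (rule manifold_dim[OF N]) (rule that)
  obtain m where m: "\<And>U \<phi> d' x. (U, \<phi>) \<in> max_atlas M \<Longrightarrow> x \<in> U \<Longrightarrow> chart_of_dim d' (U, \<phi>) \<Longrightarrow> d' = m"
    by (rule manifold_dim[OF M]) (rule that)
  obtain k where k: "\<And>U \<phi> d' x. (U, \<phi>) \<in> max_atlas (submfd M X) \<Longrightarrow> x \<in> U \<Longrightarrow> chart_of_dim d' (U, \<phi>) \<Longrightarrow> d' = k"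
    by (rule manifold_dim[OF mX]) (rule that)
  \<comment> \<open>The difference n - m is the dimension of the kernel of A; the formula for
    \<open>dim W\<close> shows that the subtraction is not truncated.\<close>
  have "chart_of_dim (n - m + k) c" if c: "c \<in> atlas (submfd N ?P)" for c
  proof -
    obtain D \<theta> where D: "c = (D, \<theta>)" by (cases c)
    then have D': "(D, \<theta>) \<in> max_atlas (submfd N ?P)" using c P.N.atlas_max by blast
    have "\<exists>x. x \<in> D"
    proof -
      obtain U' x where "D = smooth_component N (U' \<inter> ?P) x" "x \<in> U' \<inter> ?P"
        using c D unfolding submfd_def by auto
      then show ?thesis using N.smooth_component_refl[of x "U' \<inter> ?P"] by blast
    qed
    then obtain x where x: "x \<in> D" by blast
    then have x': "x \<in> pts N" "p x \<in> X" using P.N.max_sub[OF D'] by auto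
    obtain U \<Phi> A W V \<psi> C W' W1 where ad: "adapted M X V \<psi> C W'" "p x \<in> C"
      and ad': "adapted N ?P U \<Phi> {z \<in> U. p z \<in> C} (A -` W')" "x \<in> U"
      and A: "p ` U \<subseteq> V"
      and W: "subspace W" "openin (top_of_set W) (\<Phi> ` U)" "subspace W1" "openin (top_of_set W1) (\<psi> ` V)"
      and d: "dim (W \<inter> A -` W') = dim {w \<in> W. A w = 0} + dim (W1 \<inter> W')" "dim W = dim {w \<in> W. A w = 0} + dim W1"
      by (rule preimage_chart[OF subX x']) (rule that)
    note e = X.adaptedD[OF ad(1)]
    note e' = P.adaptedD[OF ad'(1)]
    have "chart_of_dim (dim W) (U, \<Phi>)" "chart_of_dim (dim W1) (V, \<psi>)"
      using W N.max_inj[OF e'(2)] M.max_inj[OF e(2)] unfolding chart_of_dim_def by auto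
    then have "dim W = n" "dim W1 = m"
      using n[OF e'(2) ad'(2)] m[OF e(2), of "p x"] A ad'(2) by auto
    moreover have "dim (W1 \<inter> W') = k" by (rule k[OF e(1) ad(2) M.adapted_dim[OF ad(1) W(3,4)]])
    ultimately have dd: "dim (W \<inter> A -` W') = n - m + k" using d by simp
    obtain d' where d': "chart_of_dim d' (D, \<theta>)" using P.N.max_chart[OF D'] by blast
    have "d' = dim (W \<inter> A -` W')"
      by (rule P.N.chart_dim_unique[OF D' e'(1) x _ d' N.adapted_dim[OF ad'(1) W(1,2)]]) (use ad'(2) ad(2) in simp)
    then show ?thesis using d' dd D by simp
  qed
  moreover have "second_countable (mtop (submfd N ?P))"
  proof -
    obtain \<A> where \<A>: "countable \<A>" "\<And>V. V \<in> \<A> \<Longrightarrow> openin (mtop N) V"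
      "\<And>U x. openin (mtop N) U \<Longrightarrow> x \<in> U \<Longrightarrow> \<exists>V\<in>\<A>. x \<in> V \<and> V \<subseteq> U"
      using N unfolding smooth_manifold_def second_countable_def by metis
    obtain \<B> where \<B>: "countable \<B>" "\<And>V. V \<in> \<B> \<Longrightarrow> openin (mtop (submfd M X)) V"
      "\<And>U x. openin (mtop (submfd M X)) U \<Longrightarrow> x \<in> U \<Longrightarrow> \<exists>V\<in>\<B>. x \<in> V \<and> V \<subseteq> U"
      using mX unfolding smooth_manifold_def second_countable_def by metis
    let ?f = "\<lambda>(A, B). ?P \<inter> A \<inter> p -` B"
    have "countable (?f ` (\<A> \<times> \<B>))" using \<A>(1) \<B>(1) by blast
    moreover have "openin (mtop (submfd N ?P)) V" if V: "V \<in> ?f ` (\<A> \<times> \<B>)" for V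
    proof -
      obtain A B where AB: "A \<in> \<A>" "B \<in> \<B>" "V = ?P \<inter> A \<inter> p -` B" using V by auto
      have "openin (mtop (submfd N ?P)) (?P \<inter> A)" by (rule P.open_trace[OF \<A>(2)[OF AB(1)]])
      moreover have "openin (mtop (submfd N ?P)) (?P \<inter> p -` B)"
        using smooth_map_open_preimage[OF preimage_restrict_smooth[OF subX] P.N.smooth_atlas_axioms \<B>(2)[OF AB(2)]] by simp
      ultimately have "openin (mtop (submfd N ?P)) ((?P \<inter> A) \<inter> (?P \<inter> p -` B))" by (rule openin_Int)
      moreover have "V = (?P \<inter> A) \<inter> (?P \<inter> p -` B)" using AB(3) by blast
      ultimately show ?thesis by simp
    qed
    moreover have "\<exists>V\<in>?f ` (\<A> \<times> \<B>). x \<in> V \<and> V \<subseteq> G" if G: "openin (mtop (submfd N ?P)) G" "x \<in> G" for G x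
    proof -
      obtain A B where AB: "openin (mtop N) A" "openin (mtop (submfd M X)) B" "x \<in> A" "p x \<in> B" "A \<inter> p -` B \<subseteq> G"
        by (rule preimage_base[OF subX G]) (rule that)
      obtain A' where A': "A' \<in> \<A>" "x \<in> A'" "A' \<subseteq> A" using \<A>(3)[OF AB(1,3)] by blast
      obtain B' where B': "B' \<in> \<B>" "p x \<in> B'" "B' \<subseteq> B" using \<B>(3)[OF AB(2,4)] by blast
      have "?f (A', B') \<in> ?f ` (\<A> \<times> \<B>)" using A'(1) B'(1) by (intro imageI) simp
      moreover have "x \<in> ?P" using openin_subset[OF G(1)] G(2) P.N.topspace_mtop by auto
      then have "x \<in> ?f (A', B')" using A'(2) B'(2) by simp
      moreover have "?f (A', B') \<subseteq> G" using A'(3) B'(3) AB(5) by auto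
      ultimately show ?thesis by (intro bexI[of _ "?f (A', B')"] conjI)
    qed
    ultimately show ?thesis unfolding second_countable_def
      by (intro exI[of _ "?f ` (\<A> \<times> \<B>)"] conjI ballI allI impI) (assumption | elim conjE)+
  qed
  moreover have "Hausdorff_space (mtop (submfd N ?P))"
    using P.Hausdorff N unfolding smooth_manifold_def by blast
  ultimately have "smooth_manifold (submfd N ?P)"
    unfolding smooth_manifold_def using P.N.cover P.N.compat by blast
  then show ?thesis unfolding initial_submanifold_def by blast
qed

text \<open>In \<open>preimage_base\<close> the set B is now the trace of an open set of M, so the
  neighbourhood it describes is the trace of an open set of N.\<close>

lemma preimage_embedded:
  assumes N: "smooth_manifold N" and M: "smooth_manifold M" and X: "embedded_submanifold M X"
  shows "embedded_submanifold N {z \<in> pts N. p z \<in> X}"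
proof -
  let ?P = "{z \<in> pts N. p z \<in> X}"
  have iX: "initial_submanifold M X" and tX: "mtop (submfd M X) = subtopology (mtop M) X"
    using X unfolding embedded_submanifold_def by blast+
  have subX: "submanifold M X" by (rule initial_submanifold_locale[OF M.smooth_atlas_axioms iX])
  interpret P: submanifold N ?P by (rule preimage_submanifold[OF subX])
  have "openin (mtop (submfd N ?P)) G \<longleftrightarrow> openin (subtopology (mtop N) ?P) G" for G
  proof
    assume "openin (subtopology (mtop N) ?P) G"
    then obtain A where "openin (mtop N) A" "G = ?P \<inter> A" unfolding openin_subtopology by blast
    then show "openin (mtop (submfd N ?P)) G" using P.open_trace by blast
  next
    assume G: "openin (mtop (submfd N ?P)) G"
    show "openin (subtopology (mtop N) ?P) G"
    proof (subst openin_subopen, intro ballI)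
      fix x assume x: "x \<in> G"
      obtain A B where AB: "openin (mtop N) A" "openin (mtop (submfd M X)) B" "x \<in> A" "p x \<in> B" "A \<inter> p -` B \<subseteq> G"
        by (rule preimage_base[OF subX G x]) (rule that)
      obtain B' where B': "openin (mtop M) B'" "B = B' \<inter> X" using AB(2) unfolding tX openin_subtopology by blast
      have xP: "x \<in> ?P" using openin_subset[OF G] x P.N.topspace_mtop by auto
      have "openin (mtop N) (A \<inter> (pts N \<inter> p -` B'))"
        by (rule openin_Int[OF AB(1) smooth_map_open_preimage[OF smooth N.smooth_atlas_axioms B'(1)]])
      then have "openin (subtopology (mtop N) ?P) ((A \<inter> (pts N \<inter> p -` B')) \<inter> ?P)"
        unfolding openin_subtopology by blast
      moreover have "x \<in> (A \<inter> (pts N \<inter> p -` B')) \<inter> ?P" using AB(3,4) B'(2) xP by blast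
      moreover have "(A \<inter> (pts N \<inter> p -` B')) \<inter> ?P \<subseteq> G" using AB(5) B'(2) by blast
      ultimately show "\<exists>T. openin (subtopology (mtop N) ?P) T \<and> x \<in> T \<and> T \<subseteq> G" by blast
    qed
  qed
  then have "mtop (submfd N ?P) = subtopology (mtop N) ?P" by (simp add: topology_eq)
  then show ?thesis unfolding embedded_submanifold_def using preimage_initial[OF N M iX] by blast
qed

end

section \<open>Fibres as preimages of points\<close>

context smooth_atlas
begin

text \<open>Slices are linear subspaces, so the chart is translated to send x to 0. It is also
  restricted to a ball, which makes its image convex.\<close>

lemma point_adapted:
  assumes x: "x \<in> pts M"
  obtains U \<phi> where "adapted M {x} U \<phi> {x} {0}"
proof -
  obtain U \<phi> where c: "(U, \<phi>) \<in> max_atlas M" "x \<in> U" using max_at[OF x] by blast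
  obtain W where W: "subspace W" "openin (top_of_set W) (\<phi> ` U)" using max_space[OF c(1)] by blast
  have \<phi>W: "\<phi> ` U \<subseteq> W" using openin_imp_subset[OF W(2)] .
  obtain r where r: "r > 0" "ball (\<phi> x) r \<inter> W \<subseteq> \<phi> ` U"
    using W(2) c(2) unfolding openin_contains_ball by blast
  let ?U = "U \<inter> \<phi> -` ball (\<phi> x) r" and ?\<psi> = "\<lambda>y. \<phi> y - \<phi> x"
  have Uo: "openin (mtop M) ?U" by (rule max_open_preimage[OF c(1) open_ball])
  note inj = max_inj[OF c(1)]
  have inj': "inj_on ?\<psi> ?U" using inj by (auto simp: inj_on_def)
  note [simp] = inv_into_f_f[OF inj] inv_into_f_f[OF inj']
  have im: "?\<psi> ` ?U = W \<inter> ball 0 r"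
  proof (intro set_eqI iffI)
    fix w assume "w \<in> ?\<psi> ` ?U"
    then show "w \<in> W \<inter> ball 0 r" using \<phi>W c(2) W(1) by (auto simp: dist_norm norm_minus_commute intro!: subspace_diff)
  next
    fix w assume w: "w \<in> W \<inter> ball 0 r"
    have "\<phi> x \<in> W" using \<phi>W c(2) by blast
    then have "\<phi> x + w \<in> ball (\<phi> x) r \<inter> W" using w W(1) by (auto simp: dist_norm subspace_add)
    moreover from this obtain y where "y \<in> U" "\<phi> y = \<phi> x + w" using r(2) by (metis imageE subsetD)
    ultimately have "y \<in> ?U" "w = ?\<psi> y" by auto
    then show "w \<in> ?\<psi> ` ?U" by blast
  qed
  have c': "(?U, ?\<psi>) \<in> max_atlas M"
  proof (rule max_atlasI[OF c(1) Uo _ inj' W(1)])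
    show "openin (top_of_set W) (?\<psi> ` ?U)" unfolding im by (auto simp: openin_open)
    show "smooth_on (\<phi> ` ?U) (?\<psi> \<circ> inv_into U \<phi>)"
      by (rule smooth_on_cong[OF smooth_on_diff[OF smooth_on_id smooth_on_const[of _ "\<phi> x"]]]) auto
    show "smooth_on (?\<psi> ` ?U) (\<phi> \<circ> inv_into ?U ?\<psi>)"
      by (rule smooth_on_cong[OF smooth_on_add[OF smooth_on_id smooth_on_const[of _ "\<phi> x"]]]) auto
  qed auto
  have 0: "?\<psi> y \<in> {0} \<longleftrightarrow> y = x" if "y \<in> ?U" for y
    using that c(2) inj by (auto simp: inj_on_def)
  have "adapted M {x} ?U ?\<psi> {y \<in> ?U. ?\<psi> y \<in> {0}} {0}"
  proof (rule adapted_convexI[OF c' im])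
    show "convex (W \<inter> ball 0 r)" by (intro convex_Int subspace_imp_convex W(1) convex_ball)
    show "?\<psi> y \<in> {0}" if "y \<in> smooth_component M (?U \<inter> {x}) x" for y
      using that smooth_component_sub by fastforce
    show "y \<in> {x}" if "y \<in> ?U" "?\<psi> y \<in> {0}" for y using 0[OF that(1)] that(2) by blast
  qed (use c(2) r(1) in auto)
  moreover have "{y \<in> ?U. ?\<psi> y \<in> {0}} = {x}"
  proof -
    have "x \<in> ?U" using c(2) r(1) by simp
    then show ?thesis using 0 by blast
  qed
  ultimately show thesis using that by metis
qed

lemma point_submanifold: "x \<in> pts M \<Longrightarrow> submanifold M {x}"
proof -
  assume x: "x \<in> pts M"
  obtain U \<phi> where "adapted M {x} U \<phi> {x} {0}" by (rule point_adapted[OF x])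
  then have "smooth_atlas (submfd M {x})"
    by (intro submfd_atlasI) (auto simp: adapted_def)
  then show ?thesis unfolding submanifold_def submanifold_axioms_def using x smooth_atlas_axioms by blast
qed

lemma point_tangent_sub: "x \<in> pts M \<Longrightarrow> tangent_sub M {x} x = {\<lambda>f. 0}"
proof -
  assume x: "x \<in> pts M"
  interpret X: submanifold M "{x}" by (rule point_submanifold[OF x])
  obtain U \<phi> where ad: "adapted M {x} U \<phi> {x} {0}" by (rule point_adapted[OF x])
  note c = X.adaptedD[OF ad]
  have eq: "tangent_sub M {x} x = {v \<in> tangent M x. coord \<phi> v \<in> {0}}" by (rule X.tangent_sub_chart[OF ad]) simp
  have z: "coord \<phi> (\<lambda>f. 0) = 0" by (simp add: coord_def)
  have xU: "x \<in> U" using c(4) by simp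
  show ?thesis
  proof (intro set_eqI iffI)
    fix v assume "v \<in> tangent_sub M {x} x"
    then have v: "v \<in> tangent M x" "coord \<phi> v = coord \<phi> (\<lambda>f. 0)" unfolding eq using z by simp_all
    have "v = (\<lambda>f. 0)" by (rule tangent_eqI[OF c(2) xU v(1) tangent_zero[OF x] v(2)])
    then show "v \<in> {\<lambda>f. 0}" by simp
  next
    fix v :: "'a tvec" assume "v \<in> {\<lambda>f. 0}"
    then have "v = (\<lambda>f. 0)" by simp
    then show "v \<in> tangent_sub M {x} x" unfolding eq using tangent_zero[OF x] z by simp
  qed
qed

end

lemma point_embedded:
  assumes M: "smooth_manifold M" and x: "x \<in> pts M"
  shows "embedded_submanifold M {x}"
proof -
  interpret smooth_atlas M by (rule smooth_manifold_atlas[OF M])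
  interpret X: submanifold M "{x}" by (rule point_submanifold[OF x])
  have op: "openin (mtop (submfd M {x})) A \<longleftrightarrow> A \<subseteq> {x}" for A
  proof
    assume "A \<subseteq> {x}"
    then have "A = {} \<or> A = topspace (mtop (submfd M {x}))" using X.N.topspace_mtop by auto
    then show "openin (mtop (submfd M {x})) A" by auto
  qed (use openin_subset X.N.topspace_mtop in fastforce)
  have "\<exists>d. \<forall>c\<in>atlas (submfd M {x}). chart_of_dim d c"
  proof (rule exI[of _ 0], intro ballI)
    fix c assume c: "c \<in> atlas (submfd M {x})"
    then obtain d where d: "chart_of_dim d c" using X.N.charts by blast
    obtain C \<phi> where C: "c = (C, \<phi>)" by (cases c)
    have C': "(C, \<phi>) \<in> max_atlas (submfd M {x})" using c C X.N.atlas_max by blast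
    have "x \<in> C"
    proof -
      obtain U y where "C = smooth_component M (U \<inter> {x}) y" "y \<in> U \<inter> {x}"
        using c C unfolding submfd_def by auto
      then show ?thesis using smooth_component_refl[of x "U \<inter> {x}"] x by auto
    qed
    obtain U \<psi> where ad: "adapted M {x} U \<psi> {x} {0}" by (rule point_adapted[OF x])
    note e = X.adaptedD[OF ad]
    obtain W0 where W0: "subspace W0" "openin (top_of_set W0) (\<psi> ` U)" using max_space[OF e(2)] by blast
    have "d = dim (W0 \<inter> {0})"
      by (rule X.N.chart_dim_unique[OF C' e(1) \<open>x \<in> C\<close> _ d[unfolded C] adapted_dim[OF ad W0]]) simp
    moreover have "W0 \<inter> {0} = {0}" using subspace_0[OF W0(1)] by blast
    ultimately show "chart_of_dim 0 c" using d by simp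
  qed
  moreover have "second_countable (mtop (submfd M {x}))"
    unfolding second_countable_def op by (intro exI[of _ "{{x}}"]) auto
  moreover have "Hausdorff_space (mtop (submfd M {x}))"
    using X.Hausdorff M unfolding smooth_manifold_def by blast
  ultimately have "smooth_manifold (submfd M {x})"
    unfolding smooth_manifold_def using X.N.cover X.N.compat by blast
  moreover have "mtop (submfd M {x}) = subtopology (mtop M) {x}"
  proof -
    have "openin (subtopology (mtop M) {x}) A \<longleftrightarrow> A \<subseteq> {x}" for A
    proof
      assume "A \<subseteq> {x}"
      then have "A = {} \<or> A = topspace (subtopology (mtop M) {x})" using x topspace_mtop by auto
      then show "openin (subtopology (mtop M) {x}) A" by (metis openin_empty openin_topspace)
    qed (use openin_subset in fastforce)
    then show ?thesis using op by (simp add: topology_eq)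
  qed
  ultimately show ?thesis unfolding embedded_submanifold_def initial_submanifold_def using x by blast
qed

context submersion_atlas
begin

lemma fibre_eq: "{z \<in> pts N. p z = y} = {z \<in> pts N. p z \<in> {y}}"
  by blast

lemma fibre_submanifold: "y \<in> pts M \<Longrightarrow> submanifold N {z \<in> pts N. p z = y}"
  unfolding fibre_eq by (rule preimage_submanifold[OF M.point_submanifold])

lemma fibre_tangent_sub:
  assumes x: "x \<in> pts N"
  shows "tangent_sub N {z \<in> pts N. p z = p x} x = {v \<in> tangent N x. push M p x v = (\<lambda>f. 0)}"
  unfolding fibre_eq preimage_tangent_sub[OF M.point_submanifold[OF p_pts[OF x]] x singletonI]
    M.point_tangent_sub[OF p_pts[OF x]] by simp

lemma fibre_embedded:
  "smooth_manifold N \<Longrightarrow> smooth_manifold M \<Longrightarrow> y \<in> pts M \<Longrightarrow> embedded_submanifold N {z \<in> pts N. p z = y}"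
  unfolding fibre_eq by (rule preimage_embedded[OF _ _ point_embedded])

end

section \<open>The Poisson structure of a symplectic leaf\<close>

context smooth_atlas
begin

text \<open>Smoothness at x depends on the germ alone, so the default value 0 occurs for both
  functions or for neither. In the smooth case both have the same coordinate expression near
  x.\<close>

lemma tangent_local:
  assumes D: "openin (mtop M) D" "x \<in> D" "\<And>y. y \<in> D \<Longrightarrow> f y = g y" and v: "v \<in> tangent M x"
  shows "v f = v g"
proof -
  have sm: "smooth_at M x f'" if f: "smooth_at M x g'" and eq: "\<And>y. y \<in> D \<Longrightarrow> f' y = g' y" for f' g'
  proof -
    obtain A where A: "openin (mtop M) A" "x \<in> A" "smooth_fn M A g'" using f unfolding smooth_at_iff by blast
    have "smooth_fn M (A \<inter> D) g'" using A(3) by (rule smooth_fn_subset) blast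
    then have "smooth_fn M (A \<inter> D) f'" by (rule smooth_fn_cong) (simp add: eq)
    then show ?thesis unfolding smooth_at_iff using openin_Int[OF A(1) D(1)] A(2) D(2) by blast
  qed
  show ?thesis
  proof (cases "smooth_at M x g")
    case True
    obtain U \<phi> where c: "(U, \<phi>) \<in> max_atlas M" "x \<in> U" using max_at[OF tangent_pts[OF v]] by blast
    obtain V h B where V: "Cinf V h" "openin (mtop M) B" "x \<in> B" "B \<subseteq> U"
      "\<And>y. y \<in> B \<Longrightarrow> \<phi> y \<in> V" "\<And>y. y \<in> B \<Longrightarrow> g y = h (\<phi> y)"
      by (rule smooth_at_chartE[OF c True]) (rule that)
    have "v g = frechet_derivative h (at (\<phi> x)) (coord \<phi> v)" by (rule tangent_apply[OF c(1) v V])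
    moreover have "v f = frechet_derivative h (at (\<phi> x)) (coord \<phi> v)"
      by (rule tangent_apply[OF c(1) v V(1) openin_Int[OF V(2) D(1)]]) (use V D in auto)
    ultimately show ?thesis by simp
  next
    case False
    then have "\<not> smooth_at M x f" using sm[of f g] D(3) sm[of g f] by metis
    then show ?thesis using False tangent_nonsmooth[OF v] by simp
  qed
qed

lemma differential_local:
  assumes "openin (mtop M) D" "x \<in> D" "\<And>y. y \<in> D \<Longrightarrow> f y = g y"
  shows "differential M f x = differential M g x"
proof (rule ext)
  fix v show "differential M f x v = differential M g x v"
    using tangent_local[where f = f and g = g, OF assms, of v] by (simp add: differential_def)
qed

end

lemma smooth_bivector_bracket:
  assumes "smooth_bivector M \<pi>" "openin (mtop M) U" "smooth_fn M U f" "smooth_fn M U g"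
  shows "smooth_fn M U (bracket M \<pi> f g)"
  using assms unfolding smooth_bivector_def smooth_fun_on_eq by blast

locale poisson_leaf = submanifold M X
  for M :: "('a, 'e::euclidean_space) mfd" and X +
  fixes \<pi> :: "'a bivector"
  assumes bivector: "smooth_bivector M \<pi>"
    and leaf: "y \<in> X \<Longrightarrow> tangent_sub M X y = sharp M \<pi> y ` cotangent M y"
begin

abbreviation "restr \<equiv> pull (submfd M X) M (\<lambda>y. y)"
abbreviation "\<sigma> \<equiv> leaf_bivector M \<pi> X"

lemma in_pts: "y \<in> X \<Longrightarrow> y \<in> pts M"
  using sub by blast

lemmas sharp_in = M.sharp_tangent[OF bivector in_pts]
  and sharp_val = M.sharp_apply[OF bivector in_pts]
  and skew = M.bivector_skew[OF bivector in_pts]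

lemma sharp_swap:
  assumes "y \<in> X" "\<xi> \<in> cotangent M y" "\<zeta> \<in> cotangent M y"
  shows "\<xi> (sharp M \<pi> y \<zeta>) = - \<zeta> (sharp M \<pi> y \<xi>)"
  using sharp_val[OF assms] sharp_val[OF assms(1,3,2)] skew[OF assms] by simp

lemma lift_sharp:
  assumes y: "y \<in> X" and \<xi>: "\<xi> \<in> cotangent M y"
  obtains u where "u \<in> tangent (submfd M X) y" "incl_push M y u = sharp M \<pi> y \<xi>"
proof -
  have "sharp M \<pi> y \<xi> \<in> tangent_sub M X y" unfolding leaf[OF y] using \<xi> by (rule imageI)
  then show thesis unfolding tangent_sub_def by (elim imageE) (metis that)
qed

lemma lower_tangent:
  assumes u: "u \<in> tangent (submfd M X) y"
  obtains \<xi> where "\<xi> \<in> cotangent M y" "incl_push M y u = sharp M \<pi> y \<xi>"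
proof -
  have y: "y \<in> X" using N.tangent_pts[OF u] by simp
  have "incl_push M y u \<in> tangent_sub M X y" unfolding tangent_sub_def using u by (rule imageI)
  then show thesis unfolding leaf[OF y] by (elim imageE) (metis that)
qed

lemma leaf_form_eq:
  assumes u: "u \<in> tangent (submfd M X) y" and v: "v \<in> tangent (submfd M X) y"
    and \<xi>: "\<xi> \<in> cotangent M y" "incl_push M y u = sharp M \<pi> y \<xi>"
  shows "leaf_form M \<pi> y u v = \<xi> (incl_push M y v)"
proof -
  have y: "y \<in> X" using N.tangent_pts[OF u] by simp
  define \<xi>' where "\<xi>' = (SOME \<xi>. \<xi> \<in> cotangent M y \<and> sharp M \<pi> y \<xi> = incl_push M y u)"
  have "\<xi> \<in> cotangent M y \<and> sharp M \<pi> y \<xi> = incl_push M y u" using \<xi> by simp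
  then have \<xi>': "\<xi>' \<in> cotangent M y" "sharp M \<pi> y \<xi>' = incl_push M y u"
    using someI[of "\<lambda>\<xi>. \<xi> \<in> cotangent M y \<and> sharp M \<pi> y \<xi> = incl_push M y u" \<xi>] unfolding \<xi>'_def by simp_all
  obtain \<zeta> where \<zeta>: "\<zeta> \<in> cotangent M y" "incl_push M y v = sharp M \<pi> y \<zeta>" by (rule lower_tangent[OF v])
  have "\<xi>' (incl_push M y v) = \<xi> (incl_push M y v)"
    unfolding \<zeta>(2) sharp_swap[OF y \<xi>'(1) \<zeta>(1)] sharp_swap[OF y \<xi>(1) \<zeta>(1)] \<xi>'(2) \<xi>(2) ..
  then show ?thesis unfolding leaf_form_def \<xi>'_def[symmetric] .
qed

text \<open>The vector that represents the restriction of \<xi> through the leaf form is the lift of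
  \<open>sharp M \<pi> y \<xi>\<close>. It is unique because, by skew-symmetry, two covectors that
  agree on the image of \<open>sharp\<close> have the same image under \<open>sharp\<close>. Later
  facts about the leaf bivector rest on this formula.\<close>

lemma leaf_bivector_restr:
  assumes y: "y \<in> X" and \<xi>: "\<xi> \<in> cotangent M y" and \<eta>: "\<eta> \<in> cotangent M y"
  shows "\<sigma> y (restr y \<xi>) (restr y \<eta>) = \<pi> y \<xi> \<eta>"
proof -
  obtain u where u: "u \<in> tangent (submfd M X) y" "incl_push M y u = sharp M \<pi> y \<xi>" by (rule lift_sharp[OF y \<xi>])
  have "(THE u. u \<in> tangent (submfd M X) y \<and> (\<forall>v\<in>tangent (submfd M X) y. leaf_form M \<pi> y u v = restr y \<xi> v)) = u"
  proof (rule the_equality, intro conjI ballI)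
    show "u \<in> tangent (submfd M X) y" by (rule u(1))
    show "leaf_form M \<pi> y u v = restr y \<xi> v" if v: "v \<in> tangent (submfd M X) y" for v
      using leaf_form_eq[OF u(1) v \<xi> u(2)] incl.pull_apply[OF v] by simp
    fix u' assume u': "u' \<in> tangent (submfd M X) y \<and> (\<forall>v\<in>tangent (submfd M X) y. leaf_form M \<pi> y u' v = restr y \<xi> v)"
    obtain \<xi>' where \<xi>': "\<xi>' \<in> cotangent M y" "incl_push M y u' = sharp M \<pi> y \<xi>'"
      by (rule lower_tangent[OF conjunct1[OF u']])
    have eq: "\<xi>' (incl_push M y v) = \<xi> (incl_push M y v)" if v: "v \<in> tangent (submfd M X) y" for v
      using leaf_form_eq[OF conjunct1[OF u'] v \<xi>'] incl.pull_apply[OF v, of \<xi>] conjunct2[OF u'] v by simp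
    have "incl_push M y u' = incl_push M y u"
      unfolding \<xi>'(2) u(2)
    proof (rule M.sharp_eqI[OF bivector in_pts[OF y] \<xi>'(1) sharp_in[OF y \<xi>]])
      fix \<zeta> assume \<zeta>: "\<zeta> \<in> cotangent M y"
      obtain v where v: "v \<in> tangent (submfd M X) y" "incl_push M y v = sharp M \<pi> y \<zeta>" by (rule lift_sharp[OF y \<zeta>])
      have "\<pi> y \<zeta> \<xi>' = \<pi> y \<zeta> \<xi>" using eq[OF v(1)] v(2) sharp_val[OF y \<zeta> \<xi>'(1)] sharp_val[OF y \<zeta> \<xi>] by simp
      then show "\<zeta> (sharp M \<pi> y \<xi>) = \<pi> y \<xi>' \<zeta>"
        using sharp_val[OF y \<xi> \<zeta>] skew[OF y \<xi> \<zeta>] skew[OF y \<xi>'(1) \<zeta>] by simp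
    qed
    then show "u' = u" by (rule incl_push_inj[OF conjunct1[OF u'] u(1)])
  qed
  then show ?thesis
    unfolding leaf_bivector_def form_bivector_def
    using incl.pull_apply[OF u(1), of \<eta>] u(2) sharp_val[OF y \<xi> \<eta>] by simp
qed

lemma restr_combination:
  "restr y (\<lambda>v. a * \<xi> v + b * \<eta> v) = (\<lambda>v. a * restr y \<xi> v + b * restr y \<eta> v)"
  by (auto simp: pull_def)

text \<open>The differential on X is the restriction of the differential of a local extension, so
  \<open>leaf_bivector_restr\<close> applies. Smoothness of brackets and the Jacobi identity pass
  from M to X in this way.\<close>

lemma leaf_bracket_eq:
  assumes D: "openin (mtop (submfd M X)) D" "y \<in> D" "\<And>z. z \<in> D \<Longrightarrow> f z = F z" "\<And>z. z \<in> D \<Longrightarrow> g z = G z"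
    and F: "smooth_at M y F" and G: "smooth_at M y G"
  shows "bracket (submfd M X) \<sigma> f g y = bracket M \<pi> F G y"
proof -
  have y: "y \<in> X" using openin_subset[OF D(1)] D(2) N.topspace_mtop by auto
  have "differential (submfd M X) f y = restr y (differential M F y)"
    "differential (submfd M X) g y = restr y (differential M G y)"
    using N.differential_local[where f = f and g = F, OF D(1-3)] N.differential_local[where f = g and g = G, OF D(1,2,4)]
      incl.pull_differential[OF F] incl.pull_differential[OF G] by simp_all
  then show ?thesis
    unfolding bracket_def
    using leaf_bivector_restr[OF y M.differential_cotangent[of F] M.differential_cotangent[of G]] by simp
qed

lemma smooth_on_open_at: "openin (mtop M) B \<Longrightarrow> smooth_fn M B F \<Longrightarrow> y \<in> B \<Longrightarrow> smooth_at M y F"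
  unfolding smooth_at_iff by blast

lemma leaf_smooth_bivector: "smooth_bivector (submfd M X) \<sigma>"
  unfolding smooth_bivector_def
proof (intro conjI ballI allI impI)
  fix x \<alpha> \<beta> \<gamma> a b
  assume "x \<in> pts (submfd M X)" and c: "\<alpha> \<in> cotangent (submfd M X) x" "\<beta> \<in> cotangent (submfd M X) x"
    "\<gamma> \<in> cotangent (submfd M X) x"
  then have x: "x \<in> X" by simp
  obtain \<xi> where \<xi>: "\<xi> \<in> cotangent M x" "\<alpha> = restr x \<xi>" by (rule cotangent_extension[OF c(1) x])
  obtain \<eta> where \<eta>: "\<eta> \<in> cotangent M x" "\<beta> = restr x \<eta>" by (rule cotangent_extension[OF c(2) x])
  obtain \<zeta> where \<zeta>: "\<zeta> \<in> cotangent M x" "\<gamma> = restr x \<zeta>" by (rule cotangent_extension[OF c(3) x])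
  show "\<sigma> x \<alpha> \<alpha> = 0" unfolding \<xi>(2) leaf_bivector_restr[OF x \<xi>(1) \<xi>(1)] using skew[OF x \<xi>(1) \<xi>(1)] by simp
  show "\<sigma> x \<alpha> \<beta> = - \<sigma> x \<beta> \<alpha>"
    unfolding \<xi>(2) \<eta>(2) leaf_bivector_restr[OF x \<xi>(1) \<eta>(1)] leaf_bivector_restr[OF x \<eta>(1) \<xi>(1)] by (rule skew[OF x \<xi>(1) \<eta>(1)])
  show "\<sigma> x (\<lambda>v. a * \<alpha> v + b * \<beta> v) \<gamma> = a * \<sigma> x \<alpha> \<gamma> + b * \<sigma> x \<beta> \<gamma>"
    unfolding \<xi>(2) \<eta>(2) \<zeta>(2) restr_combination[symmetric] leaf_bivector_restr[OF x M.cotangent_combination[OF \<xi>(1) \<eta>(1)] \<zeta>(1)]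
      leaf_bivector_restr[OF x \<xi>(1) \<zeta>(1)] leaf_bivector_restr[OF x \<eta>(1) \<zeta>(1)]
    by (rule M.bivector_linear[OF bivector in_pts[OF x] \<xi>(1) \<eta>(1) \<zeta>(1)])
next
  fix U f g
  assume U: "openin (mtop (submfd M X)) U" and "smooth_fun_on (submfd M X) U f" "smooth_fun_on (submfd M X) U g"
  then have f: "smooth_fn (submfd M X) U f" and g: "smooth_fn (submfd M X) U g" by (simp_all add: smooth_fun_on_eq)
  have "smooth_fn (submfd M X) U (bracket (submfd M X) \<sigma> f g)"
  proof (rule N.smooth_fn_local)
    fix x assume x: "x \<in> U"
    obtain F B D where F: "openin (mtop M) B" "smooth_fn M B F" "openin (mtop (submfd M X)) D" "x \<in> D" "D \<subseteq> U \<inter> B"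
      "\<And>y. y \<in> D \<Longrightarrow> F y = f y" by (rule local_extension[OF f U x]) (rule that)
    obtain G B' D' where G: "openin (mtop M) B'" "smooth_fn M B' G" "openin (mtop (submfd M X)) D'" "x \<in> D'" "D' \<subseteq> U \<inter> B'"
      "\<And>y. y \<in> D' \<Longrightarrow> G y = g y" by (rule local_extension[OF g U x]) (rule that)
    have oD: "openin (mtop (submfd M X)) (D \<inter> D')" by (rule openin_Int[OF F(3) G(3)])
    have "smooth_fn M (B \<inter> B') (bracket M \<pi> F G)"
      by (rule smooth_bivector_bracket[OF bivector openin_Int[OF F(1) G(1)] M.smooth_fn_subset[OF F(2)] M.smooth_fn_subset[OF G(2)]]) auto
    from smooth_map_fn[OF incl_smooth N.smooth_atlas_axioms M.smooth_atlas_axioms this]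
    have "smooth_fn (submfd M X) (D \<inter> D') (bracket M \<pi> F G)"
      by (rule N.smooth_fn_subset) (use F(5) G(5) openin_subset[OF F(3)] N.topspace_mtop in auto)
    then have "smooth_fn (submfd M X) (D \<inter> D') (bracket (submfd M X) \<sigma> f g)"
    proof (rule N.smooth_fn_cong)
      fix y assume y: "y \<in> D \<inter> D'"
      show "bracket M \<pi> F G y = bracket (submfd M X) \<sigma> f g y"
        by (rule leaf_bracket_eq[OF oD y _ _ smooth_on_open_at[OF F(1,2)] smooth_on_open_at[OF G(1,2)], symmetric])
          (use y F(5,6) G(5,6) in auto)
    qed
    then have "smooth_fn (submfd M X) (U \<inter> (D \<inter> D')) (bracket (submfd M X) \<sigma> f g)"
      by (rule N.smooth_fn_subset) blast
    then show "\<exists>B. openin (mtop (submfd M X)) B \<and> x \<in> B \<and> smooth_fn (submfd M X) (U \<inter> B) (bracket (submfd M X) \<sigma> f g)"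
      using oD F(4) G(4) by blast
  qed
  then show "smooth_fun_on (submfd M X) U (bracket (submfd M X) \<sigma> f g)" by (simp add: smooth_fun_on_eq)
qed

text \<open>The three functions are extended to one open set A of M. Brackets of the extensions
  extend the brackets on X over E, so the comparison can be applied twice, first to the inner and
  then to the outer bracket.\<close>

lemma leaf_poisson_manifold:
  assumes P: "poisson_manifold M \<pi>" and X: "smooth_manifold (submfd M X)"
  shows "poisson_manifold (submfd M X) \<sigma>"
  unfolding poisson_manifold_def
proof (intro conjI allI impI ballI X leaf_smooth_bivector)
  fix U f g h x
  assume U: "openin (mtop (submfd M X)) U" "x \<in> U" and "smooth_fun_on (submfd M X) U f" "smooth_fun_on (submfd M X) U g"
    "smooth_fun_on (submfd M X) U h"
  then have f: "smooth_fn (submfd M X) U f" and g: "smooth_fn (submfd M X) U g" and h: "smooth_fn (submfd M X) U h"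
    by (simp_all add: smooth_fun_on_eq)
  obtain F B D where F: "openin (mtop M) B" "smooth_fn M B F" "openin (mtop (submfd M X)) D" "x \<in> D" "D \<subseteq> U \<inter> B"
    "\<And>y. y \<in> D \<Longrightarrow> F y = f y" by (rule local_extension[OF f U]) (rule that)
  obtain G B' D' where G: "openin (mtop M) B'" "smooth_fn M B' G" "openin (mtop (submfd M X)) D'" "x \<in> D'" "D' \<subseteq> U \<inter> B'"
    "\<And>y. y \<in> D' \<Longrightarrow> G y = g y" by (rule local_extension[OF g U]) (rule that)
  obtain H B'' D'' where H: "openin (mtop M) B''" "smooth_fn M B'' H" "openin (mtop (submfd M X)) D''" "x \<in> D''" "D'' \<subseteq> U \<inter> B''"
    "\<And>y. y \<in> D'' \<Longrightarrow> H y = h y" by (rule local_extension[OF h U]) (rule that)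
  define E where "E = D \<inter> D' \<inter> D''"
  define A where "A = B \<inter> B' \<inter> B''"
  have E: "openin (mtop (submfd M X)) E" "x \<in> E" "E \<subseteq> A"
    using F G H by (auto simp: E_def A_def)
  have A: "openin (mtop M) A" using F G H by (auto simp: A_def)
  have sF: "smooth_fn M A F" and sG: "smooth_fn M A G" and sH: "smooth_fn M A H"
    using F(2) G(2) H(2) by (auto simp: A_def elim!: M.smooth_fn_subset)
  have eq: "F y = f y" "G y = g y" "H y = h y" if "y \<in> E" for y using that F(6) G(6) H(6) by (auto simp: E_def)
  note sB = smooth_bivector_bracket[OF bivector A]
  have eqB: "bracket (submfd M X) \<sigma> f' g' y = bracket M \<pi> F' G' y"
    if "y \<in> E" "\<And>z. z \<in> E \<Longrightarrow> F' z = f' z" "\<And>z. z \<in> E \<Longrightarrow> G' z = g' z" "smooth_fn M A F'" "smooth_fn M A G'" for y f' g' F' G'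
    by (rule leaf_bracket_eq[OF E(1) that(1) _ _ smooth_on_open_at[OF A that(4)] smooth_on_open_at[OF A that(5)]])
      (use that(1-3) E(3) in auto)
  have J: "bracket M \<pi> F (bracket M \<pi> G H) x + bracket M \<pi> G (bracket M \<pi> H F) x + bracket M \<pi> H (bracket M \<pi> F G) x = 0"
    using P A sF sG sH E(2,3) unfolding poisson_manifold_def smooth_fun_on_eq by blast
  show "bracket (submfd M X) \<sigma> f (bracket (submfd M X) \<sigma> g h) x + bracket (submfd M X) \<sigma> g (bracket (submfd M X) \<sigma> h f) x +
      bracket (submfd M X) \<sigma> h (bracket (submfd M X) \<sigma> f g) x = 0"
    using J eqB[OF E(2) eq(1) eqB[OF _ eq(2,3) sG sH, symmetric] sF sB[OF sG sH]]
      eqB[OF E(2) eq(2) eqB[OF _ eq(3,1) sH sF, symmetric] sG sB[OF sH sF]]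
      eqB[OF E(2) eq(3) eqB[OF _ eq(1,2) sF sG, symmetric] sH sB[OF sF sG]] by simp
qed

lemma leaf_sharp:
  assumes y: "y \<in> X" and \<xi>: "\<xi> \<in> cotangent M y"
  shows "sharp (submfd M X) \<sigma> y (restr y \<xi>) \<in> tangent (submfd M X) y"
    "incl_push M y (sharp (submfd M X) \<sigma> y (restr y \<xi>)) = sharp M \<pi> y \<xi>"
proof -
  obtain u where u: "u \<in> tangent (submfd M X) y" "incl_push M y u = sharp M \<pi> y \<xi>" by (rule lift_sharp[OF y \<xi>])
  have "sharp (submfd M X) \<sigma> y (restr y \<xi>) = u"
  proof (rule N.sharp_eqI[OF leaf_smooth_bivector _ incl.pull_cotangent[OF \<xi>] u(1)])
    show "y \<in> pts (submfd M X)" using y by simp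
    fix \<beta> assume "\<beta> \<in> cotangent (submfd M X) y"
    then obtain \<eta> where \<eta>: "\<eta> \<in> cotangent M y" "\<beta> = restr y \<eta>" using y by (rule cotangent_extension)
    show "\<beta> u = \<sigma> y (restr y \<xi>) \<beta>"
      unfolding \<eta>(2) leaf_bivector_restr[OF y \<xi> \<eta>(1)] incl.pull_apply[OF u(1)] u(2) by (rule sharp_val[OF y \<xi> \<eta>(1)])
  qed
  then show "sharp (submfd M X) \<sigma> y (restr y \<xi>) \<in> tangent (submfd M X) y"
    "incl_push M y (sharp (submfd M X) \<sigma> y (restr y \<xi>)) = sharp M \<pi> y \<xi>" using u by simp_all
qed

text \<open>The vector v is the image of some \<zeta>, so \<alpha> v is up to sign the value of
  \<zeta> on the image of \<xi>, which is zero.\<close>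

lemma leaf_nondegenerate:
  assumes y: "y \<in> X" and \<alpha>: "\<alpha> \<in> cotangent (submfd M X) y"
    and z: "sharp (submfd M X) \<sigma> y \<alpha> = (\<lambda>f. 0)" and v: "v \<in> tangent (submfd M X) y"
  shows "\<alpha> v = 0"
proof -
  obtain \<xi> where \<xi>: "\<xi> \<in> cotangent M y" "\<alpha> = restr y \<xi>" by (rule cotangent_extension[OF \<alpha> y])
  obtain \<zeta> where \<zeta>: "\<zeta> \<in> cotangent M y" "incl_push M y v = sharp M \<pi> y \<zeta>" by (rule lower_tangent[OF v])
  have "sharp M \<pi> y \<xi> = incl_push M y (\<lambda>f. 0)" using leaf_sharp(2)[OF y \<xi>(1)] z \<xi>(2) by simp
  then have "sharp M \<pi> y \<xi> = (\<lambda>f. 0)" by (simp add: push_def)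
  then have "\<xi> (sharp M \<pi> y \<zeta>) = 0" using sharp_swap[OF y \<xi>(1) \<zeta>(1)] M.cotangent_at_zero[OF \<zeta>(1) in_pts[OF y]] by simp
  then show ?thesis unfolding \<xi>(2) incl.pull_apply[OF v] \<zeta>(2) .
qed

end

section \<open>Poisson submersions with Poisson fibres\<close>

locale poisson_fibration = submersion_atlas N M p
  for N :: "('a, 'e::euclidean_space) mfd" and M :: "('b, 'f::euclidean_space) mfd" and p +
  fixes \<pi>\<^sub>N :: "'a bivector" and \<pi>\<^sub>M :: "'b bivector"
  assumes bivN: "smooth_bivector N \<pi>\<^sub>N" and bivM: "smooth_bivector M \<pi>\<^sub>M"
    and poisson: "\<lbrakk>x \<in> pts N; \<xi> \<in> cotangent M (p x); \<eta> \<in> cotangent M (p x)\<rbrakk> \<Longrightarrow>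
      \<pi>\<^sub>N x (pull N M p x \<xi>) (pull N M p x \<eta>) = \<pi>\<^sub>M (p x) \<xi> \<eta>"
    and fibres: "poisson_fibres N \<pi>\<^sub>N p"
begin

lemma push_sharp_pull:
  assumes x: "x \<in> pts N" and \<zeta>: "\<zeta> \<in> cotangent M (p x)"
  shows "push M p x (sharp N \<pi>\<^sub>N x (pull N M p x \<zeta>)) = sharp M \<pi>\<^sub>M (p x) \<zeta>"
proof (rule M.sharp_eqI[OF bivM p_pts[OF x] \<zeta>, symmetric])
  note s = N.sharp_tangent[OF bivN x pull_cotangent[OF \<zeta>]]
  show "push M p x (sharp N \<pi>\<^sub>N x (pull N M p x \<zeta>)) \<in> tangent M (p x)" by (rule push_tangent[OF s])
  fix \<eta> assume \<eta>: "\<eta> \<in> cotangent M (p x)"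
  have "\<eta> (push M p x (sharp N \<pi>\<^sub>N x (pull N M p x \<zeta>))) = pull N M p x \<eta> (sharp N \<pi>\<^sub>N x (pull N M p x \<zeta>))"
    by (rule pull_apply[OF s, symmetric])
  also have "\<dots> = \<pi>\<^sub>N x (pull N M p x \<zeta>) (pull N M p x \<eta>)"
    by (rule N.sharp_apply[OF bivN x pull_cotangent[OF \<zeta>] pull_cotangent[OF \<eta>]])
  also have "\<dots> = \<pi>\<^sub>M (p x) \<zeta> \<eta>" by (rule poisson[OF x \<zeta> \<eta>])
  finally show "\<eta> (push M p x (sharp N \<pi>\<^sub>N x (pull N M p x \<zeta>))) = \<pi>\<^sub>M (p x) \<zeta> \<eta>" .
qed

text \<open>That the pullback of \<open>Gr(\<pi>\<^sub>N)\<close> to a fibre is a graph means that every covector on the fibre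
  extends to a covector \<open>\<xi>\<close> for which \<open>\<pi>\<^sub>N\<^sup>\<sharp>(\<xi>)\<close> is tangent to the fibre.\<close>

lemma vertical_decomposition:
  assumes x: "x \<in> pts N" and \<eta>: "\<eta> \<in> cotangent N x"
  obtains \<xi> \<zeta> where "\<xi> \<in> cotangent N x" "\<zeta> \<in> cotangent M (p x)"
    "push M p x (sharp N \<pi>\<^sub>N x \<xi>) = (\<lambda>f. 0)" "\<eta> = (\<lambda>v. 1 * \<xi> v + 1 * pull N M p x \<zeta> v)"
proof -
  let ?F = "{z \<in> pts N. p z = p x}"
  interpret F: submanifold N ?F by (rule fibre_submanifold[OF p_pts[OF x]])
  have xF: "x \<in> ?F" using x by simp
  have "poisson_dirac N \<pi>\<^sub>N ?F" using fibres x unfolding poisson_fibres_def by blast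
  then obtain \<pi>\<^sub>F where \<pi>\<^sub>F: "smooth_bivector (submfd N ?F) \<pi>\<^sub>F" "gr_pullback N \<pi>\<^sub>N ?F x = gr (submfd N ?F) \<pi>\<^sub>F x"
    unfolding poisson_dirac_def using xF by blast
  let ?r = "pull (submfd N ?F) N (\<lambda>y. y) x"
  \<comment> \<open>A graph contains a pair over every covector. Applied to the restriction of
    \<eta>, this produces \<xi> with the same restriction and with vertical image.\<close>
  have "(sharp (submfd N ?F) \<pi>\<^sub>F x (?r \<eta>), ?r \<eta>) \<in> gr (submfd N ?F) \<pi>\<^sub>F x"
    unfolding gr_def using F.incl.pull_cotangent[OF \<eta>] by blast
  then have "(sharp (submfd N ?F) \<pi>\<^sub>F x (?r \<eta>), ?r \<eta>) \<in> gr_pullback N \<pi>\<^sub>N ?F x" using \<pi>\<^sub>F(2) by simp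
  then obtain u \<xi> where u: "u \<in> tangent (submfd N ?F) x" and \<xi>: "\<xi> \<in> cotangent N x"
    and eq: "?r \<eta> = ?r \<xi>" "incl_push N x u = sharp N \<pi>\<^sub>N x \<xi>"
    unfolding gr_pullback_def by blast
  have vert: "sharp N \<pi>\<^sub>N x \<xi> \<in> tangent_sub N ?F x" unfolding tangent_sub_def eq(2)[symmetric] using u by (rule imageI)
  then have 1: "push M p x (sharp N \<pi>\<^sub>N x \<xi>) = (\<lambda>f. 0)" unfolding fibre_tangent_sub[OF x] by simp
  let ?d = "\<lambda>v. 1 * \<eta> v + (-1) * \<xi> v"
  have d: "?d \<in> cotangent N x" by (rule N.cotangent_combination[OF \<eta> \<xi>])
  \<comment> \<open>Vertical vectors come from the fibre, where the restrictions of \<eta> and \<xi>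
    agree; hence the difference descends to M.\<close>
  have ker: "?d v = 0" if v: "v \<in> tangent N x" "push M p x v = (\<lambda>f. 0)" for v
  proof -
    have "v \<in> tangent_sub N ?F x" unfolding fibre_tangent_sub[OF x] using v by simp
    then obtain w where w: "w \<in> tangent (submfd N ?F) x" "v = incl_push N x w"
      unfolding tangent_sub_def by (elim imageE)
    have "\<eta> v = \<xi> v" using fun_cong[OF eq(1), of w] unfolding w(2) F.incl.pull_apply[OF w(1)] .
    then show ?thesis by simp
  qed
  obtain \<zeta> where \<zeta>: "\<zeta> \<in> cotangent M (p x)" "?d = pull N M p x \<zeta>"
    by (rule cotangent_factors[OF d x onto[OF x] ker]) (assumption, assumption, rule that)
  have "\<eta> v = 1 * \<xi> v + 1 * pull N M p x \<zeta> v" for v using fun_cong[OF \<zeta>(2), of v] by simp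
  then have "\<eta> = (\<lambda>v. 1 * \<xi> v + 1 * pull N M p x \<zeta> v)" by (rule ext)
  with \<xi> \<zeta>(1) 1 show thesis by (rule that)
qed

text \<open>The vertical part \<xi> contributes nothing and the pullback part contributes
  \<open>sharp M\<close> of \<zeta>. A Poisson submersion alone does not behave like this: take the
  symplectic plane projected to a line with the zero bivector.\<close>

lemma push_sharp:
  assumes x: "x \<in> pts N" and \<eta>: "\<eta> \<in> cotangent N x"
  shows "push M p x (sharp N \<pi>\<^sub>N x \<eta>) \<in> sharp M \<pi>\<^sub>M (p x) ` cotangent M (p x)"
proof -
  obtain \<xi> \<zeta> where d: "\<xi> \<in> cotangent N x" "\<zeta> \<in> cotangent M (p x)"
    "push M p x (sharp N \<pi>\<^sub>N x \<xi>) = (\<lambda>f. 0)" "\<eta> = (\<lambda>v. 1 * \<xi> v + 1 * pull N M p x \<zeta> v)"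
    by (rule vertical_decomposition[OF x \<eta>]) (rule that)
  have "push M p x (sharp N \<pi>\<^sub>N x \<eta>) = sharp M \<pi>\<^sub>M (p x) \<zeta>"
    unfolding d(4) N.sharp_combination[OF bivN x d(1) pull_cotangent[OF d(2)]] push_combination d(3) push_sharp_pull[OF x d(2)]
    by simp
  then show ?thesis using d(2) by blast
qed

lemma preimage_poisson_submanifold:
  assumes mN: "smooth_manifold N" and mM: "smooth_manifold M" and L: "initial_submanifold M L"
    and leaf: "\<And>y. y \<in> L \<Longrightarrow> tangent_sub M L y = sharp M \<pi>\<^sub>M y ` cotangent M y"
  shows "poisson_submanifold N \<pi>\<^sub>N {x \<in> pts N. p x \<in> L}"
  unfolding poisson_submanifold_def
proof (intro conjI ballI subsetI)
  show "initial_submanifold N {x \<in> pts N. p x \<in> L}" by (rule preimage_initial[OF mN mM L])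
  fix x v assume "x \<in> {x \<in> pts N. p x \<in> L}" and v: "v \<in> sharp N \<pi>\<^sub>N x ` cotangent N x"
  then have x: "x \<in> pts N" "p x \<in> L" by auto
  obtain \<eta> where \<eta>: "\<eta> \<in> cotangent N x" "v = sharp N \<pi>\<^sub>N x \<eta>" using v by (elim imageE)
  have "push M p x v \<in> tangent_sub M L (p x)" unfolding \<eta>(2) leaf[OF x(2)] by (rule push_sharp[OF x(1) \<eta>(1)])
  then show "v \<in> tangent_sub N {x \<in> pts N. p x \<in> L} x"
    unfolding preimage_tangent_sub[OF initial_submanifold_locale[OF M.smooth_atlas_axioms L] x] \<eta>(2)
    using N.sharp_tangent[OF bivN x(1) \<eta>(1)] by simp
qed

end

locale poisson_fibration_leaves = poisson_fibration N M p \<pi>\<^sub>N \<pi>\<^sub>M + S: poisson_leaf N S \<pi>\<^sub>N + L: poisson_leaf M L \<pi>\<^sub>M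
  for N :: "('a, 'e::euclidean_space) mfd" and M :: "('b, 'f::euclidean_space) mfd" and p \<pi>\<^sub>N \<pi>\<^sub>M S L

section \<open>Estimates near a leaf\<close>

context smooth_atlas
begin

text \<open>Subtracting R (T u) from u = \<Phi> y, with R a right inverse of T, reaches a point u'
  of the zero set of T, where f vanishes. A Lipschitz bound for f between u and u' and the
  boundedness of R produce the factor \<open>norm (T (\<Phi> y))\<close>.\<close>

lemma vanishing_bound:
  fixes f :: "'a \<Rightarrow> real" and T :: "'e \<Rightarrow> 'f::euclidean_space"
  assumes c: "(U, \<Phi>) \<in> max_atlas M" "x \<in> U" and W: "subspace W" "openin (top_of_set W) (\<Phi> ` U)"
    and T: "linear T" "T (\<Phi> x) = 0" and B: "openin (mtop M) B" "x \<in> B" and f: "smooth_fn M B f"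
    and van: "\<And>y. y \<in> B \<Longrightarrow> y \<in> U \<Longrightarrow> T (\<Phi> y) = 0 \<Longrightarrow> f y = 0"
  shows "\<exists>D K. openin (mtop M) D \<and> x \<in> D \<and> K \<ge> 0 \<and> (\<forall>y\<in>D. \<bar>f y\<bar> \<le> K * norm (T (\<Phi> y)))"
proof -
  have "smooth_at M x f" using B f unfolding smooth_at_iff by blast
  then obtain V g B1 where V: "Cinf V g" "openin (mtop M) B1" "x \<in> B1" "B1 \<subseteq> U"
      "\<And>y. y \<in> B1 \<Longrightarrow> \<Phi> y \<in> V" "\<And>y. y \<in> B1 \<Longrightarrow> f y = g (\<Phi> y)"
    by (rule smooth_at_chartE[OF c]) (rule that)
  define B2 where "B2 = B \<inter> B1"
  have B2: "openin (mtop M) B2" "x \<in> B2" "B2 \<subseteq> U" using openin_Int[OF B(1) V(2)] B(2) V(3,4) by (auto simp: B2_def)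
  obtain T1 where T1: "open T1" "B2 \<inter> U = U \<inter> \<Phi> -` T1" by (rule open_max_preimage[OF c(1) B2(1)])
  obtain T2 where T2: "open T2" "\<Phi> ` U = W \<inter> T2" using W(2) unfolding openin_open by blast
  define z0 where "z0 = \<Phi> x"
  have z0W: "z0 \<in> W" using T2(2) c(2) by (auto simp: z0_def)
  have z0V: "z0 \<in> V" using V(5)[OF V(3)] by (simp add: z0_def)
  obtain r1 K1 where r1: "r1 > 0" "ball z0 r1 \<subseteq> V" "K1 \<ge> 0"
    "\<And>u u'. u \<in> ball z0 r1 \<Longrightarrow> u' \<in> ball z0 r1 \<Longrightarrow> norm (g u - g u') \<le> K1 * norm (u - u')"
    by (rule Cinf_locally_Lipschitz[OF V(1) z0V]) (rule that)
  have "z0 \<in> T1 \<inter> T2" using T1(2) T2(2) B2 c(2) by (auto simp: z0_def)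
  then obtain r2 where r2: "r2 > 0" "ball z0 r2 \<subseteq> T1 \<inter> T2"
    using open_Int[OF T1(1) T2(1)] open_contains_ball by blast
  obtain R where R: "linear R" "\<And>t. R t \<in> W" "\<And>t. t \<in> T ` W \<Longrightarrow> T (R t) = t"
    by (rule linear_section[OF W(1) linear_subspace_image[OF T(1) W(1)] T(1)]) (auto intro: that)
  obtain k where k: "k > 0" "\<And>t. norm (R t) \<le> norm t * k"
    using bounded_linear.pos_bounded[of R] R(1) linear_conv_bounded_linear by blast
  obtain k' where k': "k' > 0" "\<And>u. norm (T u) \<le> norm u * k'"
    using bounded_linear.pos_bounded[of T] T(1) linear_conv_bounded_linear by blast
  define \<rho> where "\<rho> = min r1 r2"
  have kk: "1 + k' * k \<ge> 1" using k(1) k'(1) by simp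
  \<comment> \<open>Passing from u to u' enlarges the distance to z0 at most by the factor
    \<open>1 + k' * k\<close>, so u' remains in the ball of radius \<rho>.\<close>
  let ?D = "U \<inter> \<Phi> -` ball z0 (\<rho> / (1 + k' * k))"
  have \<rho>: "\<rho> > 0" using r1(1) r2(1) by (simp add: \<rho>_def)
  then have \<rho>': "\<rho> / (1 + k' * k) > 0" using kk by simp
  have "\<bar>f y\<bar> \<le> (K1 * k) * norm (T (\<Phi> y))" if y: "y \<in> ?D" for y
  proof -
    define u where "u = \<Phi> y"
    define u' where "u' = u - R (T u)"
    have uW: "u \<in> W" using y T2(2) by (auto simp: u_def)
    have un: "norm (u - z0) < \<rho> / (1 + k' * k)" using y by (simp add: u_def dist_norm norm_minus_commute)
    have Tu: "T u = T (u - z0)" using T by (simp add: linear_diff z0_def)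
    have Rn: "norm (R (T u)) \<le> norm (u - z0) * (k' * k)"
    proof -
      have "norm (R (T u)) \<le> norm (T u) * k" by (rule k(2))
      also have "\<dots> \<le> (norm (u - z0) * k') * k" unfolding Tu using k(1) by (intro mult_right_mono k'(2)) simp
      finally show ?thesis by (simp add: mult.assoc)
    qed
    have "norm (u' - z0) \<le> norm (u - z0) + norm (R (T u))"
      using norm_triangle_ineq4[of "u - z0" "R (T u)"] by (simp add: u'_def algebra_simps)
    also have "\<dots> \<le> norm (u - z0) * (1 + k' * k)" using Rn by (simp add: algebra_simps)
    also have "\<dots> < \<rho>" using un kk by (simp add: pos_less_divide_eq)
    finally have u'n: "norm (u' - z0) < \<rho>" .
    have "norm (u - z0) * 1 \<le> norm (u - z0) * (1 + k' * k)" using kk by (intro mult_left_mono) auto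
    also have "\<dots> < \<rho>" using un kk by (simp add: pos_less_divide_eq)
    finally have un': "norm (u - z0) < \<rho>" by simp
    have balls: "w \<in> ball z0 r1" "w \<in> T1" "w \<in> T2" if "norm (w - z0) < \<rho>" for w
      using that r2(2) by (auto simp: \<rho>_def dist_norm norm_minus_commute subset_iff)
    have "u' \<in> W" unfolding u'_def using uW R(2) W(1) by (rule subspace_diff[rotated 1])
    then have "u' \<in> \<Phi> ` U" using T2(2) balls(3)[OF u'n] by blast
    then obtain y' where y': "y' \<in> U" "u' = \<Phi> y'" by (elim imageE)
    have y'B: "y' \<in> B2" using T1(2) y' balls(2)[OF u'n] by blast
    have yB: "y \<in> B2" using T1(2) y balls(2)[OF un'] unfolding u_def by blast
    have "T u' = 0" unfolding u'_def using R(3)[of "T u"] uW by (simp add: linear_diff[OF T(1)])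
    then have "g u' = 0" using van[of y'] y' y'B V(6)[of y'] by (simp add: B2_def)
    moreover have "f y = g u" using V(6)[of y] yB by (simp add: B2_def u_def)
    ultimately have "\<bar>f y\<bar> \<le> K1 * norm (u - u')" using r1(4)[OF balls(1)[OF un'] balls(1)[OF u'n]] by simp
    also have "\<dots> \<le> K1 * (norm (T u) * k)"
      using k(2)[of "T u"] by (intro mult_left_mono r1(3)) (simp add: u'_def)
    finally show ?thesis by (simp add: u_def mult_ac)
  qed
  moreover have "openin (mtop M) ?D" by (rule max_open_preimage[OF c(1) open_ball])
  moreover have "x \<in> ?D" using c(2) \<rho>' by (simp add: z0_def)
  moreover have "K1 * k \<ge> 0" using r1(3) k(1) by simp
  ultimately show ?thesis by blast
qed

lemma differential_coord:
  assumes c: "(U, \<phi>) \<in> max_atlas M" "x \<in> U"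
  shows "differential M (\<lambda>z. \<phi> z \<bullet> a) x = (\<lambda>v. \<Sum>d\<in>Basis. (a \<bullet> d) * differential M (\<lambda>z. \<phi> z \<bullet> d) x v)"
proof (rule cotangent_eqI[OF differential_cotangent cotangent_sum[OF differential_cotangent]])
  fix v assume v: "v \<in> tangent M x"
  have "coord \<phi> v \<bullet> a = (\<Sum>d\<in>Basis. (a \<bullet> d) * (coord \<phi> v \<bullet> d))"
    by (subst euclidean_inner) (simp add: mult.commute)
  then show "differential M (\<lambda>z. \<phi> z \<bullet> a) x v = (\<Sum>d\<in>Basis. (a \<bullet> d) * differential M (\<lambda>z. \<phi> z \<bullet> d) x v)"
    by (simp add: differential_apply[OF v] coord_inner[OF c v])
qed

lemma bracket_coord:
  assumes \<pi>: "smooth_bivector M \<pi>" and c: "(U, \<phi>) \<in> max_atlas M" "x \<in> U"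
  shows "bracket M \<pi> (\<lambda>z. \<phi> z \<bullet> a) g x = (\<Sum>d\<in>Basis. (a \<bullet> d) * bracket M \<pi> (\<lambda>z. \<phi> z \<bullet> d) g x)"
proof -
  have x: "x \<in> pts M" using c max_sub by blast
  show ?thesis unfolding bracket_def differential_coord[OF c, of a]
    by (rule bivector_sum[OF \<pi> x differential_cotangent differential_cotangent])
qed

lemma sharp_differential:
  assumes \<pi>: "smooth_bivector M \<pi>" and x: "x \<in> pts M"
  shows "sharp M \<pi> x (differential M f x) g = bracket M \<pi> f g x"
  using sharp_apply[OF \<pi> x differential_cotangent[of f] differential_cotangent[of g]]
    differential_apply[OF sharp_tangent[OF \<pi> x differential_cotangent[of f]], of g] by (simp add: bracket_def)

end

context poisson_leaf
begin

text \<open>By nondegeneracy of the leaf bivector at \<open>x\<close> and its continuity.\<close>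

lemma bounded_covectors:
  assumes c: "(C, \<phi>) \<in> max_atlas (submfd M X)" "x \<in> C"
  obtains D m where "openin (mtop (submfd M X)) D" "x \<in> D" "D \<subseteq> C" "m > 0"
    "\<And>y v. y \<in> D \<Longrightarrow> v \<in> tangent (submfd M X) y \<Longrightarrow>
      \<exists>a. norm a \<le> m * norm (coord \<phi> v) \<and> v = sharp (submfd M X) \<sigma> y (differential (submfd M X) (\<lambda>z. \<phi> z \<bullet> a) y)"
proof -
  note biv = leaf_smooth_bivector
  obtain W where W: "subspace W" "openin (top_of_set W) (\<phi> ` C)" using N.max_space[OF c(1)] by blast
  define \<beta> where "\<beta> d e = bracket (submfd M X) \<sigma> (\<lambda>z. \<phi> z \<bullet> d) (\<lambda>z. \<phi> z \<bullet> e)" for d e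
  \<comment> \<open>The Hamiltonian vector at y of the linear coordinate with coefficients a. In
    coordinates it depends linearly on a, with the Poisson brackets \<open>\<beta> d e y\<close> as
    matrix.\<close>
  define S where "S y a = sharp (submfd M X) \<sigma> y (differential (submfd M X) (\<lambda>z. \<phi> z \<bullet> a) y)" for y a
  have Cpts: "y \<in> pts (submfd M X)" if "y \<in> C" for y using that N.max_sub[OF c(1)] by blast
  have S: "S y a \<in> tangent (submfd M X) y" if "y \<in> C" for y a
    unfolding S_def by (rule N.sharp_tangent[OF biv Cpts[OF that] N.differential_cotangent])
  have cS: "coord \<phi> (S y a) = (\<Sum>e\<in>Basis. \<Sum>d\<in>Basis. ((a \<bullet> d) * \<beta> d e y) *\<^sub>R e)" if y: "y \<in> C" for y a
    unfolding coord_def S_def N.sharp_differential[OF biv Cpts[OF y]] N.bracket_coord[OF biv c(1) y, of a]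
    by (simp add: \<beta>_def scaleR_sum_left)
  have lin: "linear (\<lambda>a. coord \<phi> (S y a))" if y: "y \<in> C" for y
    unfolding cS[OF y]
    by (intro linear_compose_sum ballI linearI) (simp_all add: inner_add_left algebra_simps)
  have inW: "coord \<phi> (S y a) \<in> W" if y: "y \<in> C" for y a
    by (rule N.coord_in_subspace[OF c(1) y W(1) openin_imp_subset[OF W(2)] S[OF y]])
  \<comment> \<open>Injectivity is claimed on W only, since coefficients orthogonal to W define the
    zero function on C. On W it follows from nondegeneracy, and finite dimension turns it into a
    lower bound e0.\<close>
  have "\<exists>e>0. \<forall>a\<in>W. norm (coord \<phi> (S x a)) \<ge> e * norm a"
  proof (rule injective_imp_isometric[OF closed_subspace[OF W(1)] W(1)])
    show "bounded_linear (\<lambda>a. coord \<phi> (S x a))" using lin[OF c(2)] by (simp add: linear_conv_bounded_linear)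
    show "\<forall>a\<in>W. coord \<phi> (S x a) = 0 \<longrightarrow> a = 0"
    proof (intro ballI impI)
      fix a assume a: "a \<in> W" "coord \<phi> (S x a) = 0"
      have xX: "x \<in> X" using Cpts[OF c(2)] by simp
      have "coord \<phi> (S x a) = coord \<phi> (\<lambda>f. 0)" using a(2) by (simp add: coord_def)
      then have "S x a = (\<lambda>f. 0)" by (rule N.tangent_eqI[OF c S[OF c(2)] N.tangent_zero[OF Cpts[OF c(2)]]])
      then have z: "differential (submfd M X) (\<lambda>z. \<phi> z \<bullet> a) x v = 0" if "v \<in> tangent (submfd M X) x" for v
        using leaf_nondegenerate[OF xX N.differential_cotangent _ that] unfolding S_def by blast
      obtain v where v: "v \<in> tangent (submfd M X) x" "coord \<phi> v = a" by (rule N.tangent_exists[OF c W a(1)])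
      have "a \<bullet> a = 0" using z[OF v(1)] N.differential_apply[OF v(1)] N.coord_inner[OF c v(1), of a] v(2) by simp
      then show "a = 0" by simp
    qed
  qed
  then obtain e0 where e0: "e0 > 0" "\<And>a. a \<in> W \<Longrightarrow> norm (coord \<phi> (S x a)) \<ge> e0 * norm a" by blast
  define n where "n = real DIM('e)"
  have n: "n > 0" by (simp add: n_def)
  \<comment> \<open>On D each entry of the bracket matrix differs by at most \<epsilon> from its
    value at x. Summed over n * n entries the change is at most \<open>e0 / 2 * norm a\<close>, half
    of the lower bound at x.\<close>
  define \<epsilon> where "\<epsilon> = e0 / (2 * n * n)"
  have \<epsilon>: "\<epsilon> > 0" using e0(1) n by (simp add: \<epsilon>_def)
  have sm: "smooth_fn (submfd M X) C (\<lambda>z. \<phi> z \<bullet> a)" for a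
    by (rule N.smooth_fn_compose[OF N.smooth_fn_coord[OF c(1)] smooth_on_linear[of "\<lambda>z. z \<bullet> a" UNIV]])
      (auto intro: bounded_linear.linear bounded_linear_inner_left)
  have s\<beta>: "smooth_fn (submfd M X) C (\<beta> d e)" for d e
    unfolding \<beta>_def by (rule smooth_bivector_bracket[OF biv N.max_open[OF c(1)] sm sm])
  define D where "D = (\<Inter>(d, e)\<in>Basis \<times> Basis. C \<inter> \<beta> d e -` ball (\<beta> d e x) \<epsilon>)"
  have D: "openin (mtop (submfd M X)) D"
    unfolding D_def
    by (rule openin_INT2)
      (auto intro: N.smooth_fn_open_preimage[OF s\<beta> N.max_open[OF c(1)] open_ball] simp: nonempty_Basis)
  have xD: "x \<in> D" using c(2) \<epsilon> by (auto simp: D_def)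
  obtain b0 :: 'e where "b0 \<in> Basis" using nonempty_Basis by blast
  then have DC: "D \<subseteq> C" unfolding D_def by auto
  have bound: "e0 / 2 * norm a \<le> norm (coord \<phi> (S y a))" if y: "y \<in> D" and a: "a \<in> W" for y a
  proof -
    have yC: "y \<in> C" using y DC by blast
    have \<Delta>: "\<bar>\<beta> d e y - \<beta> d e x\<bar> \<le> \<epsilon>" if "d \<in> Basis" "e \<in> Basis" for d e
      using y that by (fastforce simp: D_def dist_real_def abs_minus_commute)
    have "coord \<phi> (S y a) - coord \<phi> (S x a) = (\<Sum>e\<in>Basis. \<Sum>d\<in>Basis. ((a \<bullet> d) * (\<beta> d e y - \<beta> d e x)) *\<^sub>R e)"
      unfolding cS[OF yC] cS[OF c(2)] sum_subtractf[symmetric] scaleR_left_diff_distrib[symmetric] right_diff_distrib[symmetric] ..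
    also have "norm \<dots> \<le> (\<Sum>e\<in>(Basis::'e set). \<Sum>d\<in>(Basis::'e set). norm a * \<epsilon>)"
    proof (rule order_trans[OF norm_sum], rule sum_mono, rule order_trans[OF norm_sum], rule sum_mono)
      fix e d :: 'e assume b: "e \<in> Basis" "d \<in> Basis"
      have "norm (((a \<bullet> d) * (\<beta> d e y - \<beta> d e x)) *\<^sub>R e) = \<bar>a \<bullet> d\<bar> * \<bar>\<beta> d e y - \<beta> d e x\<bar>"
        using b by (simp add: abs_mult)
      also have "\<dots> \<le> norm a * \<epsilon>" by (intro mult_mono Basis_le_norm \<Delta> b) auto
      finally show "norm (((a \<bullet> d) * (\<beta> d e y - \<beta> d e x)) *\<^sub>R e) \<le> norm a * \<epsilon>" .
    qed
    also have "\<dots> = e0 / 2 * norm a" using n by (simp add: \<epsilon>_def n_def[symmetric])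
    finally have "norm (coord \<phi> (S y a) - coord \<phi> (S x a)) \<le> e0 / 2 * norm a" .
    moreover have "norm (coord \<phi> (S x a)) \<le> norm (coord \<phi> (S y a)) + norm (coord \<phi> (S y a) - coord \<phi> (S x a))"
      using norm_triangle_ineq4[of "coord \<phi> (S y a)" "coord \<phi> (S y a) - coord \<phi> (S x a)"] by simp
    ultimately show ?thesis using e0(2)[OF a] by linarith
  qed
  have "\<exists>a. norm a \<le> 2 / e0 * norm (coord \<phi> v) \<and> v = S y a" if y: "y \<in> D" and v: "v \<in> tangent (submfd M X) y" for y v
  proof -
    have yC: "y \<in> C" using y DC by blast
    let ?f = "\<lambda>a. coord \<phi> (S y a)"
    have inj: "inj_on ?f W"
    proof (rule inj_onI)
      fix a a' assume a: "a \<in> W" "a' \<in> W" "?f a = ?f a'"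
      have "?f (a - a') = 0" using a(3) linear_diff[OF lin[OF yC]] by simp
      then have "e0 / 2 * norm (a - a') \<le> 0" using bound[OF y subspace_diff[OF W(1) a(1,2)]] by simp
      then show "a = a'" using e0(1) by (simp add: mult_le_0_iff)
    qed
    \<comment> \<open>An injective linear map of W into itself is onto, so each tangent vector at y
      is Hamiltonian for some a in W, and the lower bound controls the size of a.\<close>
    have "?f ` W = W"
    proof (rule subspace_dim_equal[OF linear_subspace_image[OF lin[OF yC] W(1)] W(1)])
      show "?f ` W \<subseteq> W" using inW[OF yC] by blast
      have "dim (?f ` W) = dim W"
        by (rule dim_image_eq[OF lin[OF yC]]) (use inj W(1) in \<open>simp add: span_eq_iff[THEN iffD2]\<close>)
      then show "dim W \<le> dim (?f ` W)" by simp
    qed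
    moreover have "coord \<phi> v \<in> W" by (rule N.coord_in_subspace[OF c(1) yC W(1) openin_imp_subset[OF W(2)] v])
    ultimately have "coord \<phi> v \<in> ?f ` W" by simp
    then obtain a where a: "a \<in> W" "coord \<phi> v = coord \<phi> (S y a)" by (elim imageE)
    have "v = S y a" by (rule N.tangent_eqI[OF c(1) yC v S[OF yC] a(2)])
    moreover have "norm a \<le> 2 / e0 * norm (coord \<phi> v)"
      using bound[OF y a(1)] e0(1) by (simp add: a(2) field_simps)
    ultimately show ?thesis by blast
  qed
  moreover have "2 / e0 > 0" using e0(1) by simp
  ultimately show thesis using that[OF D xD DC] unfolding S_def by blast
qed

end

context poisson_fibration_leaves
begin

text \<open>Along a curve in \<open>S\<close>, a coordinate \<open>h\<close> transverse to \<open>L\<close> satisfies \<open>\<bar>h'\<bar> \<le> K \<bar>h\<bar>\<close>: its derivative is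
  a bounded combination of brackets of \<open>h\<close>, which vanish where \<open>h\<close> does because \<open>p\<^sub>*\<close> maps
  the image of \<open>\<pi>\<^sub>N\<^sup>\<sharp>\<close> into \<open>TL\<close>.\<close>

lemma leaf_preimage_local:
  assumes x0: "x0 \<in> S" "p x0 \<in> L"
  obtains D where "openin (mtop (submfd N S)) D" "x0 \<in> D" "p ` D \<subseteq> L"
proof -
  have x0N: "x0 \<in> pts N" using S.sub x0(1) by blast
  obtain V \<psi> C W' where ad: "adapted M L V \<psi> C W'" "p x0 \<in> C" using L.adapted_at[OF x0(2)] by blast
  note c = L.adaptedD[OF ad(1)]
  have px: "p x0 \<in> V" using ad(2) c(4) by blast
  obtain W1 where W1: "subspace W1" "openin (top_of_set W1) (\<psi> ` V)" using M.max_space[OF c(2)] by blast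
  obtain U \<Phi> A B W r where U: "(U, \<Phi>) \<in> max_atlas N" "x0 \<in> U" "p ` U \<subseteq> V" "linear A" "subspace W" "r > 0"
    "\<Phi> ` U = W \<inter> ball (\<Phi> x0) r" "\<And>y. y \<in> U \<Longrightarrow> \<psi> (p y) = A (\<Phi> y)" "\<And>w. A w \<in> W1"
    "linear B" "\<And>v. B v \<in> W" "\<And>w. w \<in> W1 \<Longrightarrow> A (B w) = w"
    by (rule submersion_chart[OF x0N c(2) px W1]) (rule that)
  have \<Phi>U: "openin (top_of_set W) (\<Phi> ` U)" unfolding U(7) by (auto simp: openin_open)
  obtain P where P: "linear P" "\<And>v. P v \<in> W'" "\<And>w. w \<in> W' \<Longrightarrow> P w = w"
    by (rule linear_projection[OF c(3)]) (rule that)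
  \<comment> \<open>T removes from A the component in W'. Inside U the slice C of L is therefore the
    zero set of \<open>T (\<Phi> y)\<close>, whose components are the coordinates transverse to
    L.\<close>
  define T where "T z = A z - P (A z)" for z
  have T: "linear T" unfolding T_def[abs_def]
    using linear_compose_sub[OF U(4) linear_compose[OF U(4) P(1)]] by (simp add: o_def)
  have T0: "T z = 0 \<longleftrightarrow> A z \<in> W'" for z
    unfolding T_def using P(2)[of "A z"] P(3)[of "A z"] by auto
  have pC: "p y \<in> C \<longleftrightarrow> T (\<Phi> y) = 0" if y: "y \<in> U" for y
  proof -
    have "p y \<in> V" using U(3) y by blast
    then show ?thesis using c(6)[of "p y"] U(8)[OF y] T0 by simp
  qed
  obtain US \<phi> CS WS where adS: "adapted N S US \<phi> CS WS" "x0 \<in> CS" using S.adapted_at[OF x0(1)] by blast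
  note cS = S.adaptedD[OF adS(1)]
  have x0US: "x0 \<in> US" using adS(2) cS(4) by blast
  define h where "h b y = T (\<Phi> y) \<bullet> b" for b y
  \<comment> \<open>Through the adjoint, \<open>h b\<close> becomes a linear coordinate of the chart
    \<Phi>, as required by \<open>coord_inner\<close> and \<open>smooth_at_inner\<close>.\<close>
  have lin_h: "h b = (\<lambda>y. \<Phi> y \<bullet> adjoint T b)" for b
    unfolding h_def[abs_def] by (rule ext) (rule adjoint_works[OF T, symmetric])
  have inner_lin: "linear (\<lambda>z. z \<bullet> a)" for a :: 'e
    by (rule bounded_linear.linear[OF bounded_linear_inner_left])
  have sh: "smooth_fn N U (h b)" for b
    unfolding lin_h by (rule N.smooth_fn_compose[OF N.smooth_fn_coord[OF U(1)] smooth_on_linear[OF inner_lin, of UNIV]]) simp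
  have s\<phi>: "smooth_fn N US (\<lambda>z. \<phi> z \<bullet> d)" for d
    by (rule N.smooth_fn_compose[OF N.smooth_fn_coord[OF cS(2)] smooth_on_linear[OF inner_lin, of UNIV]]) simp
  have UUS: "openin (mtop N) (U \<inter> US)" by (rule openin_Int[OF N.max_open[OF U(1)] N.max_open[OF cS(2)]])
  \<comment> \<open>The brackets are formed in N and not on the leaf S:
    \<open>vanishing_bound\<close> needs a function on an open set of N in the chart \<Phi>, which
    is adapted to p, while the covectors along S are controlled in the chart \<phi>.\<close>
  define G where "G d b = bracket N \<pi>\<^sub>N (\<lambda>z. \<phi> z \<bullet> d) (h b)" for d b
  have sG: "smooth_fn N (U \<inter> US) (G d b)" for d b
    unfolding G_def
    by (rule smooth_bivector_bracket[OF bivN UUS N.smooth_fn_subset[OF s\<phi>] N.smooth_fn_subset[OF sh]]) auto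
  have van: "G d b y = 0" if y: "y \<in> U \<inter> US" "y \<in> U" "T (\<Phi> y) = 0" for d b y
  proof -
    have yN: "y \<in> pts N" using y(2) N.max_sub[OF U(1)] by blast
    have yC: "p y \<in> C" using pC[OF y(2)] y(3) by simp
    then have yL: "p y \<in> L" "p y \<in> V" using c(4,5) by blast+
    let ?v = "sharp N \<pi>\<^sub>N y (differential N (\<lambda>z. \<phi> z \<bullet> d) y)"
    have v: "?v \<in> tangent N y" by (rule N.sharp_tangent[OF bivN yN N.differential_cotangent])
    have "push M p y ?v \<in> tangent_sub M L (p y)"
      unfolding L.leaf[OF yL(1)] by (rule push_sharp[OF yN N.differential_cotangent])
    then have "coord \<psi> (push M p y ?v) \<in> W'" unfolding L.tangent_sub_chart[OF ad(1) yC] by simp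
    then have "A (coord \<Phi> ?v) \<in> W'" using coord_push[OF U(1) y(2) c(2) yL(2) U(4,8) v] by simp
    then have z: "T (coord \<Phi> ?v) = 0" using T0 by simp
    have "G d b y = ?v (h b)" unfolding G_def by (rule N.sharp_differential[OF bivN yN, symmetric])
    also have "\<dots> = coord \<Phi> ?v \<bullet> adjoint T b" unfolding lin_h by (rule N.coord_inner[OF U(1) y(2) v])
    also have "\<dots> = T (coord \<Phi> ?v) \<bullet> b" by (rule adjoint_works[OF T])
    finally show ?thesis using z by simp
  qed
  have "\<exists>D K. openin (mtop N) D \<and> x0 \<in> D \<and> K \<ge> 0 \<and> (\<forall>y\<in>D. \<bar>G d b y\<bar> \<le> K * norm (T (\<Phi> y)))" for d b
    by (rule N.vanishing_bound[OF U(1,2,5) \<Phi>U T _ UUS _ sG van]) (use pC[OF U(2)] ad(2) U(2) x0US in auto)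
  then obtain D0 K0 where D0: "\<And>d b. openin (mtop N) (D0 d b)" "\<And>d b. x0 \<in> D0 d b" "\<And>d b. (K0 d b :: real) \<ge> 0"
    "\<And>d b y. y \<in> D0 d b \<Longrightarrow> \<bar>G d b y\<bar> \<le> K0 d b * norm (T (\<Phi> y))"
    by metis
  define D1 where "D1 = (\<Inter>(d, b)\<in>Basis \<times> Basis. D0 d b) \<inter> (U \<inter> US)"
  have "openin (mtop N) (\<Inter>(d, b)\<in>Basis \<times> Basis. D0 d b)"
    by (rule openin_INT2) (use D0(1) in \<open>auto simp: nonempty_Basis\<close>)
  then have D1: "openin (mtop N) D1" "x0 \<in> D1"
    unfolding D1_def using UUS U(2) x0US D0(2) by (auto intro: openin_Int)
  obtain D2 m where D2: "openin (mtop (submfd N S)) D2" "x0 \<in> D2" "D2 \<subseteq> CS" "m > 0"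
    "\<And>y v. y \<in> D2 \<Longrightarrow> v \<in> tangent (submfd N S) y \<Longrightarrow>
      \<exists>a. norm a \<le> m * norm (coord \<phi> v) \<and> v = sharp (submfd N S) S.\<sigma> y (differential (submfd N S) (\<lambda>z. \<phi> z \<bullet> a) y)"
    by (rule S.bounded_covectors[OF cS(1) adS(2)]) (rule that)
  define D3 where "D3 = D2 \<inter> (S \<inter> D1)"
  have D3: "openin (mtop (submfd N S)) D3" "x0 \<in> D3"
    unfolding D3_def using openin_Int[OF D2(1) S.open_trace[OF D1(1)]] D2(2) D1(2) x0(1) by auto
  obtain E where E: "openin (mtop (submfd N S)) E" "x0 \<in> E" "E \<subseteq> D3"
      "\<And>y. y \<in> E \<Longrightarrow> y \<in> smooth_component (submfd N S) E x0"
    by (rule S.N.ball_component[OF D3]) (rule that)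
  have "p y \<in> L" if y: "y \<in> E" for y
  proof -
    obtain d where d: "smooth_curve (submfd N S) d" "range d \<subseteq> E" "d 0 = x0" "d 1 = y"
      using E(4)[OF y] unfolding smooth_component_def by blast
    have dE: "d t \<in> E" for t using d(2) by blast
    have dD: "d t \<in> D2" "d t \<in> S" "d t \<in> D1" "d t \<in> U" "d t \<in> US" "d t \<in> CS" for t
      using dE[of t] E(3) D2(3) unfolding D3_def D1_def by blast+
    have dN: "smooth_curve N d" using S.incl.smooth_curve_image[OF d(1)] .
    define \<gamma> where "\<gamma> t = \<phi> (d t)" for t
    have "d -` CS = UNIV" "d -` U = UNIV" using dD by blast+
    then have C\<gamma>: "Cinf UNIV \<gamma>" and Ch: "Cinf UNIV (\<lambda>t. T (\<Phi> (d t)))"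
      using smooth_curve_fn[OF d(1) S.N.smooth_atlas_axioms S.N.smooth_fn_coord[OF cS(1)]] smooth_on_open[of UNIV]
        smooth_on_linear_compose[OF T smooth_curve_fn[OF dN N.smooth_atlas_axioms N.smooth_fn_coord[OF U(1)]]]
      unfolding \<gamma>_def[abs_def] by auto
    have vd: "(f has_vector_derivative frechet_derivative f (at t) 1) (at t)" if "Cinf UNIV f" for f :: "real \<Rightarrow> 'x::euclidean_space" and t
    proof -
      have D: "(f has_derivative frechet_derivative f (at t)) (at t)" using Cinf_has_derivative[OF that] by simp
      have "frechet_derivative f (at t) s = s *\<^sub>R frechet_derivative f (at t) 1" for s
        using linear_cmul[OF has_derivative_linear[OF D], of s 1] by simp
      then have "frechet_derivative f (at t) = (\<lambda>s. s *\<^sub>R frechet_derivative f (at t) 1)" by (rule ext)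
      then show ?thesis unfolding has_vector_derivative_def by (rule has_derivative_eq_rhs[OF D])
    qed
    have shift: "((\<lambda>s. f (t + s)) has_vector_derivative w) (at 0)"
      if "(f has_vector_derivative w) (at t)" for f :: "real \<Rightarrow> 'x::euclidean_space" and t w
    proof -
      have "((\<lambda>s. t + s) has_vector_derivative 1) (at 0)"
        by (auto intro!: derivative_eq_intros)
      from vector_diff_chain_at[OF this, of f w] that show ?thesis by (simp add: o_def)
    qed
    \<comment> \<open>The bound Q for the speed depends on the curve. This does no harm, because the
      differential inequality forces h to vanish whatever its constant is.\<close>
    have "continuous_on {0..1} (\<lambda>t. frechet_derivative \<gamma> (at t) 1)"
      using Cinf_continuous_on[OF Cinf_frechet_derivative[OF C\<gamma>]] by (rule continuous_on_subset) simp
    then have "bounded ((\<lambda>t. frechet_derivative \<gamma> (at t) 1) ` {0..1})"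
      by (intro compact_imp_bounded compact_continuous_image) auto
    then obtain Q where "\<forall>w\<in>(\<lambda>t. frechet_derivative \<gamma> (at t) 1) ` {0..1}. norm w \<le> Q" unfolding bounded_iff ..
    then have Q: "norm (frechet_derivative \<gamma> (at t) 1) \<le> Q" if "0 \<le> t" "t \<le> 1" for t using that by simp
    have "T (\<Phi> (d 1)) = 0"
    proof (rule differential_inequality_zero[where h = "\<lambda>t. T (\<Phi> (d t))", OF vd[OF Ch]])
      show "T (\<Phi> (d 0)) = 0" using pC[OF U(2)] ad(2) d(3) by simp
      fix t :: real assume t: "0 \<le> t" "t \<le> 1"
      let ?h' = "frechet_derivative (\<lambda>t. T (\<Phi> (d t))) (at t) 1"
      \<comment> \<open>Velocities are taken at time 0, so the curve is shifted to reach its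
        velocity at time t.\<close>
      let ?d = "\<lambda>s. d (t + s)"
      have d': "smooth_curve (submfd N S) ?d"
        by (rule smooth_curve_reparam[OF d(1) S.N.smooth_atlas_axioms]) (intro smooth_on_add smooth_on_const smooth_on_id)
      define v where "v = velocity (submfd N S) ?d"
      have v: "v \<in> tangent (submfd N S) (d t)" unfolding v_def tangent_def using d' by (intro CollectI exI[of _ ?d]) simp
      have "((\<lambda>s. \<phi> (?d s)) has_vector_derivative coord \<phi> v) (at 0)"
        unfolding v_def by (rule S.N.velocity_chart[OF cS(1) d']) (simp add: dD)
      then have cv: "coord \<phi> v = frechet_derivative \<gamma> (at t) 1"
        using shift[OF vd[OF C\<gamma>]] unfolding \<gamma>_def by (rule vector_derivative_unique_at)
      obtain a where a: "norm a \<le> m * norm (coord \<phi> v)"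
        "v = sharp (submfd N S) S.\<sigma> (d t) (differential (submfd N S) (\<lambda>z. \<phi> z \<bullet> a) (d t))"
        using D2(5)[OF dD(1) v] by blast
      have an: "norm a \<le> m * Q"
        using a(1) Q[OF t] D2(4) unfolding cv by (meson mult_left_mono less_imp_le order_trans)
      \<comment> \<open>The velocity v is Hamiltonian on the leaf for the coordinate with
        coefficients a, so the derivative of \<open>h b\<close> is a leaf bracket. It equals the
        bracket of the same functions in N, and this is linear in a.\<close>
      have hb: "?h' \<bullet> b = (\<Sum>e\<in>Basis. (a \<bullet> e) * G e b (d t))" for b
      proof -
        have smN: "smooth_at N (d t) (h b)" unfolding lin_h by (rule N.smooth_at_inner[OF U(1) dD(4)])
        have sm: "smooth_at (submfd N S) (d t) (h b)"
          using S.incl.smooth_at_compose[OF _ smN] dD(2) by simp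
        have "((\<lambda>s. T (\<Phi> (d (t + s))) \<bullet> b) has_vector_derivative ?h' \<bullet> b) (at 0)"
          by (rule bounded_linear.has_vector_derivative[OF bounded_linear_inner_left shift[OF vd[OF Ch]]])
        then have "deriv (\<lambda>s. h b (?d s)) 0 = ?h' \<bullet> b"
          by (simp add: h_def has_real_derivative_iff_has_vector_derivative DERIV_imp_deriv)
        then have "?h' \<bullet> b = v (h b)" unfolding v_def velocity_def using sm by simp
        also have "\<dots> = bracket (submfd N S) S.\<sigma> (\<lambda>z. \<phi> z \<bullet> a) (h b) (d t)"
          unfolding a(2) by (rule S.N.sharp_differential[OF S.leaf_smooth_bivector]) (use dD(2) in simp)
        also have "\<dots> = bracket N \<pi>\<^sub>N (\<lambda>z. \<phi> z \<bullet> a) (h b) (d t)"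
          by (rule S.leaf_bracket_eq[OF E(1) dE refl refl N.smooth_at_inner[OF cS(2) dD(5)] smN])
        also have "\<dots> = (\<Sum>e\<in>Basis. (a \<bullet> e) * G e b (d t))"
          unfolding G_def by (rule N.bracket_coord[OF bivN cS(2) dD(5)])
        finally show ?thesis .
      qed
      have "norm ?h' \<le> (\<Sum>b\<in>Basis. \<bar>?h' \<bullet> b\<bar>)" by (rule norm_le_l1)
      also have "\<dots> \<le> (\<Sum>b\<in>Basis. \<Sum>e\<in>Basis. norm a * (K0 e b * norm (T (\<Phi> (d t)))))"
        unfolding hb
      proof (rule sum_mono, rule order_trans[OF sum_abs], rule sum_mono)
        fix b :: 'f and e :: 'e assume b: "b \<in> Basis" "e \<in> Basis"
        have "d t \<in> D0 e b" using dD(3)[of t] b unfolding D1_def by auto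
        then have "\<bar>a \<bullet> e\<bar> * \<bar>G e b (d t)\<bar> \<le> norm a * (K0 e b * norm (T (\<Phi> (d t))))"
          by (intro mult_mono Basis_le_norm b D0(4)) auto
        then show "\<bar>(a \<bullet> e) * G e b (d t)\<bar> \<le> norm a * (K0 e b * norm (T (\<Phi> (d t))))" by (simp add: abs_mult)
      qed
      also have "\<dots> = norm a * ((\<Sum>b\<in>Basis. \<Sum>e\<in>Basis. K0 e b) * norm (T (\<Phi> (d t))))"
        by (simp add: sum_distrib_left sum_distrib_right mult_ac)
      also have "\<dots> \<le> (m * Q) * ((\<Sum>b\<in>Basis. \<Sum>e\<in>Basis. K0 e b) * norm (T (\<Phi> (d t))))"
        by (rule mult_right_mono[OF an]) (intro mult_nonneg_nonneg sum_nonneg D0(3) norm_ge_zero)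
      finally show "norm ?h' \<le> (m * Q * (\<Sum>b\<in>Basis. \<Sum>e\<in>Basis. K0 e b)) * norm (T (\<Phi> (d t)))"
        by (simp only: mult.assoc)
    qed
    then have "p y \<in> C" using pC[OF dD(4)[of 1]] d(4) by simp
    then show ?thesis using c(5) by blast
  qed
  then have "p ` E \<subseteq> L" by blast
  with E(1,2) show thesis by (rule that)
qed

end

section \<open>The restriction of the submersion to the leaves\<close>

locale poisson_leaf_map = poisson_fibration_leaves +
  assumes maps: "p ` S \<subseteq> L"
begin

abbreviation "SN \<equiv> submfd N S"
abbreviation "LM \<equiv> submfd M L"

lemma S_pts: "x \<in> S \<Longrightarrow> x \<in> pts N"
  using S.sub by blast

lemma S_to_L: "x \<in> S \<Longrightarrow> p x \<in> L"
  using maps by blast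

lemma smooth_on_leaf: "smooth_map SN LM p"
proof (rule L.initial[OF S.N.smooth_atlas_axioms])
  show "smooth_map SN M p"
    by (rule smooth_map_compose[OF S.incl_smooth smooth S.N.smooth_atlas_axioms N.smooth_atlas_axioms M.smooth_atlas_axioms])
qed (use S_to_L in simp)

sublocale q: smooth_atlas_map SN LM p
  by unfold_locales (rule smooth_on_leaf)

lemma push_incl:
  assumes x: "x \<in> S"
  shows "incl_push M (p x) (push LM p x u) = push M p x (incl_push N x u)"
proof -
  have "incl_push M (p x) (push LM p x u) = push M p x u"
    by (rule push_push[OF L.incl.smooth_atlas_map_axioms]) (use S_to_L[OF x] in simp)
  moreover have "push M p x (incl_push N x u) = push M p x u"
    using push_push[OF smooth_atlas_map_axioms, of "\<lambda>y. y" x u] S_pts[OF x] by simp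
  ultimately show ?thesis by simp
qed

lemma pull_restr:
  assumes x: "x \<in> S"
  shows "pull SN LM p x (L.restr (p x) \<xi>) = S.restr x (pull N M p x \<xi>)"
  using pull_pull[OF q.smooth_atlas_map_axioms L.incl.smooth_atlas_map_axioms, of x \<xi>]
    pull_pull[OF S.incl.smooth_atlas_map_axioms smooth_atlas_map_axioms, of x \<xi>] x by simp

text \<open>A vector tangent to L is \<open>sharp M\<close> of some \<zeta>. The image under
  \<open>sharp N\<close> of the pullback of \<zeta> is tangent to S, because S is a leaf, and
  projects to it by \<open>push_sharp_pull\<close>.\<close>

sublocale q: submersion_atlas SN LM p
proof
  fix x assume "x \<in> pts SN"
  then have x: "x \<in> S" by simp
  show "push LM p x ` tangent SN x = tangent LM (p x)"
  proof (intro set_eqI iffI)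
    fix v assume "v \<in> push LM p x ` tangent SN x"
    then show "v \<in> tangent LM (p x)" using q.push_tangent by (elim imageE) simp
  next
    fix v assume v: "v \<in> tangent LM (p x)"
    obtain \<zeta> where \<zeta>: "\<zeta> \<in> cotangent M (p x)" "incl_push M (p x) v = sharp M \<pi>\<^sub>M (p x) \<zeta>" by (rule L.lower_tangent[OF v])
    obtain u where u: "u \<in> tangent SN x" "incl_push N x u = sharp N \<pi>\<^sub>N x (pull N M p x \<zeta>)"
      by (rule S.lift_sharp[OF x pull_cotangent[OF \<zeta>(1)]])
    have "incl_push M (p x) (push LM p x u) = incl_push M (p x) v"
      unfolding push_incl[OF x] u(2) \<zeta>(2) by (rule push_sharp_pull[OF S_pts[OF x] \<zeta>(1)])
    then have "push LM p x u = v" by (rule L.incl_push_inj[OF q.push_tangent[OF u(1)] v])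
    then show "v \<in> push LM p x ` tangent SN x" using u(1) by (rule image_eqI[OF sym])
  qed
qed

lemma leaf_submersion: "submersion SN LM p"
  unfolding submersion_def using smooth_on_leaf q.onto by blast

text \<open>Covectors on L are restrictions of covectors of M, restriction commutes with pullback,
  and on restrictions the leaf bivectors are the given ones.\<close>

lemma leaf_poisson_map: "poisson_map SN S.\<sigma> LM L.\<sigma> p"
  unfolding poisson_map_def
proof (intro conjI ballI smooth_on_leaf)
  fix x \<alpha> \<beta> assume "x \<in> pts SN" and \<alpha>: "\<alpha> \<in> cotangent LM (p x)" and \<beta>: "\<beta> \<in> cotangent LM (p x)"
  then have x: "x \<in> S" by simp
  note px = S_to_L[OF x]
  obtain \<xi> where \<xi>: "\<xi> \<in> cotangent M (p x)" "\<alpha> = L.restr (p x) \<xi>" by (rule L.cotangent_extension[OF \<alpha> px])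
  obtain \<eta> where \<eta>: "\<eta> \<in> cotangent M (p x)" "\<beta> = L.restr (p x) \<eta>" by (rule L.cotangent_extension[OF \<beta> px])
  show "S.\<sigma> x (pull SN LM p x \<alpha>) (pull SN LM p x \<beta>) = L.\<sigma> (p x) \<alpha> \<beta>"
    unfolding \<xi>(2) \<eta>(2) pull_restr[OF x] L.leaf_bivector_restr[OF px \<xi>(1) \<eta>(1)]
      S.leaf_bivector_restr[OF x pull_cotangent[OF \<xi>(1)] pull_cotangent[OF \<eta>(1)]]
    by (rule poisson[OF S_pts[OF x] \<xi>(1) \<eta>(1)])
qed

lemma push_vertical:
  assumes x: "x \<in> S" and u: "u \<in> tangent SN x"
  shows "push LM p x u = (\<lambda>f. 0) \<longleftrightarrow> push M p x (incl_push N x u) = (\<lambda>f. 0)"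
proof -
  have z: "incl_push M (p x) (\<lambda>f. 0) = (\<lambda>f. 0)" by (simp add: push_def)
  have t: "(\<lambda>f. 0) \<in> tangent LM (p x)" by (rule L.N.tangent_zero) (use S_to_L[OF x] in simp)
  show ?thesis
    unfolding push_incl[OF x, symmetric] using L.incl_push_inj[OF q.push_tangent[OF u] t] z by auto
qed

lemma fibre_tangent: "x \<in> S \<Longrightarrow> tangent_sub SN {z \<in> S. p z = p x} x = {v \<in> tangent SN x. push LM p x v = (\<lambda>f. 0)}"
  using q.fibre_tangent_sub[of x] by simp

lemma pull_conormal:
  assumes x: "x \<in> S" and \<zeta>: "\<zeta> \<in> cotangent M (p x)"
  shows "S.restr x (pull N M p x \<zeta>) \<in> conormal SN {z \<in> S. p z = p x} x"
proof -
  have c: "pull N M p x \<zeta> \<in> cotangent N x" by (rule pull_cotangent[OF \<zeta>])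
  have "S.restr x (pull N M p x \<zeta>) v = 0" if v: "v \<in> tangent SN x" "push LM p x v = (\<lambda>f. 0)" for v
  proof -
    have "S.restr x (pull N M p x \<zeta>) v = \<zeta> (push M p x (incl_push N x v))"
      unfolding S.incl.pull_apply[OF v(1)] by (rule pull_apply[OF S.incl.push_tangent[OF v(1)]])
    also have "push M p x (incl_push N x v) = (\<lambda>f. 0)" using push_vertical[OF x v(1)] v(2) by simp
    finally show ?thesis using M.cotangent_at_zero[OF \<zeta> p_pts[OF S_pts[OF x]]] by simp
  qed
  then show ?thesis unfolding conormal_def fibre_tangent[OF x] using S.incl.pull_cotangent[OF c] by blast
qed

text \<open>Every \<eta> takes the value 0 on d. A pullback from M does so because d is vertical.
  For the part \<xi>1 with vertical image, skew-symmetry gives minus the value of \<xi> on that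
  image, and this is zero because \<alpha> is conormal.\<close>

lemma fibre_transversal:
  assumes x: "x \<in> S" and d: "d \<in> tangent_sub SN {z \<in> S. p z = p x} x"
    and \<alpha>: "\<alpha> \<in> conormal SN {z \<in> S. p z = p x} x" "d = sharp SN S.\<sigma> x \<alpha>"
  shows "d = (\<lambda>f. 0)"
proof -
  note xN = S_pts[OF x]
  have dt: "d \<in> tangent SN x" and dv: "push LM p x d = (\<lambda>f. 0)" using d unfolding fibre_tangent[OF x] by auto
  have \<alpha>c: "\<alpha> \<in> cotangent SN x" and \<alpha>0: "\<And>v. v \<in> tangent SN x \<Longrightarrow> push LM p x v = (\<lambda>f. 0) \<Longrightarrow> \<alpha> v = 0"
    using \<alpha>(1) unfolding conormal_def fibre_tangent[OF x] by auto
  obtain \<xi> where \<xi>: "\<xi> \<in> cotangent N x" "\<alpha> = S.restr x \<xi>" by (rule S.cotangent_extension[OF \<alpha>c x])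
  have id: "incl_push N x d = sharp N \<pi>\<^sub>N x \<xi>" unfolding \<alpha>(2) \<xi>(2) by (rule S.leaf_sharp(2)[OF x \<xi>(1)])
  have "incl_push N x d = (\<lambda>f. 0)"
  proof (rule N.tangent_separated[OF S.incl.push_tangent[OF dt] N.tangent_zero[OF xN]])
    fix \<eta> assume \<eta>: "\<eta> \<in> cotangent N x"
    obtain \<xi>1 \<zeta> where dec: "\<xi>1 \<in> cotangent N x" "\<zeta> \<in> cotangent M (p x)"
      "push M p x (sharp N \<pi>\<^sub>N x \<xi>1) = (\<lambda>f. 0)" "\<eta> = (\<lambda>v. 1 * \<xi>1 v + 1 * pull N M p x \<zeta> v)"
      by (rule vertical_decomposition[OF xN \<eta>]) (rule that)
    have "pull N M p x \<zeta> (incl_push N x d) = 0"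
      using pull_apply[OF S.incl.push_tangent[OF dt], of \<zeta>] push_vertical[OF x dt] dv
        M.cotangent_at_zero[OF dec(2) p_pts[OF xN]] by simp
    moreover have "\<xi>1 (incl_push N x d) = 0"
    proof -
      obtain w where w: "w \<in> tangent SN x" "incl_push N x w = sharp N \<pi>\<^sub>N x \<xi>1" by (rule S.lift_sharp[OF x dec(1)])
      have "\<alpha> w = 0" by (rule \<alpha>0[OF w(1)]) (use push_vertical[OF x w(1)] w(2) dec(3) in simp)
      then have "\<xi> (sharp N \<pi>\<^sub>N x \<xi>1) = 0" unfolding \<xi>(2) S.incl.pull_apply[OF w(1)] w(2) .
      then show ?thesis unfolding id using S.sharp_swap[OF x dec(1) \<xi>(1)] by simp
    qed
    ultimately show "\<eta> (incl_push N x d) = \<eta> (\<lambda>f. 0)" using N.cotangent_at_zero[OF \<eta> xN] dec(4) by simp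
  qed
  moreover have "incl_push N x (\<lambda>f. 0) = (\<lambda>f. 0)" by (simp add: push_def)
  moreover have "(\<lambda>f. 0) \<in> tangent SN x" by (rule S.N.tangent_zero) (use x in simp)
  ultimately show ?thesis using S.incl_push_inj[OF dt] by metis
qed

text \<open>A tangent vector w of S is the image of some \<xi>; the two parts of the vertical
  decomposition of \<xi> give a vertical vector and the image of a conormal covector. The difference
  of two such splittings lies in both summands and vanishes by
  \<open>fibre_transversal\<close>.\<close>

lemma fibre_poisson_transversal:
  assumes mS: "smooth_manifold SN" and mL: "smooth_manifold LM" and x0: "x0 \<in> S"
  shows "poisson_transversal SN S.\<sigma> {z \<in> S. p z = p x0}"
  unfolding poisson_transversal_def
proof (intro conjI ballI)
  let ?F = "{z \<in> S. p z = p x0}"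
  show "embedded_submanifold SN ?F"
    using q.fibre_embedded[OF mS mL, of "p x0"] S_to_L[OF x0] by simp
  have F: "{z \<in> S. p z = p x} = ?F" "x \<in> S" if "x \<in> ?F" for x using that by auto
  have xNS: "x \<in> pts SN" if "x \<in> S" for x using that by simp
  note sh = S.N.sharp_tangent[OF S.leaf_smooth_bivector xNS]
  have con: "\<alpha> \<in> cotangent SN x" if "\<alpha> \<in> conormal SN ?F x" for \<alpha> x using that unfolding conormal_def by simp
  have ts: "u \<in> tangent SN x" if "u \<in> tangent_sub SN ?F x" "x \<in> ?F" for u x
    using that(1) fibre_tangent[OF F(2)[OF that(2)]] F(1)[OF that(2)] by simp
  {
    fix x u v assume x: "x \<in> ?F" and u: "u \<in> tangent_sub SN ?F x" and "v \<in> sharp SN S.\<sigma> x ` conormal SN ?F x"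
    then obtain \<alpha> where \<alpha>: "\<alpha> \<in> conormal SN ?F x" "v = sharp SN S.\<sigma> x \<alpha>" by (elim imageE)
    show "(\<lambda>f. u f + v f) \<in> tangent SN x"
      using S.N.tangent_combination[OF ts[OF u x] sh[OF F(2)[OF x] con[OF \<alpha>(1)]], of 1 1] \<alpha>(2) by simp
  }
  fix x w assume x: "x \<in> ?F" and w: "w \<in> tangent SN x"
  note xS = F(2)[OF x]
  note xN = S_pts[OF xS]
  let ?R = "\<lambda>(u, v). u \<in> tangent_sub SN ?F x \<and> v \<in> sharp SN S.\<sigma> x ` conormal SN ?F x \<and> w = (\<lambda>f. u f + v f)"
  show "\<exists>!z. ?R z"
  proof (rule ex_ex1I)
    obtain \<xi> where \<xi>: "\<xi> \<in> cotangent N x" "incl_push N x w = sharp N \<pi>\<^sub>N x \<xi>" by (rule S.lower_tangent[OF w])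
    obtain \<xi>1 \<zeta> where dec: "\<xi>1 \<in> cotangent N x" "\<zeta> \<in> cotangent M (p x)"
      "push M p x (sharp N \<pi>\<^sub>N x \<xi>1) = (\<lambda>f. 0)" "\<xi> = (\<lambda>v. 1 * \<xi>1 v + 1 * pull N M p x \<zeta> v)"
      by (rule vertical_decomposition[OF xN \<xi>(1)]) (rule that)
    obtain u where u: "u \<in> tangent SN x" "incl_push N x u = sharp N \<pi>\<^sub>N x \<xi>1" by (rule S.lift_sharp[OF xS dec(1)])
    define v where "v = sharp SN S.\<sigma> x (S.restr x (pull N M p x \<zeta>))"
    note v = S.leaf_sharp[OF xS pull_cotangent[OF dec(2)], folded v_def]
    have "u \<in> tangent_sub SN ?F x"
      using push_vertical[OF xS u(1)] u dec(3) fibre_tangent[OF xS] F(1)[OF x] by simp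
    moreover have "v \<in> sharp SN S.\<sigma> x ` conormal SN ?F x"
      unfolding v_def using pull_conormal[OF xS dec(2)] F(1)[OF x] by (intro imageI) simp
    moreover have "w = (\<lambda>f. 1 * u f + 1 * v f)"
    proof (rule S.incl_push_inj[OF w S.N.tangent_combination[OF u(1) v(1)]])
      show "incl_push N x w = incl_push N x (\<lambda>f. 1 * u f + 1 * v f)"
        unfolding \<xi>(2) dec(4) push_combination u(2) v(2)
        by (rule N.sharp_combination[OF bivN xN dec(1) pull_cotangent[OF dec(2)]])
    qed
    ultimately have "?R (u, v)" by simp
    then show "\<exists>z. ?R z" by (rule exI)
  next
    fix z z' assume z: "?R z" and z': "?R z'"
    obtain u v where uv: "z = (u, v)" by (cases z)
    obtain u' v' where uv': "z' = (u', v')" by (cases z')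
    have u: "u \<in> tangent_sub SN ?F x" "u' \<in> tangent_sub SN ?F x" and eq: "w = (\<lambda>f. u f + v f)" "w = (\<lambda>f. u' f + v' f)"
      and "v \<in> sharp SN S.\<sigma> x ` conormal SN ?F x" "v' \<in> sharp SN S.\<sigma> x ` conormal SN ?F x"
      using z z' unfolding uv uv' by simp_all
    then obtain \<alpha> \<alpha>' where \<alpha>: "\<alpha> \<in> conormal SN ?F x" "v = sharp SN S.\<sigma> x \<alpha>"
      and \<alpha>': "\<alpha>' \<in> conormal SN ?F x" "v' = sharp SN S.\<sigma> x \<alpha>'" by (elim imageE)
    \<comment> \<open>From u + v = u' + v' one has u - u' = v' - v, hence the opposite signs in
      \<open>?d\<close> and \<open>?\<alpha>\<close>.\<close>
    let ?d = "\<lambda>f. 1 * u f + (-1) * u' f" and ?\<alpha> = "\<lambda>v. (-1) * \<alpha> v + 1 * \<alpha>' v"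
    have uu: "u f + v f = u' f + v' f" for f using fun_cong[OF eq(1), of f] fun_cong[OF eq(2), of f] by simp
    have fs: "tangent_sub SN {z \<in> S. p z = p x} x = {v \<in> tangent SN x. push LM p x v = (\<lambda>f. 0)}"
      by (rule fibre_tangent[OF xS])
    have "?d = (\<lambda>f. 0)"
    proof (rule fibre_transversal[OF xS])
      show "?d \<in> tangent_sub SN {z \<in> S. p z = p x} x"
        using u S.N.tangent_combination[of u x u' 1 "-1"] push_combination[of LM p x 1 u "-1" u'] unfolding fs F(1)[OF x, symmetric] by simp
      show "?\<alpha> \<in> conormal SN {z \<in> S. p z = p x} x"
        using \<alpha>(1) \<alpha>'(1) S.N.cotangent_combination[of \<alpha> x \<alpha>' "-1" 1] unfolding conormal_def F(1)[OF x] by simp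
      have "sharp SN S.\<sigma> x ?\<alpha> = (\<lambda>f. (-1) * v f + 1 * v' f)"
        unfolding \<alpha>(2) \<alpha>'(2)
        by (rule S.N.sharp_combination[OF S.leaf_smooth_bivector xNS[OF xS] con[OF \<alpha>(1)] con[OF \<alpha>'(1)]])
      moreover have "?d = (\<lambda>f. (-1) * v f + 1 * v' f)"
      proof
        show "1 * u f + (-1) * u' f = (-1) * v f + 1 * v' f" for f using uu[of f] by simp
      qed
      ultimately show "?d = sharp SN S.\<sigma> x ?\<alpha>" by simp
    qed
    then have 1: "u f = u' f" for f using fun_cong[of ?d "\<lambda>f. 0" f] by simp
    moreover have "v f = v' f" for f using uu[of f] 1[of f] by simp
    ultimately have "u = u'" "v = v'" by (auto intro: ext)
    then show "z = z'" unfolding uv uv' by simp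
  qed
qed

lemma leaf_coupling:
  assumes N: "poisson_manifold N \<pi>\<^sub>N" and M: "poisson_manifold M \<pi>\<^sub>M"
    and mS: "smooth_manifold SN" and mL: "smooth_manifold LM"
  shows "poisson_submersion SN S.\<sigma> LM L.\<sigma> p \<and> coupling SN S.\<sigma> LM p"
proof -
  note PS = S.leaf_poisson_manifold[OF N mS]
  have "poisson_transversal SN S.\<sigma> {x \<in> pts SN. p x = y}" if "y \<in> p ` pts SN" for y
    using that fibre_poisson_transversal[OF mS mL] by auto
  then show ?thesis
    unfolding poisson_submersion_def coupling_def
    using PS L.leaf_poisson_manifold[OF M mL] leaf_submersion leaf_poisson_map by blast
qed

end

section \<open>From local to global statements about leaves\<close>

lemma symplectic_leafD:
  assumes "symplectic_leaves M \<pi> S" "poisson_manifold M \<pi>" "x \<in> pts M"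
  shows "poisson_leaf M (S x) \<pi>" "x \<in> S x" "\<And>y. y \<in> S x \<Longrightarrow> S y = S x" "initial_submanifold M (S x)"
    "connected_space (mtop (submfd M (S x)))" "\<And>y. y \<in> S x \<Longrightarrow> tangent_sub M (S x) y = sharp M \<pi> y ` cotangent M y"
proof -
  show S: "x \<in> S x" "\<And>y. y \<in> S x \<Longrightarrow> S y = S x" "initial_submanifold M (S x)"
    "connected_space (mtop (submfd M (S x)))" "\<And>y. y \<in> S x \<Longrightarrow> tangent_sub M (S x) y = sharp M \<pi> y ` cotangent M y"
    using assms(1,3) unfolding symplectic_leaves_def by blast+
  have "smooth_atlas M" "smooth_bivector M \<pi>"
    using assms(2) smooth_manifold_atlas unfolding poisson_manifold_def by blast+
  then show "poisson_leaf M (S x) \<pi>"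
    unfolding poisson_leaf_def poisson_leaf_axioms_def using initial_submanifold_locale S(3,5) by blast
qed

context poisson_fibration
begin

text \<open>\<open>leaf_preimage_local\<close> holds at each point z of \<open>S x\<close> with the
  leaf through p z as target. The preimages of leaves of M therefore cut \<open>S x\<close> into
  disjoint open sets, and \<open>S x\<close> is connected.\<close>

lemma leaf_into_leaf:
  assumes N: "poisson_manifold N \<pi>\<^sub>N" and M: "poisson_manifold M \<pi>\<^sub>M"
    and S: "symplectic_leaves N \<pi>\<^sub>N S" and L: "symplectic_leaves M \<pi>\<^sub>M L" and x: "x \<in> pts N"
  shows "p ` S x \<subseteq> L (p x)"
proof -
  note Sx = symplectic_leafD[OF S N x]
  note Ly = symplectic_leafD[OF L M]
  interpret Sx: poisson_leaf N "S x" \<pi>\<^sub>N by (rule Sx(1))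
  have loc: "\<exists>D. openin (mtop (submfd N (S x))) D \<and> z \<in> D \<and> p ` D \<subseteq> L (p z)" if z: "z \<in> S x" for z
  proof -
    have zN: "z \<in> pts N" by (rule Sx.in_pts[OF z])
    interpret Lz: poisson_leaf M "L (p z)" \<pi>\<^sub>M by (rule Ly(1)[OF p_pts[OF zN]])
    interpret both: poisson_fibration_leaves N M p \<pi>\<^sub>N \<pi>\<^sub>M "S x" "L (p z)" by unfold_locales
    obtain D where "openin (mtop (submfd N (S x))) D" "z \<in> D" "p ` D \<subseteq> L (p z)"
      by (rule both.leaf_preimage_local[OF z Ly(2)[OF p_pts[OF zN]]])
    then show ?thesis by blast
  qed
  let ?G = "{z \<in> S x. p z \<in> L (p x)}"
  note px = p_pts[OF x]
  have eq: "L (p z) = L (p x)" if "p z \<in> L (p x)" for z by (rule Ly(3)[OF px that])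
  have "openin (mtop (submfd N (S x))) ?G"
  proof (subst openin_subopen, intro ballI)
    fix z assume z: "z \<in> ?G"
    then obtain D where D: "openin (mtop (submfd N (S x))) D" "z \<in> D" "p ` D \<subseteq> L (p z)" using loc by blast
    have "D \<subseteq> ?G" using D(3) eq[of z] z openin_subset[OF D(1)] Sx.N.topspace_mtop by auto
    then show "\<exists>T. openin (mtop (submfd N (S x))) T \<and> z \<in> T \<and> T \<subseteq> ?G" using D(1,2) by blast
  qed
  moreover have "openin (mtop (submfd N (S x))) (S x - ?G)"
  proof (subst openin_subopen, intro ballI)
    fix z assume z: "z \<in> S x - ?G"
    then obtain D where D: "openin (mtop (submfd N (S x))) D" "z \<in> D" "p ` D \<subseteq> L (p z)" using loc by blast
    have pz: "p z \<in> pts M" using z Sx.in_pts p_pts by blast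
    have "D \<subseteq> S x - ?G"
    proof
      fix y assume y: "y \<in> D"
      have "p y \<in> L (p z)" using y D(3) by blast
      then have "L (p y) = L (p z)" by (rule Ly(3)[OF pz])
      \<comment> \<open>Leaves with a common point coincide, so p y in the leaf through p x would
        put p z there as well.\<close>
      then have "p y \<notin> L (p x)" using eq[of y] Ly(2)[OF pz] z by auto
      then show "y \<in> S x - ?G" using y openin_subset[OF D(1)] Sx.N.topspace_mtop by auto
    qed
    then show "\<exists>T. openin (mtop (submfd N (S x))) T \<and> z \<in> T \<and> T \<subseteq> S x - ?G" using D(1,2) by blast
  qed
  then have "closedin (mtop (submfd N (S x))) ?G"
    unfolding closedin_def Sx.N.topspace_mtop by auto
  ultimately have "?G = {} \<or> ?G = S x"
    using Sx(5) Sx.N.topspace_mtop unfolding connected_space_clopen_in by (metis submfd_simps)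
  moreover have "x \<in> ?G" using Sx(2) Ly(2)[OF px] by simp
  ultimately show ?thesis by blast
qed

end

theorem theorem3p11:
  fixes \<Sigma> :: "('a, 'e::euclidean_space) mfd" and \<pi>\<^sub>\<Sigma> :: "'a bivector"
    and M :: "('b, 'f::euclidean_space) mfd" and \<pi>\<^sub>M :: "'b bivector"
    and p :: "'a \<Rightarrow> 'b"
    and S\<^sub>\<Sigma> :: "'a \<Rightarrow> 'a set" and S\<^sub>M :: "'b \<Rightarrow> 'b set"
  assumes "poisson_submersion \<Sigma> \<pi>\<^sub>\<Sigma> M \<pi>\<^sub>M p"
    and "poisson_fibres \<Sigma> \<pi>\<^sub>\<Sigma> p"
    and "symplectic_leaves \<Sigma> \<pi>\<^sub>\<Sigma> S\<^sub>\<Sigma>"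
    and "symplectic_leaves M \<pi>\<^sub>M S\<^sub>M"
  shows "(\<forall>y\<in>pts M. poisson_submanifold \<Sigma> \<pi>\<^sub>\<Sigma> {x \<in> pts \<Sigma>. p x \<in> S\<^sub>M y}) \<and>
    (\<forall>x\<in>pts \<Sigma>.
       poisson_submersion
         (submfd \<Sigma> (S\<^sub>\<Sigma> x)) (leaf_bivector \<Sigma> \<pi>\<^sub>\<Sigma> (S\<^sub>\<Sigma> x))
         (submfd M (S\<^sub>M (p x))) (leaf_bivector M \<pi>\<^sub>M (S\<^sub>M (p x))) p \<and>
       coupling
         (submfd \<Sigma> (S\<^sub>\<Sigma> x)) (leaf_bivector \<Sigma> \<pi>\<^sub>\<Sigma> (S\<^sub>\<Sigma> x))
         (submfd M (S\<^sub>M (p x))) p)"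
proof -
  have P\<Sigma>: "poisson_manifold \<Sigma> \<pi>\<^sub>\<Sigma>" and PM: "poisson_manifold M \<pi>\<^sub>M"
    and sub: "submersion \<Sigma> M p" and map: "poisson_map \<Sigma> \<pi>\<^sub>\<Sigma> M \<pi>\<^sub>M p"
    using assms(1) unfolding poisson_submersion_def by blast+
  have m\<Sigma>: "smooth_manifold \<Sigma>" and mM: "smooth_manifold M"
    and b\<Sigma>: "smooth_bivector \<Sigma> \<pi>\<^sub>\<Sigma>" and bM: "smooth_bivector M \<pi>\<^sub>M"
    using P\<Sigma> PM unfolding poisson_manifold_def by blast+
  interpret N: smooth_atlas \<Sigma> by (rule smooth_manifold_atlas[OF m\<Sigma>])
  interpret M: smooth_atlas M by (rule smooth_manifold_atlas[OF mM])
  interpret fib: poisson_fibration \<Sigma> M p \<pi>\<^sub>\<Sigma> \<pi>\<^sub>M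
    by unfold_locales (use sub map b\<Sigma> bM assms(2) in \<open>auto simp: submersion_def poisson_map_def\<close>)
  note leaf\<Sigma> = symplectic_leafD[OF assms(3) P\<Sigma>] and leafM = symplectic_leafD[OF assms(4) PM]
  show ?thesis
  proof (intro conjI[where P = "\<forall>y\<in>pts M. _ y"] ballI)
    fix y assume y: "y \<in> pts M"
    show "poisson_submanifold \<Sigma> \<pi>\<^sub>\<Sigma> {x \<in> pts \<Sigma>. p x \<in> S\<^sub>M y}"
      by (rule fib.preimage_poisson_submanifold[OF m\<Sigma> mM leafM(4,6)[OF y]])
  next
    fix x assume x: "x \<in> pts \<Sigma>"
    interpret S: poisson_leaf \<Sigma> "S\<^sub>\<Sigma> x" \<pi>\<^sub>\<Sigma> by (rule leaf\<Sigma>(1)[OF x])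
    interpret L: poisson_leaf M "S\<^sub>M (p x)" \<pi>\<^sub>M by (rule leafM(1)[OF fib.p_pts[OF x]])
    interpret map: poisson_leaf_map \<Sigma> M p \<pi>\<^sub>\<Sigma> \<pi>\<^sub>M "S\<^sub>\<Sigma> x" "S\<^sub>M (p x)"
      by unfold_locales (rule fib.leaf_into_leaf[OF P\<Sigma> PM assms(3,4) x])
    show "poisson_submersion
         (submfd \<Sigma> (S\<^sub>\<Sigma> x)) (leaf_bivector \<Sigma> \<pi>\<^sub>\<Sigma> (S\<^sub>\<Sigma> x))
         (submfd M (S\<^sub>M (p x))) (leaf_bivector M \<pi>\<^sub>M (S\<^sub>M (p x))) p \<and>
       coupling
         (submfd \<Sigma> (S\<^sub>\<Sigma> x)) (leaf_bivector \<Sigma> \<pi>\<^sub>\<Sigma> (S\<^sub>\<Sigma> x))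
         (submfd M (S\<^sub>M (p x))) p"
      by (rule map.leaf_coupling[OF P\<Sigma> PM])
        (use leaf\<Sigma>(4)[OF x] leafM(4)[OF fib.p_pts[OF x]] in \<open>auto simp: initial_submanifold_def\<close>)
  qed
qed

end
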